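(* Let $n,k,m$ be positive integers with $k+m\le n$, let $\omega\in S_n$, and let $r[k,m]$ denote the $(m+1)$-cycle $(k+m\ \ k+m-1\ \ \ldots\ \ k+1\ \ k)$. Let $r[k,m]\cdot\mathcal T_\omega$ be the set of those labelled tower diagrams in $k_{(m)}\cdot\mathcal T_\omega$, with labels $(1,a_1,b_1),\ldots,(m,a_m,b_m)$, such that (i) $a_1\ge a_2\ge\cdots\ge a_m$, and (ii) no two labelled cells lie in the same tower of the diagram. Then $$\mathfrak S_\omega\,\mathfrak S_{r[k,m]}=\sum_{\mathcal T\in r[k,m]\cdot\mathcal T_\omega}\mathfrak S_{\omega_{\mathcal T}},$$ where $\omega_{\mathcal T}$ is the permutation whose tower diagram is the underlying diagram of $\mathcal T$.
   Context: $\mathfrak S_w$ denotes the Schubert polynomial of a permutation $w$. Permutations are composed as functions, $(\sigma\tau)(x)=\sigma(\tau(x))$; $t_{a,b}$ is the transposition exchanging $a$ and $b$; $\ell$ is Coxeter length; a cycle $(c_1\,c_2\,\ldots\,c_p)$ maps $c_1\mapsto c_2\mapsto\cdots\mapsto c_p\mapsto c_1$. Tower diagrams: a tower diagram is a sequence $\mathcal T=(\mathcal T_1,\mathcal T_2,\ldots)$ of nonnegative integers, almost all zero; $\mathcal T_p$ is the height of the $p$-th tower. A cell is identified with the south-east corner $(a,b)$ of the unit square $[a-1,a]\times[b,b+1]$; the cell $(a,b)$ belongs to $\mathcal T$ iff $0\le b<\mathcal T_a$. The slide of $(a,b)$ is $a+b$. Sliding a positive integer $i$ into $\mathcal T$ produces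 a diagram $i\searrow\mathcal T$: set $s:=i$ and examine towers $p=1,2,\ldots$ in order, with $h=\mathcal T_p$: if $s>p+h$ go to the next tower; if $s=p+h$ increase $\mathcal T_p$ by one and stop; if $h\ge1$ and $s=p+h-1$ decrease $\mathcal T_p$ by one and stop; if $s<p+h-1$ replace $s$ by $s+1$ and go to the next tower. For a word $\alpha=\alpha_1\cdots\alpha_l$, $\alpha\searrow\mathcal T=\alpha_l\searrow(\cdots(\alpha_1\searrow\mathcal T))$. For a permutation $w$ with reduced word $\alpha$ (i.e. $w=s_{\alpha_1}\cdots s_{\alpha_l}$, $l=\ell(w)$, $s_p=t_{p,p+1}$), its tower diagram is $\mathcal T_w:=\alpha\searrow\varnothing$ (independent of the reduced word); $w\mapsto\mathcal T_w$ is a bijection, with inverse $\mathcal T\mapsto\omega_{\mathcal T}$. Saturated chains: fix $k$. A saturated $k$-Bruhat chain of length $m$ from $\omega$ is a sequence $(a_1,b_1),\ldots,(a_m,b_m)$ of pairs of positive integers with $a_q\le k<b_q$ and $\ell(\omega^{(q)})=\ell(\omega^{(q-1)})+1$ for all $q$, where $\omega^{(0)}=\omega$ and $\omega^{(q)}=\omega^{(q-1)}t_{a_q,b_q}$. It is known that in this situation $\mathcal T_{\omega^{(q)}}$ is obtained from $D:=\mathcal T_{\omega^{(q-1)}}$ by raising tower $s=\omega^{(q-1)}(a_q)$ by $r+1$ cells and lowering tower $l=\omega^{(q-1)}(b_q)$ by $r$ cells for some $r\ge0$, other towers unchanged. The set $k_{(m)}\cdot\mathcal T_\omega$ consists, for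 each such chain, of the diagram $\mathcal T_{\omega^{(m)}}$ together with the labels $(1,a_1,b_1),\ldots,(m,a_m,b_m)$ (different chains give different elements even if the diagrams coincide). Each label is attached to a cell, tracked as follows: at step $q$, label $(q,a_q,b_q)$ is attached to the cell $(s,D_s)$ (the lowest new cell of the raised tower); previously labelled cells keep their positions, except that a labelled cell among the removed cells $(l,D_l-r+u)$, $0\le u<r$, is carried to the cell $(s,D_s+1+u)$. *)

theory Defs
  imports
    "HOL-Library.Poly_Mapping"
    "HOL-Combinatorics.Permutations"
    "HOL-Combinatorics.Cycles"
begin

section \<open>Permutations\<close>

text \<open>
  Permutations act on the positive integers: an element of $S_n$ is a function on
  \<^typ>\<open>nat\<close> that permutes \<open>{1..n}\<close> and hence fixes every other number (also \<open>0\<close>).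
  Composition of functions is the product.
\<close>

definition fin_perm :: "(nat \<Rightarrow> nat) \<Rightarrow> bool" where
  "fin_perm w \<longleftrightarrow> (\<exists>n. w permutes {1..n})"

definition simple_refl :: "nat \<Rightarrow> nat \<Rightarrow> nat" where
  "simple_refl p = transpose p (Suc p)"

definition word_perm :: "nat list \<Rightarrow> nat \<Rightarrow> nat" where
  "word_perm \<alpha> = foldr (\<lambda>p v. simple_refl p \<circ> v) \<alpha> id"

definition is_word_of :: "nat list \<Rightarrow> (nat \<Rightarrow> nat) \<Rightarrow> bool" where
  "is_word_of \<alpha> w \<longleftrightarrow> (\<forall>p\<in>set \<alpha>. 0 < p) \<and> word_perm \<alpha> = w"

definition coxeter_length :: "(nat \<Rightarrow> nat) \<Rightarrow> nat" where
  "coxeter_length w = (LEAST l. \<exists>\<alpha>. is_word_of \<alpha> w \<and> length \<alpha> = l)"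

definition reduced_word :: "nat list \<Rightarrow> (nat \<Rightarrow> nat) \<Rightarrow> bool" where
  "reduced_word \<alpha> w \<longleftrightarrow> is_word_of \<alpha> w \<and> length \<alpha> = coxeter_length w"

text \<open>The cycle \<open>(k+m  k+m-1  ...  k+1  k)\<close>, sending each entry to the next one.\<close>

definition pieri_cycle :: "nat \<Rightarrow> nat \<Rightarrow> nat \<Rightarrow> nat" where
  "pieri_cycle k m = cycle_of_list (rev [k..<Suc (k + m)])"


section \<open>Schubert polynomials\<close>

text \<open>
  Polynomials over the integers in variables \<open>x\<^sub>i\<close> indexed by \<^typ>\<open>nat\<close> (only \<open>i \<ge> 1\<close> is used):
  a monomial is its exponent function, of finite support.
\<close>

type_synonym mpol = "(nat \<Rightarrow>\<^sub>0 nat) \<Rightarrow>\<^sub>0 int"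

definition var :: "nat \<Rightarrow> mpol" where
  "var i = Poly_Mapping.single (Poly_Mapping.single i 1) 1"

text \<open>Exchange of the variables \<open>x\<^sub>i\<close> and \<open>x\<^sub>i\<^sub>+\<^sub>1\<close>: the coefficient of a monomial in the result is
  the coefficient in \<open>f\<close> of that monomial with its \<open>i\<close>-th and \<open>(i+1)\<close>-st exponent exchanged.\<close>

definition swap_vars :: "nat \<Rightarrow> mpol \<Rightarrow> mpol" where
  "swap_vars i f = Poly_Mapping.map_key (Poly_Mapping.map_key (transpose i (Suc i))) f"

text \<open>Newton's divided difference $(f - s_i f)/(x_i - x_{i+1})$; the division is exact and
  the quotient is unique.\<close>

definition divided_difference :: "nat \<Rightarrow> mpol \<Rightarrow> mpol" where
  "divided_difference i f = (THE g. f - swap_vars i f = (var i - var (Suc i)) * g)"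

definition longest_perm :: "nat \<Rightarrow> nat \<Rightarrow> nat" where
  "longest_perm n i = (if 1 \<le> i \<and> i \<le> n then Suc n - i else i)"

definition staircase_monomial :: "nat \<Rightarrow> mpol" where
  "staircase_monomial n = (\<Prod>i=1..n. var i ^ (n - i))"

text \<open>Lascoux and Schuetzenberger: for $w \in S_n$ the Schubert polynomial is
  $\partial_u (x_1^{n-1} x_2^{n-2} \cdots x_{n-1})$ with $u = w^{-1} w_0$, where
  $\partial_u = \partial_{\alpha_1} \cdots \partial_{\alpha_l}$ for any reduced word of $u$.
  It does not depend on the \<open>n\<close> with $w \in S_n$; the least one is taken.\<close>

definition schubert_in :: "nat \<Rightarrow> (nat \<Rightarrow> nat) \<Rightarrow> mpol" where
  "schubert_in n w =
     foldr divided_difference (SOME \<alpha>. reduced_word \<alpha> (inv w \<circ> longest_perm n))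
       (staircase_monomial n)"

definition schubert :: "(nat \<Rightarrow> nat) \<Rightarrow> mpol" where
  "schubert w = schubert_in (LEAST n. w permutes {1..n}) w"


section \<open>Tower diagrams\<close>

text \<open>\<open>T p\<close> is the height of the \<open>p\<close>-th tower (\<open>p \<ge> 1\<close>; \<open>T 0\<close> is always \<open>0\<close>).\<close>

type_synonym tower = "nat \<Rightarrow> nat"

text \<open>
  The state of a slide on reaching tower \<open>p\<close> with current value \<open>s\<close>. Starting from \<open>p = 1\<close> and
  \<open>s \<ge> 1\<close> one has \<open>p \<le> s\<close> throughout, so the last branch is the case \<open>s < p + h - 1\<close>.
  The process stops for every diagram with almost all towers empty.
\<close>

partial_function (tailrec) slide_from :: "nat \<Rightarrow> nat \<Rightarrow> tower \<Rightarrow> tower" where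
  "slide_from p s T =
     (if s > p + T p then slide_from (Suc p) s T
      else if s = p + T p then T(p := T p + 1)
      else if T p \<ge> 1 \<and> s + 1 = p + T p then T(p := T p - 1)
      else slide_from (Suc p) (Suc s) T)"

definition slide :: "nat \<Rightarrow> tower \<Rightarrow> tower" where
  "slide i T = slide_from 1 i T"

definition slide_word :: "nat list \<Rightarrow> tower \<Rightarrow> tower" where
  "slide_word \<alpha> T = fold slide \<alpha> T"

definition tower_of :: "(nat \<Rightarrow> nat) \<Rightarrow> tower" where
  "tower_of w = slide_word (SOME \<alpha>. reduced_word \<alpha> w) (\<lambda>_. 0)"

definition perm_of_tower :: "tower \<Rightarrow> nat \<Rightarrow> nat" where
  "perm_of_tower T = (THE w. fin_perm w \<and> tower_of w = T)"


section \<open>Saturated chains and labelled diagrams\<close>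

definition chain_perm :: "(nat \<Rightarrow> nat) \<Rightarrow> (nat \<times> nat) list \<Rightarrow> nat \<Rightarrow> nat" where
  "chain_perm w c = foldl (\<lambda>v (a, b). v \<circ> transpose a b) w c"

definition saturated_chain :: "nat \<Rightarrow> nat \<Rightarrow> (nat \<Rightarrow> nat) \<Rightarrow> (nat \<times> nat) list \<Rightarrow> bool" where
  "saturated_chain k m w c \<longleftrightarrow>
     length c = m \<and>
     (\<forall>(a, b)\<in>set c. 0 < a \<and> a \<le> k \<and> k < b) \<and>
     (\<forall>q<m. coxeter_length (chain_perm w (take (Suc q) c))
              = coxeter_length (chain_perm w (take q c)) + 1)"

text \<open>
  A label is a triple \<open>(q, a, b)\<close>; a cell is given by its south-east corner \<open>(p, h)\<close>, that is,
  by its tower \<open>p\<close> and its level \<open>h\<close> counted from \<open>0\<close>. A labelled diagram consists of the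
  diagram and the relation between the labels and the cells carrying them.
\<close>

type_synonym label = "nat \<times> nat \<times> nat"
type_synonym cell = "nat \<times> nat"
type_synonym labelled_tower = "tower \<times> (label \<times> cell) set"

text \<open>Tower \<open>l\<close> of \<open>D\<close> loses its topmost \<open>r\<close> cells, and these are carried to tower \<open>s\<close>, above its
  lowest new cell.\<close>

definition carry_cell :: "tower \<Rightarrow> nat \<Rightarrow> nat \<Rightarrow> nat \<Rightarrow> cell \<Rightarrow> cell" where
  "carry_cell D s l r = (\<lambda>(p, h).
     if p = l \<and> D l - r \<le> h \<and> h < D l then (s, D s + 1 + (h - (D l - r))) else (p, h))"

text \<open>\<open>add_labels w q L c\<close> continues with the steps \<open>q, q+1, ...\<close> given by \<open>c\<close> from the diagram of
  \<open>w\<close> labelled by \<open>L\<close>; \<open>r\<close> is the number of cells by which tower \<open>l\<close> is lowered.\<close>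

fun add_labels ::
  "(nat \<Rightarrow> nat) \<Rightarrow> nat \<Rightarrow> (label \<times> cell) set \<Rightarrow> (nat \<times> nat) list \<Rightarrow> labelled_tower" where
  "add_labels w q L [] = (tower_of w, L)"
| "add_labels w q L ((a, b) # c) =
     (let w' = w \<circ> transpose a b;
          D = tower_of w; s = w a; l = w b;
          r = D l - tower_of w' l
      in add_labels w' (Suc q)
           (insert ((q, a, b), (s, D s)) (apsnd (carry_cell D s l r) ` L)) c)"

definition chain_diagrams :: "nat \<Rightarrow> nat \<Rightarrow> (nat \<Rightarrow> nat) \<Rightarrow> labelled_tower set" where
  "chain_diagrams k m w = {add_labels w 1 {} c | c. saturated_chain k m w c}"

definition weakly_decreasing_labels :: "labelled_tower \<Rightarrow> bool" where
  "weakly_decreasing_labels X \<longleftrightarrow>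
     (\<forall>((q, a, b), _)\<in>snd X. \<forall>((q', a', b'), _)\<in>snd X. q \<le> q' \<longrightarrow> a \<ge> a')"

definition labels_in_distinct_towers :: "labelled_tower \<Rightarrow> bool" where
  "labels_in_distinct_towers X \<longleftrightarrow>
     (\<forall>(t, p, h)\<in>snd X. \<forall>(t', p', h')\<in>snd X. t \<noteq> t' \<longrightarrow> p \<noteq> p')"

definition pieri_diagrams :: "nat \<Rightarrow> nat \<Rightarrow> (nat \<Rightarrow> nat) \<Rightarrow> labelled_tower set" where
  "pieri_diagrams k m w =
     {X \<in> chain_diagrams k m w. weakly_decreasing_labels X \<and> labels_in_distinct_towers X}"

end

theory Submission
  imports Defs
begin

text \<open>
  Write \<open>[a b]\<close> for the operator sending a permutation \<open>w\<close> to \<open>w t\<^sub>a\<^sub>b\<close> if the length increases by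
  one and to \<open>0\<close> otherwise, with \<open>[b a] = - [a b]\<close>, and let \<open>d\<^sub>i\<close> send \<open>w\<close> to \<open>w s\<^sub>i\<close> if \<open>i\<close> is a
  descent and to \<open>0\<close> otherwise. Operators \<open>[a b]\<close> with disjoint indices commute,
  \<open>[a b] d\<^sub>i = d\<^sub>i [s\<^sub>i a  s\<^sub>i b]\<close> unless \<open>{a, b} = {i, i+1}\<close>, and the exceptional case has the extra
  summand \<open>1\<close>. Hence, for a finite set \<open>A\<close> of indices, the sum \<open>H\<^sub>m(A)\<close> of all products
  \<open>[a\<^sub>1 b\<^sub>1] \<dots> [a\<^sub>m b\<^sub>m]\<close> with the \<open>a\<^sub>q\<close> in \<open>A\<close> in a fixed weakly monotone order and distinct \<open>b\<^sub>q\<close>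
  outside \<open>A\<close> satisfies the same Leibniz rule with respect to the \<open>d\<^sub>i\<close> as multiplication by the complete
  symmetric polynomial \<open>h\<^sub>m(x\<^sub>A)\<close> does with respect to the divided differences. A homogeneous
  polynomial of positive degree killed by all divided differences is \<open>0\<close>, so
  \<open>S\<^sub>w h\<^sub>m(x\<^sub>A) = S(w H\<^sub>m(A))\<close> by induction on \<open>m\<close> and the length of \<open>w\<close>; the same principle identifies
  the Schubert polynomial of the cycle with \<open>h\<^sub>m(x\<^sub>1, \<dots>, x\<^sub>k)\<close>.

  The tower diagram of \<open>w\<close> is the inversion code of its inverse. Following the labels shows that, for
  decreasing \<open>a\<^sub>q\<close>, the labelled cells lie in distinct towers exactly if the \<open>b\<^sub>q\<close> are distinct.
\<close>

section \<open>Length and inversions\<close>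

text \<open>Only the index set {1..k} matters in the end, but the induction leaves it: for i in A
  and i+1 outside A, the divided difference of h_m(x_A) is h_{m-1} in the variables of A together
  with i+1, while the other Leibniz term replaces A by s_i A. So arbitrary finite sets A occur, an
  index b outside A may be smaller than a, and signs enter; they vanish again for A = {1..k}. As s_i
  also disturbs the order in which A is listed, independence of that order has to be shown first.
  The induction runs over m plus the length of w, since each Leibniz term lowers one of the two. To
  keep the sums finite, the b's are confined to {1..N}; N >= n + m leaves enough room because a
  cover by t_ab with a <= n reaches at most one place beyond n. On the tower side the two directions
  differ in kind. For distinct b's every label is located exactly. For the converse it is enough to
  know that all labels end in towers of values at positions b, and to count.\<close>

lemma fin_perm_id [simp]: "fin_perm id"
  unfolding fin_perm_def by (auto intro: permutes_id)

lemma permutes_atLeastAtMost_mono: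
  "w permutes {1..n} \<Longrightarrow> n \<le> N \<Longrightarrow> w permutes {1..N::nat}"
  by (erule permutes_subset) auto

lemma fin_perm_comp [simp]: "fin_perm v \<Longrightarrow> fin_perm w \<Longrightarrow> fin_perm (v \<circ> w)"
proof -
  assume "fin_perm v" "fin_perm w"
  then obtain m n where "v permutes {1..m}" "w permutes {1..n}"
    unfolding fin_perm_def by blast
  then have "v permutes {1..max m n}" "w permutes {1..max m n}"
    using permutes_atLeastAtMost_mono max.cobounded1 max.cobounded2 by blast+
  then show ?thesis
    unfolding fin_perm_def using permutes_compose by blast
qed

lemma fin_perm_inv [simp]: "fin_perm w \<Longrightarrow> fin_perm (inv w)"
  unfolding fin_perm_def using permutes_inv by blast

lemma fin_perm_transpose [simp]: "0 < a \<Longrightarrow> 0 < b \<Longrightarrow> fin_perm (transpose a b)"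
  unfolding fin_perm_def by (rule exI[of _ "max a b"], rule permutes_swap_id) auto

lemma fin_perm_simple_refl [simp]: "0 < p \<Longrightarrow> fin_perm (simple_refl p)"
  unfolding simple_refl_def by simp

lemma fin_perm_bij: "fin_perm w \<Longrightarrow> bij w"
  unfolding fin_perm_def using permutes_bij by blast

lemma fin_perm_inj: "fin_perm w \<Longrightarrow> inj w"
  using fin_perm_bij bij_is_inj by blast

lemma fin_perm_eq_iff: "fin_perm w \<Longrightarrow> w i = w j \<longleftrightarrow> i = j"
  using fin_perm_inj by (blast dest: injD)

lemma fin_perm_0: "fin_perm w \<Longrightarrow> w 0 = 0"
  unfolding fin_perm_def by (auto simp: permutes_def)

lemma fin_perm_pos_iff: "fin_perm w \<Longrightarrow> 0 < w i \<longleftrightarrow> 0 < i"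
  by (metis fin_perm_0 fin_perm_eq_iff neq0_conv)

lemma fin_perm_inv_apply: "fin_perm w \<Longrightarrow> inv w (w i) = i" "fin_perm w \<Longrightarrow> w (inv w i) = i"
  by (simp_all add: fin_perm_inj fin_perm_bij bij_is_surj surj_f_inv_f)

lemma fin_perm_inv_eq_iff: "fin_perm w \<Longrightarrow> inv w i = j \<longleftrightarrow> w j = i"
  using fin_perm_inv_apply by metis

lemma fin_perm_inv_comp: "fin_perm v \<Longrightarrow> fin_perm w \<Longrightarrow> inv (v \<circ> w) = inv w \<circ> inv v"
  using o_inv_distrib fin_perm_bij by blast

lemma simple_refl_simps [simp]:
  "simple_refl p p = Suc p" "simple_refl p (Suc p) = p"
  "i \<noteq> p \<Longrightarrow> i \<noteq> Suc p \<Longrightarrow> simple_refl p i = i"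
  unfolding simple_refl_def by (auto simp: transpose_def)

lemma simple_refl_invol [simp]: "simple_refl p (simple_refl p i) = i"
  "simple_refl p \<circ> simple_refl p = id"
  "w \<circ> simple_refl p \<circ> simple_refl p = w"
  "simple_refl p \<circ> (simple_refl p \<circ> w) = w"
  unfolding simple_refl_def by (auto simp: fun_eq_iff)

lemma inv_simple_refl [simp]: "inv (simple_refl p) = simple_refl p"
  by (rule inv_unique_comp) simp_all

lemma simple_refl_less: "i < j \<Longrightarrow> (i, j) \<noteq> (p, Suc p) \<Longrightarrow> simple_refl p i < simple_refl p j"
  unfolding simple_refl_def transpose_def by auto

lemma inj_simple_refl: "inj (simple_refl p)"
  by (rule injI) (metis simple_refl_invol(1))

section \<open>Inversion number and Coxeter length\<close>

definition inversions :: "(nat \<Rightarrow> nat) \<Rightarrow> (nat \<times> nat) set" where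
  "inversions w = {(i, j). i < j \<and> w j < w i}"

definition len :: "(nat \<Rightarrow> nat) \<Rightarrow> nat" where
  "len w = card (inversions w)"

lemma finite_inversions [simp]:
  assumes "fin_perm w"
  shows "finite (inversions w)"
proof -
  obtain n where n: "w permutes {1..n}"
    using assms unfolding fin_perm_def by blast
  have "j \<le> n" if "i < j" "w j < w i" for i j
  proof (rule ccontr)
    assume "\<not> j \<le> n"
    then have "w j = j" "w i \<notin> {1..n}"
      using n that by (auto simp: permutes_def)
    moreover from this(2) have "w i = i"
      by (metis n permutes_in_image permutes_not_in)
    ultimately show False using that by simp
  qed
  then have "inversions w \<subseteq> {..n} \<times> {..n}"
    unfolding inversions_def by fastforce
  then show ?thesis by (rule finite_subset) simp
qed

text \<open>Applying \<open>simple_refl p\<close> to both positions of a pair alters their order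
  only for the pair of \<open>p\<close> and \<open>Suc p\<close>. Hence the inversions correspond
  bijectively, apart from the new one \<open>(p, Suc p)\<close>.\<close>

lemma len_ascent:
  assumes w: "fin_perm w" and asc: "w p < w (Suc p)"
  shows "len (w \<circ> simple_refl p) = Suc (len w)"
proof -
  let ?f = "map_prod (simple_refl p) (simple_refl p)"
  have invol: "?f (?f x) = x" for x by (cases x) simp
  have iff: "simple_refl p i < simple_refl p j \<longleftrightarrow> i < j"
    if "(i, j) \<noteq> (p, Suc p)" "(i, j) \<noteq> (Suc p, p)" for i j
    using that unfolding simple_refl_def transpose_def by auto
  have "(i, j) \<in> inversions (w \<circ> simple_refl p) \<longleftrightarrow> (i, j) = (p, Suc p) \<or> ?f (i, j) \<in> inversions w" for i j
  proof (cases "(i, j) = (p, Suc p) \<or> (i, j) = (Suc p, p)")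
    case False
    then show ?thesis using iff[of i j] by (auto simp: inversions_def)
  qed (use asc in \<open>auto simp: inversions_def\<close>)
  then have "inversions (w \<circ> simple_refl p) = insert (p, Suc p) (?f ` inversions w)"
    using invol by (auto simp del: map_prod_simp) (metis image_eqI map_prod_simp invol)+
  moreover have "(p, Suc p) \<notin> ?f ` inversions w"
    unfolding inversions_def by (auto, metis less_not_sym lessI simple_refl_invol(1) simple_refl_simps(1,2))
  moreover have "inj_on ?f (inversions w)"
    by (metis invol inj_onI)
  ultimately show ?thesis
    unfolding len_def using w by (simp add: card_image)
qed

lemma len_descent:
  assumes "fin_perm w" "0 < p" "w (Suc p) < w p"
  shows "len w = Suc (len (w \<circ> simple_refl p))"
  using len_ascent[of "w \<circ> simple_refl p" p] assms by simp

lemma len_id [simp]: "len id = 0"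
  proof -
  have "inversions id = {}" unfolding inversions_def by auto
  then show ?thesis unfolding len_def by simp
qed

text \<open>A strictly increasing \<open>w\<close> has \<open>i \<le> w i\<close>; once this is
  strict at some \<open>x\<close> it stays strict at all larger arguments, against the finite
  support.\<close>

lemma no_descent_imp_id:
  assumes "fin_perm w" "\<And>p. 0 < p \<Longrightarrow> w p < w (Suc p)"
  shows "w = id"
proof
  fix x
  have asc: "w i < w (Suc i)" for i
    using assms fin_perm_0[of w] fin_perm_pos_iff[of w "Suc 0"] by (cases "i = 0") auto
  have le: "i \<le> w i" for i
    by (induction i) (use asc in \<open>auto simp: Suc_le_eq intro: le_less_trans\<close>)
  have mono: "strict_mono w"
    using asc by (simp add: strict_mono_Suc_iff)
  obtain n where "w permutes {1..n}"
    using assms unfolding fin_perm_def by blast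
  then have "w (Suc n + i) = Suc n + i" for i
    by (simp add: permutes_def)
  show "w x = id x"
  proof (rule ccontr)
    assume "w x \<noteq> id x"
    then have lt: "x < w x" using le[of x] by simp
    have *: "i < w i" if "x \<le> i" for i
      using that by (induction rule: dec_induct) (use lt asc in \<open>auto intro: less_le_trans simp: Suc_le_eq\<close>)
    have "w (max x (Suc n)) = max x (Suc n)"
      using \<open>w permutes {1..n}\<close> by (simp add: permutes_def)
    then show False using *[of "max x (Suc n)"] by simp
  qed
qed

lemma exists_descent:
  assumes "fin_perm w" "w \<noteq> id"
  obtains p where "0 < p" "w (Suc p) < w p"
  using no_descent_imp_id[OF assms(1)] assms
  by (metis fin_perm_eq_iff linorder_neqE_nat n_not_Suc_n)

lemma len_eq_0_iff: "fin_perm w \<Longrightarrow> len w = 0 \<longleftrightarrow> w = id"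
  by (metis exists_descent len_descent len_id nat.distinct(1))

lemma word_perm_Nil [simp]: "word_perm [] = id"
  and word_perm_Cons [simp]: "word_perm (p # \<alpha>) = simple_refl p \<circ> word_perm \<alpha>"
  unfolding word_perm_def by simp_all

lemma word_perm_append [simp]: "word_perm (\<alpha> @ \<beta>) = word_perm \<alpha> \<circ> word_perm \<beta>"
  by (induction \<alpha>) (auto simp: o_assoc)

lemma fin_perm_word_perm [simp]: "\<forall>p\<in>set \<alpha>. 0 < p \<Longrightarrow> fin_perm (word_perm \<alpha>)"
  by (induction \<alpha>) auto

lemma len_comp_simple_refl_le:
  assumes "fin_perm w" "0 < p"
  shows "len (w \<circ> simple_refl p) \<le> Suc (len w)"
  using len_ascent[of w p] len_descent[of w p] assms
  by (metis fin_perm_eq_iff le_SucI lessI less_or_eq_imp_le linorder_neqE_nat n_not_Suc_n order_refl)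

lemma len_word_perm_le: "\<forall>p\<in>set \<alpha>. 0 < p \<Longrightarrow> len (word_perm \<alpha>) \<le> length \<alpha>"
proof (induction \<alpha> rule: rev_induct)
  case (snoc p \<alpha>)
  then have "len (word_perm \<alpha> \<circ> simple_refl p) \<le> Suc (length \<alpha>)"
    using len_comp_simple_refl_le[of "word_perm \<alpha>" p] by (simp add: le_trans)
  moreover have "word_perm (\<alpha> @ [p]) = word_perm \<alpha> \<circ> simple_refl p" by simp
  ultimately show ?case by (metis length_append_singleton)
qed simp

lemma exists_word_len:
  assumes "fin_perm w"
  shows "\<exists>\<alpha>. is_word_of \<alpha> w \<and> length \<alpha> = len w"
  using assms
proof (induction "len w" arbitrary: w)
  case 0
  then have "w = id" by (simp add: len_eq_0_iff)
  then show ?case by (metis is_word_of_def empty_iff empty_set len_id list.size(3) word_perm_Nil)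
next
  case (Suc l)
  then obtain p where p: "0 < p" "w (Suc p) < w p"
    by (metis exists_descent len_id nat.distinct(1))
  then obtain \<alpha> where "is_word_of \<alpha> (w \<circ> simple_refl p)" "length \<alpha> = l"
    using Suc.hyps(1)[of "w \<circ> simple_refl p"] Suc.hyps(2) Suc.prems len_descent[OF Suc.prems p] by auto
  then have "is_word_of (\<alpha> @ [p]) w \<and> length (\<alpha> @ [p]) = len w"
    using p Suc.hyps(2) by (auto simp: is_word_of_def)
  then show ?case by blast
qed

lemma coxeter_length_eq [simp]:
  assumes "fin_perm w"
  shows "coxeter_length w = len w"
  unfolding coxeter_length_def
proof (rule Least_equality)
  show "\<exists>\<alpha>. is_word_of \<alpha> w \<and> length \<alpha> = len w"
    using exists_word_len[OF assms] .
qed (use len_word_perm_le in \<open>auto simp: is_word_of_def\<close>)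

lemma reduced_word_iff:
  "reduced_word \<alpha> w \<longleftrightarrow> (\<forall>p\<in>set \<alpha>. 0 < p) \<and> word_perm \<alpha> = w \<and> length \<alpha> = len w"
  unfolding reduced_word_def is_word_of_def by auto

lemma exists_reduced_word: "fin_perm w \<Longrightarrow> \<exists>\<alpha>. reduced_word \<alpha> w"
  using exists_word_len by (auto simp: reduced_word_def is_word_of_def)

lemma reduced_word_some: "fin_perm w \<Longrightarrow> reduced_word (SOME \<alpha>. reduced_word \<alpha> w) w"
  using exists_reduced_word by (rule someI_ex)

lemma len_inv [simp]:
  assumes "fin_perm w"
  shows "len (inv w) = len w"
proof -
  have "bij_betw (\<lambda>(i, j). (w j, w i)) (inversions w) (inversions (inv w))"
    by (rule bij_betw_byWitness[where f' = "\<lambda>(i, j). (inv w j, inv w i)"])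
      (use assms in \<open>auto simp: inversions_def fin_perm_inv_apply\<close>)
  then show ?thesis
    unfolding len_def using bij_betw_same_card by metis
qed

lemma len_left_ascent:
  assumes w: "fin_perm w" "0 < p" and "inv w p < inv w (Suc p)"
  shows "len (simple_refl p \<circ> w) = Suc (len w)"
proof -
  have "len (simple_refl p \<circ> w) = len (inv w \<circ> simple_refl p)"
    using w len_inv[of "simple_refl p \<circ> w"] by (simp add: fin_perm_inv_comp del: len_inv)
  then show ?thesis
    using len_ascent[of "inv w" p] assms by simp
qed

lemma len_left_descent:
  assumes "fin_perm w" "0 < p" and "inv w (Suc p) < inv w p"
  shows "len w = Suc (len (simple_refl p \<circ> w))"
  using len_left_ascent[of "simple_refl p \<circ> w" p] assms by (simp add: fin_perm_inv_comp)

section \<open>Length under general transpositions\<close>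

lemma transpose_Suc: 
  assumes "Suc a < b"
  shows "transpose a b = simple_refl a \<circ> transpose (Suc a) b \<circ> simple_refl a"
  using assms by (auto simp: fun_eq_iff transpose_def simple_refl_def)

text \<open>Conjugation with \<open>simple_refl a\<close> lowers \<open>b - a\<close>, and the inner
  transposition lengthens by induction. Each outer factor changes the length by one; as
  \<open>w (Suc a)\<close> cannot be both below \<open>w a\<close> and above \<open>w b\<close>, at
  least one of them lengthens and makes up for the other.\<close>

lemma len_transpose_less:
  assumes "fin_perm w" "0 < a" "a < b" "w a < w b"
  shows "len w < len (w \<circ> transpose a b)"
  using assms
proof (induction "b - a" arbitrary: a w)
  case (Suc d)
  show ?case
  proof (cases "b = Suc a")
    case True
    then show ?thesis
      using len_ascent[of w a] Suc.prems by (simp add: simple_refl_def)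
  next
    case False
    let ?u = "w \<circ> simple_refl a" and ?v = "w \<circ> simple_refl a \<circ> transpose (Suc a) b"
    have b: "Suc a < b" using False Suc.prems by simp
    have u: "fin_perm ?u" and v: "fin_perm ?v"
      using Suc.prems b by auto
    have "len ?u < len ?v"
      using Suc.hyps(1)[of "Suc a" ?u] Suc.hyps(2) Suc.prems b u by simp
    moreover have "w \<circ> transpose a b = ?v \<circ> simple_refl a"
      using transpose_Suc[OF b] by (simp add: o_assoc)
    moreover have "?v a = w (Suc a)" "?v (Suc a) = w b"
      using b by (auto simp: transpose_def)
    ultimately have **: "len ?u < len ?v"
      "w \<circ> transpose a b = ?v \<circ> simple_refl a" "?v a = w (Suc a)" "?v (Suc a) = w b"
      by blast+
    have up: "len w < len ?u" if "w a < w (Suc a)"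
      using len_ascent[of w a] that Suc.prems by simp
    have down: "len w \<le> Suc (len ?u)"
      using len_comp_simple_refl_le[of ?u a] u Suc.prems by simp
    have up': "len ?v < len (?v \<circ> simple_refl a)" if "w (Suc a) < w b"
      using len_ascent[OF v, of a] that ** by simp
    have down': "len ?v \<le> Suc (len (?v \<circ> simple_refl a))"
      using len_comp_simple_refl_le[of "?v \<circ> simple_refl a" a] v Suc.prems by simp
    have "w a < w (Suc a) \<or> w (Suc a) < w b"
      using Suc.prems by linarith
    then have "len w < len (?v \<circ> simple_refl a)"
      using **(1) up down up' down' by linarith
    then show ?thesis using **(2) by simp
  qed
qed simp

lemma len_transpose_less_iff:
  assumes "fin_perm w" "0 < a" "a < b"
  shows "len w < len (w \<circ> transpose a b) \<longleftrightarrow> w a < w b"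
proof
  assume lt: "len w < len (w \<circ> transpose a b)"
  show "w a < w b"
  proof (rule ccontr)
    assume "\<not> w a < w b"
    then have "w b < w a"
      using assms fin_perm_eq_iff[OF assms(1), of a b] by linarith
    then have "len (w \<circ> transpose a b) < len (w \<circ> transpose a b \<circ> transpose a b)"
      using assms by (intro len_transpose_less) auto
    then show False
      using lt by (simp add: comp_assoc)
  qed
qed (rule len_transpose_less[OF assms])

text \<open>\<open>transpose a b\<close> is the product of the transpositions of a c, of c b and
  again of a c, and each of these three steps exchanges an ascending pair. This later bounds
  \<open>b\<close> in a cover.\<close>

lemma not_cover_between:
  assumes w: "fin_perm w" and "0 < a" "a < c" "c < b" "w a < w c" "w c < w b"
  shows "Suc (len w) < len (w \<circ> transpose a b)"
proof -
  let ?u = "w \<circ> transpose a c" and ?v = "w \<circ> transpose a c \<circ> transpose c b"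
  have "len w < len ?u"
    using assms by (intro len_transpose_less) auto
  moreover have "len ?u < len ?v"
    using assms by (intro len_transpose_less) (auto simp: transpose_def)
  moreover have "len ?v < len (?v \<circ> transpose a c)"
    using assms by (intro len_transpose_less) (auto simp: transpose_def)
  moreover have eq: "?v \<circ> transpose a c = w \<circ> transpose a b"
    using assms by (auto simp: fun_eq_iff transpose_def)
  ultimately show ?thesis unfolding eq by linarith
qed

section \<open>Divided differences\<close>

lemma mpol_sum_induct:
  fixes f :: mpol
  assumes "\<And>t c. P (Poly_Mapping.single t c)" "\<And>f g. P f \<Longrightarrow> P g \<Longrightarrow> P (f + g)"
  shows "P f"
proof (induction f rule: update_induct)
  case const
  show ?case using assms(1)[of 0 0] by simp
next
  case (update f t c)
  have "Poly_Mapping.update t c f = f + Poly_Mapping.single t c"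
    using update(1) by (intro poly_mapping_eqI) (auto simp: lookup_update lookup_add lookup_single in_keys_iff when_def)
  then show ?case using assms update by simp
qed

lemma var_power: "var i ^ n = Poly_Mapping.single (Poly_Mapping.single i n) 1"
  by (induction n) (simp_all add: var_def mult_single flip: single_add)

lemma mpol_induct [case_names const var add mult]:
  fixes f :: mpol
  assumes const: "\<And>c. P (Poly_Mapping.single 0 c)" and var: "\<And>i. P (var i)"
    and add: "\<And>f g. P f \<Longrightarrow> P g \<Longrightarrow> P (f + g)" and mult: "\<And>f g. P f \<Longrightarrow> P g \<Longrightarrow> P (f * g)"
  shows "P f"
proof (rule mpol_sum_induct)
  fix t :: "nat \<Rightarrow>\<^sub>0 nat" and c
  have pow: "P (var i ^ n)" for i n
    by (induction n) (use const[of 1] var mult in auto)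
  show "P (Poly_Mapping.single t c)"
  proof (induction t rule: update_induct)
    case (update t i n)
    have "Poly_Mapping.update i n t = t + Poly_Mapping.single i n"
      using update(1) by (intro poly_mapping_eqI) (auto simp: lookup_update lookup_add lookup_single in_keys_iff when_def)
    then have "Poly_Mapping.single (Poly_Mapping.update i n t) c = Poly_Mapping.single t c * var i ^ n"
      by (simp add: mult_single var_power)
    then show ?case using mult[OF update(3) pow] by simp
  qed (rule const)
qed (rule add)

section \<open>Exchange of adjacent variables\<close>

abbreviation swap_exps :: "nat \<Rightarrow> (nat \<Rightarrow>\<^sub>0 nat) \<Rightarrow> (nat \<Rightarrow>\<^sub>0 nat)" where
  "swap_exps i \<equiv> Poly_Mapping.map_key (transpose i (Suc i))"

lemma lookup_swap_exps [simp]: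
  "Poly_Mapping.lookup (swap_exps i t) j = Poly_Mapping.lookup t (transpose i (Suc i) j)"
  by (subst map_key.rep_eq) auto

lemma swap_exps_swap_exps [simp]: "swap_exps i (swap_exps i t) = t"
  by (rule poly_mapping_eqI) simp

lemma inj_swap_exps: "inj (swap_exps i)"
  by (metis injI swap_exps_swap_exps)

lemma swap_exps_add [simp]: "swap_exps i (s + t) = swap_exps i s + swap_exps i t"
  by (rule poly_mapping_eqI) (simp add: lookup_add)

lemma lookup_swap_vars [simp]:
  "Poly_Mapping.lookup (swap_vars i f) t = Poly_Mapping.lookup f (swap_exps i t)"
  unfolding swap_vars_def by (subst map_key.rep_eq[OF inj_swap_exps]) simp

lemma swap_vars_swap_vars [simp]: "swap_vars i (swap_vars i f) = f"
  by (rule poly_mapping_eqI) simp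

lemma swap_vars_add [simp]: "swap_vars i (f + g) = swap_vars i f + swap_vars i g"
  by (rule poly_mapping_eqI) (simp add: lookup_add)

lemma swap_vars_diff [simp]: "swap_vars i (f - g) = swap_vars i f - swap_vars i g"
  by (rule poly_mapping_eqI) (simp add: lookup_minus)

lemma swap_vars_0 [simp]: "swap_vars i 0 = 0"
  by (rule poly_mapping_eqI) simp

lemma swap_vars_single [simp]:
  "swap_vars i (Poly_Mapping.single t c) = Poly_Mapping.single (swap_exps i t) c"
proof (rule poly_mapping_eqI)
  fix u
  have "t = swap_exps i u \<longleftrightarrow> swap_exps i t = u"
    by (metis swap_exps_swap_exps)
  then show "Poly_Mapping.lookup (swap_vars i (Poly_Mapping.single t c)) u
      = Poly_Mapping.lookup (Poly_Mapping.single (swap_exps i t) c) u"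
    by (simp add: lookup_single)
qed

lemma swap_vars_mult [simp]: "swap_vars i (f * g) = swap_vars i f * swap_vars i g"
proof (induction f rule: mpol_sum_induct)
  fix t c
  show "swap_vars i (Poly_Mapping.single t c * g) = swap_vars i (Poly_Mapping.single t c) * swap_vars i g"
    by (induction g rule: mpol_sum_induct) (simp_all add: mult_single distrib_left)
qed (simp add: distrib_right)

lemma swap_vars_1 [simp]: "swap_vars i 1 = 1"
proof -
  have "swap_exps i 0 = 0" by (rule poly_mapping_eqI) simp
  then show ?thesis using swap_vars_single[of i 0 1] by simp
qed

lemma swap_exps_single: "swap_exps i (Poly_Mapping.single j n) = Poly_Mapping.single (transpose i (Suc i) j) n"
  by (rule poly_mapping_eqI) (auto simp: lookup_single when_def)

lemma swap_vars_var: "swap_vars i (var j) = var (simple_refl i j)"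
  unfolding var_def simple_refl_def by (simp add: swap_exps_single)

lemma swap_vars_var_simps [simp]:
  "swap_vars i (var i) = var (Suc i)" "swap_vars i (var (Suc i)) = var i"
  "j \<noteq> i \<Longrightarrow> j \<noteq> Suc i \<Longrightarrow> swap_vars i (var j) = var j"
  by (simp_all add: swap_vars_var)

lemma swap_vars_commute:
  assumes "Suc i < j"
  shows "swap_vars i (swap_vars j f) = swap_vars j (swap_vars i f)"
  using assms
  by (intro poly_mapping_eqI, simp, intro arg_cong[where f = "Poly_Mapping.lookup f"] poly_mapping_eqI)
    (auto simp: transpose_def intro!: arg_cong[where f = "Poly_Mapping.lookup _"])

lemma swap_vars_braid:
  "swap_vars i (swap_vars (Suc i) (swap_vars i f)) = swap_vars (Suc i) (swap_vars i (swap_vars (Suc i) f))"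
  by (intro poly_mapping_eqI, simp, intro arg_cong[where f = "Poly_Mapping.lookup f"] poly_mapping_eqI)
    (auto simp: transpose_def intro!: arg_cong[where f = "Poly_Mapping.lookup _"])

lemma var_eq_iff [simp]: "var i = var j \<longleftrightarrow> i = j"
  unfolding var_def by (metis lookup_single_eq lookup_single_not_eq zero_neq_one)

lemma var_diff_cancel: "i \<noteq> j \<Longrightarrow> (var i - var j) * f = (var i - var j) * g \<longleftrightarrow> f = g"
  by simp

section \<open>Exactness of the division and the Leibniz rule\<close>

lemma divided_difference_eqI:
  assumes "f - swap_vars i f = (var i - var (Suc i)) * g"
  shows "divided_difference i f = g"
  unfolding divided_difference_def using assms var_diff_cancel[of i "Suc i"]
  by (intro the_equality) auto

text \<open>The polynomials for which the division is exact contain the constants and the variables,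
  and are closed under sums and, by the Leibniz identity, under products.\<close>

lemma divided_difference_exists: "\<exists>g. f - swap_vars i f = (var i - var (Suc i)) * g"
proof (induction f rule: mpol_induct)
  case (const c)
  have "swap_exps i 0 = 0" by (rule poly_mapping_eqI) simp
  then show ?case by (intro exI[of _ 0]) simp
next
  case (var j)
  have "var j - swap_vars i (var j) = (var i - var (Suc i)) * (if j = i then 1 else if j = Suc i then - 1 else 0)"
    by auto
  then show ?case by blast
next
  case (add f g)
  then obtain f' g' where "f - swap_vars i f = (var i - var (Suc i)) * f'"
    "g - swap_vars i g = (var i - var (Suc i)) * g'" by blast
  then have "(f + g) - swap_vars i (f + g) = (var i - var (Suc i)) * (f' + g')"
    by (simp add: algebra_simps)
  then show ?case by blast
next
  case (mult f g)
  then obtain f' g' where "f - swap_vars i f = (var i - var (Suc i)) * f'"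
    "g - swap_vars i g = (var i - var (Suc i)) * g'" by blast
  moreover have "f * g - swap_vars i (f * g) = (f - swap_vars i f) * g + swap_vars i f * (g - swap_vars i g)"
    by (simp add: algebra_simps)
  ultimately have "f * g - swap_vars i (f * g) = (var i - var (Suc i)) * f' * g + swap_vars i f * ((var i - var (Suc i)) * g')"
    by metis
  then have "f * g - swap_vars i (f * g) = (var i - var (Suc i)) * (f' * g + swap_vars i f * g')"
    by (simp only: algebra_simps)
  then show ?case by blast
qed

lemma divided_difference_mult_diff: "(var i - var (Suc i)) * divided_difference i f = f - swap_vars i f"
  using divided_difference_exists[of f i] divided_difference_eqI[of f i] by metis

lemma divided_difference_add [simp]:
  "divided_difference i (f + g) = divided_difference i f + divided_difference i g"
  by (rule divided_difference_eqI) (simp add: divided_difference_mult_diff distrib_left)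

lemma divided_difference_diff [simp]:
  "divided_difference i (f - g) = divided_difference i f - divided_difference i g"
  by (rule divided_difference_eqI) (simp add: divided_difference_mult_diff right_diff_distrib)

lemma divided_difference_0 [simp]: "divided_difference i 0 = 0"
  by (rule divided_difference_eqI) simp

lemma divided_difference_uminus [simp]: "divided_difference i (- f) = - divided_difference i f"
  using divided_difference_diff[of i 0 f] by simp

lemma divided_difference_sum [simp]:
  "divided_difference i (sum F A) = (\<Sum>a\<in>A. divided_difference i (F a))"
  by (induction A rule: infinite_finite_induct) auto

lemma divided_difference_mult:
  "divided_difference i (f * g) = divided_difference i f * swap_vars i g + f * divided_difference i g"
proof (rule divided_difference_eqI)
  have "f * g - swap_vars i (f * g) = (f - swap_vars i f) * swap_vars i g + f * (g - swap_vars i g)"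
    by (simp add: algebra_simps)
  then show "f * g - swap_vars i (f * g) =
      (var i - var (Suc i)) * (divided_difference i f * swap_vars i g + f * divided_difference i g)"
    unfolding divided_difference_mult_diff[symmetric] by (simp add: algebra_simps)
qed

lemma divided_difference_eq_0_iff: "divided_difference i f = 0 \<longleftrightarrow> swap_vars i f = f"
  using divided_difference_mult_diff[of i f] by (auto intro: divided_difference_eqI)

lemma swap_vars_divided_difference [simp]:
  "swap_vars i (divided_difference i f) = divided_difference i f"
proof -
  have "(var (Suc i) - var i) * swap_vars i (divided_difference i f) = swap_vars i f - f"
    using arg_cong[OF divided_difference_mult_diff[of i f], of "swap_vars i"] by simp
  then have "(var i - var (Suc i)) * swap_vars i (divided_difference i f) = f - swap_vars i f"
    by (simp add: algebra_simps)
  then show ?thesis using divided_difference_eqI by metis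
qed

lemma divided_difference_twice [simp]: "divided_difference i (divided_difference i f) = 0"
  by (simp add: divided_difference_eq_0_iff)

section \<open>Commutation and braid relations\<close>

text \<open>Multiplied by both differences of variables, either side becomes the alternating sum of
  \<open>f\<close> over the four products of the two commuting exchanges.\<close>

lemma divided_difference_commute:
  assumes "Suc i < j"
  shows "divided_difference i (divided_difference j f) = divided_difference j (divided_difference i f)"
proof -
  let ?a = "var i - var (Suc i)" and ?b = "var j - var (Suc j)"
  have b: "swap_vars i ?b = ?b" and a: "swap_vars j ?a = ?a" using assms by auto
  have 1: "?b * (?a * divided_difference i (divided_difference j f))
    = f - swap_vars j f - (swap_vars i f - swap_vars i (swap_vars j f))"
  proof -
    have "?b * (?a * divided_difference i (divided_difference j f))
        = ?b * divided_difference j f - swap_vars i (?b * divided_difference j f)"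
      by (simp only: divided_difference_mult_diff[of i "divided_difference j f"] swap_vars_mult b right_diff_distrib)
    also have "\<dots> = f - swap_vars j f - (swap_vars i f - swap_vars i (swap_vars j f))"
      by (simp only: divided_difference_mult_diff swap_vars_diff)
    finally show ?thesis .
  qed
  have 2: "?a * (?b * divided_difference j (divided_difference i f))
    = f - swap_vars i f - (swap_vars j f - swap_vars j (swap_vars i f))"
  proof -
    have "?a * (?b * divided_difference j (divided_difference i f))
        = ?a * divided_difference i f - swap_vars j (?a * divided_difference i f)"
      by (simp only: divided_difference_mult_diff[of j "divided_difference i f"] swap_vars_mult a right_diff_distrib)
    also have "\<dots> = f - swap_vars i f - (swap_vars j f - swap_vars j (swap_vars i f))"
      by (simp only: divided_difference_mult_diff swap_vars_diff)
    finally show ?thesis .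
  qed
  have "?a * (?b * divided_difference i (divided_difference j f))
      = ?a * (?b * divided_difference j (divided_difference i f))"
    using 1 2 swap_vars_commute[OF assms, of f] by (simp only: mult.left_commute[of ?a ?b]) (simp add: algebra_simps)
  then show ?thesis by simp
qed

text \<open>Multiplication by the Vandermonde product of three variables yields the
  antisymmetrization of \<open>f\<close> over the group of order 6 generated by \<open>s\<close> and
  \<open>t\<close>. Keeping \<open>s\<close> and \<open>t\<close> interchangeable lets both sides of
  the braid relation be read off from one computation.\<close>

lemma divided_difference_braid_aux:
  assumes s: "{s, t} = {i, Suc i}"
  shows "(var i - var (Suc i)) * (var (Suc i) - var (Suc (Suc i))) * (var i - var (Suc (Suc i))) *
      divided_difference s (divided_difference t (divided_difference s f))
    = f - swap_vars s f - swap_vars t f + swap_vars t (swap_vars s f) + swap_vars s (swap_vars t f)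
      - swap_vars s (swap_vars t (swap_vars s f))"
proof -
  let ?dd = divided_difference
  define a b c where "a = var s - var (Suc s)" and "b = var t - var (Suc t)"
    and "c = var i - var (Suc (Suc i))"
  have cab: "c = a + b" and sw: "swap_vars s a = - a" "swap_vars s b = c" "swap_vars s c = b"
    "swap_vars t a = c" "swap_vars t b = - b" "swap_vars t c = a"
    using s unfolding a_def b_def c_def by (auto simp: doubleton_eq_iff)
  have dd: "a * ?dd s g = g - swap_vars s g" "b * ?dd t g = g - swap_vars t g" for g
    unfolding a_def b_def by (rule divided_difference_mult_diff)+
  have 1: "c * swap_vars t (?dd s f) = swap_vars t f - swap_vars t (swap_vars s f)"
    using arg_cong[OF dd(1)[of f], of "swap_vars t"] by (simp add: sw)
  define X where "X = ?dd t (?dd s f)"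
  have "a * b * c * X = a * c * (b * X)"
    by (simp only: ac_simps)
  also have "\<dots> = c * (a * ?dd s f) - a * (c * swap_vars t (?dd s f))"
    unfolding X_def dd(2) by (simp only: algebra_simps)
  finally have X: "a * b * c * X = c * (f - swap_vars s f) - a * (swap_vars t f - swap_vars t (swap_vars s f))"
    unfolding 1 dd(1) .
  have sX: "- (a * b * c * swap_vars s X) = b * (swap_vars s f - f)
      + a * (swap_vars s (swap_vars t f) - swap_vars s (swap_vars t (swap_vars s f)))"
    using arg_cong[OF X, of "swap_vars s"] by (simp add: sw algebra_simps)
  \<comment> \<open>The surplus factor \<open>a\<close> turns \<open>?dd s X\<close> into
    \<open>X - swap_vars s X\<close>. After insertion of \<open>X\<close> and \<open>sX\<close>, the
    relation \<open>c = a + b\<close> makes \<open>a\<close> a common factor of all terms, so that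
    it can be cancelled.\<close>
  have "a * (a * b * c * ?dd s X) = a * b * c * (a * ?dd s X)"
    by (simp add: algebra_simps)
  also have "\<dots> = a * b * c * X - a * b * c * swap_vars s X"
    unfolding dd by (simp add: algebra_simps)
  also have "\<dots> = a * (f - swap_vars s f - swap_vars t f + swap_vars t (swap_vars s f) + swap_vars s (swap_vars t f)
      - swap_vars s (swap_vars t (swap_vars s f)))"
    (is "_ = ?R")
  proof -
    have "a * b * c * X - a * b * c * swap_vars s X = a * b * c * X + - (a * b * c * swap_vars s X)"
      by simp
    also have "\<dots> = (c * (f - swap_vars s f) - a * (swap_vars t f - swap_vars t (swap_vars s f)))
        + (b * (swap_vars s f - f) + a * (swap_vars s (swap_vars t f) - swap_vars s (swap_vars t (swap_vars s f))))"
      by (rule arg_cong2[where f = "(+)", OF X sX])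
    also have "\<dots> = ?R"
      by (simp add: cab algebra_simps)
    finally show ?thesis .
  qed
  finally have "a * b * c * ?dd s X = f - swap_vars s f - swap_vars t f + swap_vars t (swap_vars s f)
      + swap_vars s (swap_vars t f) - swap_vars s (swap_vars t (swap_vars s f))"
    unfolding a_def by simp
  moreover have "a * b = (var i - var (Suc i)) * (var (Suc i) - var (Suc (Suc i)))"
    using s unfolding a_def b_def by (auto simp: doubleton_eq_iff algebra_simps)
  ultimately show ?thesis unfolding c_def X_def by simp
qed

lemma divided_difference_braid:
  "divided_difference i (divided_difference (Suc i) (divided_difference i f))
    = divided_difference (Suc i) (divided_difference i (divided_difference (Suc i) f))" (is "?l = ?r")
proof -
  let ?D = "(var i - var (Suc i)) * (var (Suc i) - var (Suc (Suc i))) * (var i - var (Suc (Suc i)))"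
  have "?D * ?l = f - swap_vars i f - swap_vars (Suc i) f + swap_vars (Suc i) (swap_vars i f)
      + swap_vars i (swap_vars (Suc i) f) - swap_vars i (swap_vars (Suc i) (swap_vars i f))"
    by (rule divided_difference_braid_aux) simp
  also have "\<dots> = f - swap_vars (Suc i) f - swap_vars i f + swap_vars i (swap_vars (Suc i) f)
      + swap_vars (Suc i) (swap_vars i f) - swap_vars (Suc i) (swap_vars i (swap_vars (Suc i) f))"
    unfolding swap_vars_braid by (simp only: algebra_simps)
  also have "\<dots> = ?D * ?r"
    by (rule divided_difference_braid_aux[symmetric]) auto
  finally have "?D * ?l = ?D * ?r" .
  then show ?thesis by simp
qed

subsection \<open>Homogeneity\<close>

definition total_degree :: "(nat \<Rightarrow>\<^sub>0 nat) \<Rightarrow> nat" where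
  "total_degree t = (\<Sum>i\<in>Poly_Mapping.keys t. Poly_Mapping.lookup t i)"

lemma total_degree_add [simp]: "total_degree (s + t) = total_degree s + total_degree t"
  unfolding total_degree_def by (rule setsum_keys_plus_distrib) auto

lemma total_degree_single [simp]: "total_degree (Poly_Mapping.single i n) = n"
  unfolding total_degree_def by auto

lemma total_degree_0 [simp]: "total_degree 0 = 0"
  unfolding total_degree_def by simp

lemma total_degree_swap_exps [simp]: "total_degree (swap_exps i t) = total_degree t"
proof -
  have bij: "bij_betw (transpose i (Suc i)) (Poly_Mapping.keys (swap_exps i t)) (Poly_Mapping.keys t)"
    by (rule bij_betw_byWitness[where f' = "transpose i (Suc i)"]) (auto simp: in_keys_iff)
  then show ?thesis
    unfolding total_degree_def using sum.reindex_bij_betw[OF bij, of "Poly_Mapping.lookup t"] by simp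
qed

text \<open>The variable \<open>x\<^sub>0\<close> is untouched by the exchanges \<open>swap_vars i\<close> with \<open>i \<ge> 1\<close>, so it has to be
  excluded for the statement that polynomials invariant under all of them are constant.\<close>

definition homogeneous :: "nat \<Rightarrow> mpol \<Rightarrow> bool" where
  "homogeneous d f \<longleftrightarrow> (\<forall>t\<in>Poly_Mapping.keys f. total_degree t = d \<and> Poly_Mapping.lookup t 0 = 0)"

lemma homogeneous_0 [simp]: "homogeneous d 0"
  unfolding homogeneous_def by simp

lemma homogeneous_1 [simp]: "homogeneous 0 1"
  unfolding homogeneous_def by simp

lemma homogeneous_var [simp]: "0 < i \<Longrightarrow> homogeneous (Suc 0) (var i)"
  unfolding homogeneous_def var_def by (auto simp: lookup_single when_def)

lemma homogeneous_add: "homogeneous d f \<Longrightarrow> homogeneous d g \<Longrightarrow> homogeneous d (f + g)"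
  unfolding homogeneous_def using Poly_Mapping.keys_add[of f g] by blast

lemma homogeneous_uminus [simp]: "homogeneous d (- f) \<longleftrightarrow> homogeneous d f"
  unfolding homogeneous_def by simp

lemma homogeneous_diff: "homogeneous d f \<Longrightarrow> homogeneous d g \<Longrightarrow> homogeneous d (f - g)"
  unfolding homogeneous_def using Poly_Mapping.keys_diff[of f g] by blast

lemma homogeneous_sum: "(\<And>a. a \<in> A \<Longrightarrow> homogeneous d (F a)) \<Longrightarrow> homogeneous d (sum F A)"
  by (induction A rule: infinite_finite_induct) (auto intro: homogeneous_add)

lemma homogeneous_mult: "homogeneous d f \<Longrightarrow> homogeneous e g \<Longrightarrow> homogeneous (d + e) (f * g)"
  unfolding homogeneous_def using keys_mult[of f g] by (fastforce simp: lookup_add)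

lemma homogeneous_swap_vars: "0 < i \<Longrightarrow> homogeneous d f \<Longrightarrow> homogeneous d (swap_vars i f)"
  unfolding homogeneous_def
proof (intro ballI)
  fix t
  assume i: "0 < i" and f: "\<forall>t\<in>Poly_Mapping.keys f. total_degree t = d \<and> Poly_Mapping.lookup t 0 = 0"
    and t: "t \<in> Poly_Mapping.keys (swap_vars i f)"
  then have "swap_exps i t \<in> Poly_Mapping.keys f"
    by (simp add: in_keys_iff)
  then have "total_degree (swap_exps i t) = d \<and> Poly_Mapping.lookup (swap_exps i t) 0 = 0"
    using f by blast
  then show "total_degree t = d \<and> Poly_Mapping.lookup t 0 = 0"
    using i by (simp add: transpose_def)
qed

lemma poly_mapping_split:
  fixes f :: "'a \<Rightarrow>\<^sub>0 int"
  obtains g h where "f = g + h" "Poly_Mapping.keys g \<subseteq> A" "Poly_Mapping.keys h \<inter> A = {}"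
proof -
  have "\<exists>g h. f = g + h \<and> Poly_Mapping.keys g \<subseteq> A \<and> Poly_Mapping.keys h \<inter> A = {}"
  proof (induction f rule: update_induct)
    case (update f t c)
    then obtain g h where gh: "f = g + h" "Poly_Mapping.keys g \<subseteq> A" "Poly_Mapping.keys h \<inter> A = {}" by blast
    have eq: "Poly_Mapping.update t c f = f + Poly_Mapping.single t c"
      using update(1) by (intro poly_mapping_eqI) (auto simp: lookup_update lookup_add lookup_single in_keys_iff when_def)
    show ?case
    proof (cases "t \<in> A")
      case True
      then have "Poly_Mapping.keys (g + Poly_Mapping.single t c) \<subseteq> A"
        using gh Poly_Mapping.keys_add[of g "Poly_Mapping.single t c"] by (auto split: if_splits)
      moreover have "Poly_Mapping.update t c f = (g + Poly_Mapping.single t c) + h"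
        unfolding eq unfolding gh(1) by (simp only: ac_simps)
      ultimately show ?thesis using gh by blast
    next
      case False
      then have "Poly_Mapping.keys (h + Poly_Mapping.single t c) \<inter> A = {}"
        using gh Poly_Mapping.keys_add[of h "Poly_Mapping.single t c"] by (auto split: if_splits)
      moreover have "Poly_Mapping.update t c f = g + (h + Poly_Mapping.single t c)"
        unfolding eq unfolding gh(1) by (simp only: ac_simps)
      ultimately show ?thesis using gh by blast
    qed
  qed (intro exI[of _ 0], simp)
  then show ?thesis using that by blast
qed

text \<open>Split the quotient into the part \<open>g\<close> of the right degree and the rest
  \<open>h\<close>. The product of \<open>h\<close> with the difference of variables has no monomial
  of degree \<open>d\<close> free of x_0, yet it is a difference of polynomials consisting of such
  monomials only; so it is 0, and \<open>h\<close> is 0. Written with \<open>Suc\<close>, the claim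
  also covers \<open>d = 0\<close>, where the quotient vanishes.\<close>

lemma homogeneous_divided_difference:
  assumes "0 < i" and "homogeneous d f"
  shows "\<forall>t\<in>Poly_Mapping.keys (divided_difference i f). Suc (total_degree t) = d \<and> Poly_Mapping.lookup t 0 = 0"
proof -
  let ?x = "var i - var (Suc i)"
  let ?A = "{t. Suc (total_degree t) = d \<and> Poly_Mapping.lookup t 0 = 0}"
  let ?B = "{t. total_degree t = d \<and> Poly_Mapping.lookup t 0 = 0}"
  obtain g h where gh: "divided_difference i f = g + h" "Poly_Mapping.keys g \<subseteq> ?A" "Poly_Mapping.keys h \<inter> ?A = {}"
    using poly_mapping_split .
  have x: "\<exists>j>0. t = Poly_Mapping.single j 1" if "t \<in> Poly_Mapping.keys ?x" for t
  proof -
    have "t \<in> Poly_Mapping.keys (var i) \<union> Poly_Mapping.keys (var (Suc i))"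
      using that Poly_Mapping.keys_diff[of "var i" "var (Suc i)"] by (rule rev_subsetD)
    then show ?thesis using assms(1) by (auto simp: var_def)
  qed
  have xh: "?x * h = f - swap_vars i f - ?x * g"
    using divided_difference_mult_diff[of i f] gh(1) by (simp add: algebra_simps)
  have "homogeneous d (f - swap_vars i f)"
    using assms by (intro homogeneous_diff homogeneous_swap_vars)
  moreover have "homogeneous d (?x * g)"
    unfolding homogeneous_def
  proof (intro ballI)
    fix t assume "t \<in> Poly_Mapping.keys (?x * g)"
    then obtain u v where "t = u + v" "u \<in> Poly_Mapping.keys ?x" "v \<in> Poly_Mapping.keys g"
      using keys_mult[of ?x g] by blast
    then show "total_degree t = d \<and> Poly_Mapping.lookup t 0 = 0"
      using gh(2) x[of u] by (auto simp: lookup_add lookup_single when_def)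
  qed
  ultimately have "homogeneous d (?x * h)"
    unfolding xh by (rule homogeneous_diff)
  then have B: "Poly_Mapping.keys (?x * h) \<subseteq> ?B"
    unfolding homogeneous_def by blast
  have "Poly_Mapping.keys (?x * h) \<inter> ?B = {}"
  proof (intro equals0I)
    fix t assume t: "t \<in> Poly_Mapping.keys (?x * h) \<inter> ?B"
    then obtain u v where "t = u + v" "u \<in> Poly_Mapping.keys ?x" "v \<in> Poly_Mapping.keys h"
      using keys_mult[of ?x h] by blast
    then show False
      using gh(3) x[of u] t by (auto simp: lookup_add)
  qed
  then have "Poly_Mapping.keys (?x * h) = {}"
    using B by blast
  then have "?x * h = 0"
    unfolding Poly_Mapping.keys_eq_empty .
  then have "h = 0" by simp
  then show ?thesis using gh by auto
qed

lemma homogeneous_divided_difference_Suc: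
  "0 < i \<Longrightarrow> homogeneous (Suc d) f \<Longrightarrow> homogeneous d (divided_difference i f)"
  using homogeneous_divided_difference[of i "Suc d" f] unfolding homogeneous_def by simp

text \<open>Otherwise exchanging the largest occurring index with the next one yields a monomial with a larger index.\<close>

lemma symmetric_imp_0:
  assumes hom: "homogeneous d f" and "0 < d" and sym: "\<And>i. 0 < i \<Longrightarrow> swap_vars i f = f"
  shows "f = 0"
proof (rule ccontr)
  assume "f \<noteq> 0"
  define J where "J = (\<Union>t\<in>Poly_Mapping.keys f. Poly_Mapping.keys t)"
  have fin: "finite J" unfolding J_def by simp
  obtain t where t: "t \<in> Poly_Mapping.keys f"
    using \<open>f \<noteq> 0\<close> by (metis Poly_Mapping.keys_eq_empty equals0I)
  have "Poly_Mapping.keys t \<noteq> {}"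
    using hom t \<open>0 < d\<close> unfolding homogeneous_def total_degree_def by auto
  then have ne: "J \<noteq> {}" unfolding J_def using t by blast
  then have "Max J \<in> J" using fin by simp
  then obtain u where u: "u \<in> Poly_Mapping.keys f" "Max J \<in> Poly_Mapping.keys u"
    unfolding J_def by blast
  have pos: "0 < Max J"
    using u hom unfolding homogeneous_def by (metis gr0I in_keys_iff)
  have "Poly_Mapping.lookup f (swap_exps (Max J) u) \<noteq> 0"
    using sym[OF pos] u lookup_swap_vars[of "Max J" f u] by (simp add: in_keys_iff)
  moreover have "Suc (Max J) \<in> Poly_Mapping.keys (swap_exps (Max J) u)"
    using u by (simp add: in_keys_iff)
  ultimately have "Suc (Max J) \<in> J"
    unfolding J_def in_keys_iff[of _ f, symmetric] by blast
  then show False using Max_ge[OF fin] by fastforce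
qed

text \<open>The uniqueness principle behind both identifications with complete symmetric
  polynomials. Degree 0 is excluded because every divided difference annihilates the
  constants.\<close>

lemma eq_if_divided_differences_eq:
  assumes "homogeneous d f" "homogeneous d g" "0 < d"
    and "\<And>i. 0 < i \<Longrightarrow> divided_difference i f = divided_difference i g"
  shows "f = g"
proof -
  have "f - g = 0"
  proof (rule symmetric_imp_0)
    show "swap_vars i (f - g) = f - g" if "0 < i" for i
      unfolding divided_difference_eq_0_iff[symmetric] using assms(4)[OF that] by simp
  qed (use assms homogeneous_diff in auto)
  then show ?thesis by simp
qed

section \<open>Schubert polynomials\<close>

lemma reduced_word_Cons_iff:
  assumes w: "fin_perm w"
  shows "reduced_word (i # \<alpha>) w \<longleftrightarrow> 0 < i \<and> inv w (Suc i) < inv w i \<and> reduced_word \<alpha> (simple_refl i \<circ> w)"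
proof (cases "0 < i")
  case True
  have word: "word_perm (i # \<alpha>) = w \<longleftrightarrow> word_perm \<alpha> = simple_refl i \<circ> w"
    by (metis simple_refl_invol(4) word_perm_Cons)
  show ?thesis
  proof (cases "inv w (Suc i) < inv w i")
    case False
    then have "inv w i < inv w (Suc i)"
      using w fin_perm_eq_iff[of "inv w" i "Suc i"] by (metis fin_perm_inv linorder_neqE_nat n_not_Suc_n)
    then have *: "len (simple_refl i \<circ> w) = Suc (len w)"
      using len_left_ascent w True by blast
    have "\<not> reduced_word (i # \<alpha>) w"
    proof
      assume r: "reduced_word (i # \<alpha>) w"
      then have "len (word_perm \<alpha>) \<le> length \<alpha>"
        by (intro len_word_perm_le) (simp add: reduced_word_iff)
      moreover have "word_perm \<alpha> = simple_refl i \<circ> w" "Suc (length \<alpha>) = len w"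
        using r word by (simp_all add: reduced_word_iff del: word_perm_Cons)
      ultimately show False using * by simp
    qed
    then show ?thesis using False by simp
  next
    case desc: True
    then have *: "len w = Suc (len (simple_refl i \<circ> w))"
      using len_left_descent w True by blast
    show ?thesis
      unfolding reduced_word_iff word using True desc * by auto
  qed
qed (simp add: reduced_word_iff)

lemma simple_refl_commute:
  "Suc i < j \<Longrightarrow> simple_refl i \<circ> (simple_refl j \<circ> w) = simple_refl j \<circ> (simple_refl i \<circ> w)"
  by (auto simp: fun_eq_iff simple_refl_def transpose_def)

lemma simple_refl_braid:
  "simple_refl i \<circ> (simple_refl (Suc i) \<circ> (simple_refl i \<circ> w))
    = simple_refl (Suc i) \<circ> (simple_refl i \<circ> (simple_refl (Suc i) \<circ> w))"
  by (auto simp: fun_eq_iff simple_refl_def transpose_def)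

text \<open>The inductive step of Matsumoto's theorem. Both \<open>i\<close> and \<open>j\<close>
  are left descents, so there are reduced words of \<open>w\<close> starting with i j and j i, or
  with i j i and j i j if the letters are adjacent, with a common remainder \<open>\<gamma>\<close>.
  Words with equal first letter are compared by induction, the two special ones by the commutation
  or braid relation.\<close>

lemma foldr_divided_difference_cong_aux:
  assumes w: "fin_perm w" and IH: "\<And>v \<alpha> \<beta>. len v < len w \<Longrightarrow> fin_perm v \<Longrightarrow> reduced_word \<alpha> v \<Longrightarrow>
      reduced_word \<beta> v \<Longrightarrow> foldr divided_difference \<alpha> f = foldr divided_difference \<beta> f"
    and \<alpha>: "reduced_word (i # \<alpha>) w" and \<beta>: "reduced_word (j # \<beta>) w" and "i < j"
  shows "foldr divided_difference (i # \<alpha>) f = foldr divided_difference (j # \<beta>) f"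
proof -
  let ?si = "simple_refl i" and ?sj = "simple_refl j"
  have i: "0 < i" "inv w (Suc i) < inv w i" and ra: "reduced_word \<alpha> (?si \<circ> w)"
    using \<alpha> w by (auto simp: reduced_word_Cons_iff)
  have j: "0 < j" "inv w (Suc j) < inv w j" and rb: "reduced_word \<beta> (?sj \<circ> w)"
    using \<beta> w by (auto simp: reduced_word_Cons_iff)
  have fi: "fin_perm (?si \<circ> w)" "len (?si \<circ> w) < len w" and fj: "fin_perm (?sj \<circ> w)" "len (?sj \<circ> w) < len w"
    using len_left_descent[OF w i] len_left_descent[OF w j] w i j by auto
  show ?thesis
  proof (cases "Suc i < j")
    case True
    let ?u = "?sj \<circ> (?si \<circ> w)"
    have u: "fin_perm ?u" using fi j by simp
    then obtain \<gamma> where \<gamma>: "reduced_word \<gamma> ?u" using exists_reduced_word by blast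
    have inv: "inv (?si \<circ> w) = inv w \<circ> ?si" "inv (?sj \<circ> w) = inv w \<circ> ?sj"
      using w i j by (simp_all add: fin_perm_inv_comp)
    have "reduced_word (j # \<gamma>) (?si \<circ> w)"
      using \<gamma> fi True i j inv by (subst reduced_word_Cons_iff) auto
    then have a: "foldr divided_difference \<alpha> f = foldr divided_difference (j # \<gamma>) f"
      using IH fi ra by blast
    have "reduced_word (i # \<gamma>) (?sj \<circ> w)"
      using \<gamma> fj True i j inv by (subst reduced_word_Cons_iff) (auto simp: simple_refl_commute[OF True, of w])
    then have b: "foldr divided_difference \<beta> f = foldr divided_difference (i # \<gamma>) f"
      using IH fj rb by blast
    show ?thesis using a b divided_difference_commute[OF True] by simp
  next
    case False
    then have [simp]: "j = Suc i" using \<open>i < j\<close> by simp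
    let ?u = "?si \<circ> (?sj \<circ> (?si \<circ> w))"
    have u: "fin_perm ?u" using fi j i by simp
    then obtain \<gamma> where \<gamma>: "reduced_word \<gamma> ?u" using exists_reduced_word by blast
    have inv: "inv (?si \<circ> w) = inv w \<circ> ?si" "inv (?sj \<circ> w) = inv w \<circ> ?sj"
      "inv (?sj \<circ> (?si \<circ> w)) = inv w \<circ> ?si \<circ> ?sj" "inv (?si \<circ> (?sj \<circ> w)) = inv w \<circ> ?sj \<circ> ?si"
      using w i j by (simp_all add: fin_perm_inv_comp)
    have f2: "fin_perm (?sj \<circ> (?si \<circ> w))" "fin_perm (?si \<circ> (?sj \<circ> w))"
      using w i j by simp_all
    have "reduced_word (i # \<gamma>) (?sj \<circ> (?si \<circ> w))"
      using \<gamma> i j by (subst reduced_word_Cons_iff[OF f2(1)]) (simp add: inv(3)[unfolded \<open>j = Suc i\<close>])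
    then have "reduced_word (j # i # \<gamma>) (?si \<circ> w)"
      using i j by (subst reduced_word_Cons_iff[OF fi(1)]) (simp add: inv(1)[unfolded \<open>j = Suc i\<close>])
    then have a: "foldr divided_difference \<alpha> f = foldr divided_difference (j # i # \<gamma>) f"
      using IH fi ra by blast
    have "reduced_word (j # \<gamma>) (?si \<circ> (?sj \<circ> w))"
      using \<gamma> i j simple_refl_braid[of i w] by (subst reduced_word_Cons_iff[OF f2(2)]) (simp add: inv(4)[unfolded \<open>j = Suc i\<close>])
    then have "reduced_word (i # j # \<gamma>) (?sj \<circ> w)"
      using i j by (subst reduced_word_Cons_iff[OF fj(1)]) (simp add: inv(2)[unfolded \<open>j = Suc i\<close>])
    then have b: "foldr divided_difference \<beta> f = foldr divided_difference (i # j # \<gamma>) f"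
      using IH fj rb by blast
    show ?thesis using a b divided_difference_braid by simp
  qed
qed

lemma foldr_divided_difference_cong:
  assumes "fin_perm w" "reduced_word \<alpha> w" "reduced_word \<beta> w"
  shows "foldr divided_difference \<alpha> f = foldr divided_difference \<beta> f"
  using assms
proof (induction "len w" arbitrary: w \<alpha> \<beta> rule: less_induct)
  case less
  show ?case
  proof (cases \<alpha>)
    case Nil
    then show ?thesis using less.prems by (simp add: reduced_word_iff)
  next
    case (Cons i \<alpha>')
    then obtain j \<beta>' where \<beta>: "\<beta> = j # \<beta>'"
      using less.prems by (cases \<beta>) (auto simp: reduced_word_iff)
    consider "i = j" | "i < j" | "j < i" by linarith
    then show ?thesis
    proof cases
      case 1
      have *: "reduced_word \<alpha>' (simple_refl i \<circ> w)" "reduced_word \<beta>' (simple_refl i \<circ> w)"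
        "0 < i" "inv w (Suc i) < inv w i"
        using less.prems Cons \<beta> 1 by (auto simp: reduced_word_Cons_iff)
      have "foldr divided_difference \<alpha>' f = foldr divided_difference \<beta>' f"
        by (rule less.hyps[of "simple_refl i \<circ> w"]) (use * less.prems(1) len_left_descent[of w i] in simp_all)
      then show ?thesis using Cons \<beta> 1 by simp
    next
      case 2
      show ?thesis
        unfolding Cons \<beta>
        by (rule foldr_divided_difference_cong_aux[OF less.prems(1) _ _ _ 2], erule (3) less.hyps)
          (use less.prems Cons \<beta> in simp_all)
    next
      case 3
      show ?thesis
        unfolding Cons \<beta>
        by (rule foldr_divided_difference_cong_aux[OF less.prems(1) _ _ _ 3, symmetric], erule (3) less.hyps)
          (use less.prems Cons \<beta> in simp_all)
    qed
  qed
qed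

section \<open>The longest permutation and stability in n\<close>

lemma longest_perm_longest_perm [simp]: "longest_perm n (longest_perm n i) = i"
  unfolding longest_perm_def by auto

lemma longest_perm_permutes: "longest_perm n permutes {1..n}"
  by (rule bij_imp_permutes[OF bij_betw_byWitness[where f' = "longest_perm n"]])
    (auto simp: longest_perm_def)

lemma fin_perm_longest_perm [simp]: "fin_perm (longest_perm n)"
  unfolding fin_perm_def using longest_perm_permutes by blast

lemma inv_longest_perm [simp]: "inv (longest_perm n) = longest_perm n"
  by (rule inv_unique_comp) auto

lemma longest_perm_less_iff:
  "1 \<le> i \<Longrightarrow> i \<le> n \<Longrightarrow> 1 \<le> j \<Longrightarrow> j \<le> n \<Longrightarrow> longest_perm n i < longest_perm n j \<longleftrightarrow> j < i"
  unfolding longest_perm_def by auto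

lemma permutes_fin_perm: "w permutes {1..n} \<Longrightarrow> fin_perm w"
  unfolding fin_perm_def by blast

lemma schubert_in_eq:
  assumes "fin_perm w" "reduced_word \<alpha> (inv w \<circ> longest_perm n)"
  shows "schubert_in n w = foldr divided_difference \<alpha> (staircase_monomial n)"
  unfolding schubert_in_def using assms
  by (intro foldr_divided_difference_cong[of "inv w \<circ> longest_perm n"] reduced_word_some) auto

text \<open>The letters n, n-1, ... move the value n+1 one place to the left each, past a value at
  most n; so every letter is applied at an ascent.\<close>

lemma len_comp_descending:
  assumes u: "u permutes {1..n}" and "k \<le> n"
  defines "v \<equiv> \<lambda>k. u \<circ> word_perm (rev [Suc (n - k)..<Suc n])"
  shows "len (v k) = len u + k \<and> v k (Suc (n - k)) = Suc n \<and> (\<forall>i \<le> n - k. v k i = u i)"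
  using \<open>k \<le> n\<close>
proof (induction k)
  case 0
  then show ?case using u by (simp add: v_def permutes_def)
next
  case (Suc k)
  define p where "p = n - k"
  have p: "0 < p" "p \<le> n" "n - Suc k = p - 1" using Suc.prems unfolding p_def by auto
  have IH: "len (v k) = len u + k" "v k (Suc p) = Suc n" "\<forall>i\<le>p. v k i = u i"
    using Suc unfolding p_def by auto
  have "rev [Suc (n - Suc k)..<Suc n] = rev [Suc p..<Suc n] @ [p]"
    using p by (simp add: upt_rec[of p] del: upt_Suc)
  then have v: "v (Suc k) = v k \<circ> simple_refl p"
    unfolding v_def p_def[symmetric] by (simp add: o_assoc del: upt_Suc)
  have "u p \<le> n"
    using permutes_in_image[OF u, of p] p by simp
  then have "v k p < v k (Suc p)" using IH by simp
  moreover have "fin_perm (v k)"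
    unfolding v_def using permutes_fin_perm[OF u] by (intro fin_perm_comp fin_perm_word_perm) auto
  ultimately have "len (v (Suc k)) = Suc (len (v k))"
    unfolding v by (intro len_ascent)
  moreover have "v (Suc k) p = Suc n" unfolding v using IH by simp
  moreover have "v (Suc k) i = u i" if "i \<le> p - 1" for i
    unfolding v using IH that p by simp
  ultimately show ?case using IH p by simp
qed

lemma longest_perm_Suc: "longest_perm (Suc n) = longest_perm n \<circ> word_perm (rev [1..<Suc n])"
proof -
  have c: "word_perm (rev [1..<Suc n]) i = (if i = 0 then 0 else if i = 1 then Suc n
      else if i \<le> Suc n then i - 1 else i)" for i
  proof (induction n)
    case (Suc n)
    have "word_perm (rev [1..<Suc (Suc n)]) = simple_refl (Suc n) \<circ> word_perm (rev [1..<Suc n])"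
      by simp
    then show ?case using Suc by (auto simp: simple_refl_def transpose_def simp del: upt_Suc)
  qed auto
  show ?thesis
    by (rule ext) (auto simp: c[unfolded One_nat_def] longest_perm_def simp del: upt_Suc)
qed

lemma len_comp_longest_perm_Suc:
  assumes "u permutes {1..n}"
  shows "len (u \<circ> word_perm (rev [1..<Suc n])) = len u + n"
  using len_comp_descending[OF assms, of n] by (simp del: upt_Suc)

lemma swap_vars_power [simp]: "swap_vars i (f ^ n) = swap_vars i f ^ n"
  by (induction n) auto

lemma swap_vars_prod [simp]: "swap_vars i (prod F A) = (\<Prod>a\<in>A. swap_vars i (F a))"
  by (induction A rule: infinite_finite_induct) auto

lemma divided_difference_var_mult_symmetric:
  assumes "swap_vars i g = g"
  shows "divided_difference i (var i * g) = g"
  by (rule divided_difference_eqI) (simp add: assms algebra_simps)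

text \<open>On the reversed list, \<open>foldr\<close> applies the divided difference of index 1
  first. After \<open>j\<close> of them the exponents of the first \<open>j\<close> variables have
  dropped by one and the others are untouched.\<close>

lemma foldr_divided_difference_staircase:
  "foldr divided_difference (rev [1..<Suc n]) (staircase_monomial (Suc n)) = staircase_monomial n"
proof -
  have "fold divided_difference [1..<Suc j] (staircase_monomial (Suc n))
      = (\<Prod>i=1..j. var i ^ (n - i)) * (\<Prod>i=Suc j..Suc n. var i ^ (Suc n - i))" if "j \<le> n" for j
    using that
  proof (induction j)
    case 0
    then show ?case by (simp add: staircase_monomial_def)
  next
    case (Suc j)
    define P Q where "P = (\<Prod>i=1..j. var i ^ (n - i))" and "Q = (\<Prod>i=Suc (Suc (Suc j))..Suc n. var i ^ (Suc n - i))"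
    \<comment> \<open>In \<open>G\<close> the variables of index j+1 and j+2 have the same exponent
      n-j-1. The current polynomial is \<open>var (Suc j) * G\<close>, and this one surplus factor
      is what the next divided difference removes.\<close>
    define G where "G = P * (var (Suc j) ^ (n - Suc j) * var (Suc (Suc j)) ^ (n - Suc j)) * Q"
    have "swap_vars (Suc j) P = P" "swap_vars (Suc j) Q = Q"
      unfolding P_def Q_def swap_vars_prod by (auto intro!: prod.cong)
    then have sym: "swap_vars (Suc j) G = G"
      unfolding G_def by (simp add: ac_simps)
    have Q: "(\<Prod>i=Suc (Suc j)..Suc n. var i ^ (Suc n - i)) = var (Suc (Suc j)) ^ (n - Suc j) * Q"
      unfolding Q_def using Suc.prems by (subst prod.atLeast_Suc_atMost) auto
    have P: "(\<Prod>i=1..Suc j. var i ^ (n - i)) = P * var (Suc j) ^ (n - Suc j)"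
      unfolding P_def by simp
    have "(\<Prod>i=Suc j..Suc n. var i ^ (Suc n - i))
        = var (Suc j) ^ (n - j) * (var (Suc (Suc j)) ^ (n - Suc j) * Q)"
      unfolding Q[symmetric] using Suc.prems by (subst prod.atLeast_Suc_atMost) auto
    also have "var (Suc j) ^ (n - j) = var (Suc j) * var (Suc j) ^ (n - Suc j)"
      using Suc.prems by (simp add: Suc_diff_Suc flip: power_Suc)
    finally have "fold divided_difference [1..<Suc j] (staircase_monomial (Suc n)) = var (Suc j) * G"
      using Suc unfolding G_def P_def by (simp add: ac_simps del: upt_Suc)
    then have "fold divided_difference [1..<Suc (Suc j)] (staircase_monomial (Suc n)) = G"
      using divided_difference_var_mult_symmetric[OF sym] by simp
    then show ?case unfolding P Q G_def by (simp only: ac_simps)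
  qed
  from this[of n] show ?thesis
    by (simp add: foldr_conv_fold staircase_monomial_def del: upt_Suc)
qed

text \<open>Passing from n to n+1 appends the letters n, ..., 1 to a reduced word of
  \<open>inv w \<circ> longest_perm n\<close>; they act first and turn the larger staircase into the
  smaller one.\<close>

lemma schubert_in_Suc:
  assumes w: "w permutes {1..n}"
  shows "schubert_in (Suc n) w = schubert_in n w"
proof -
  let ?u = "inv w \<circ> longest_perm n" and ?c = "rev [1..<Suc n]"
  have u: "?u permutes {1..n}"
    using w longest_perm_permutes permutes_inv permutes_compose by blast
  have fp: "fin_perm w" "fin_perm ?u" using w u permutes_fin_perm by blast+
  then obtain \<alpha> where \<alpha>: "reduced_word \<alpha> ?u" using exists_reduced_word by blast
  have "word_perm (\<alpha> @ ?c) = inv w \<circ> longest_perm (Suc n)"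
    unfolding longest_perm_Suc word_perm_append using \<alpha> by (simp add: reduced_word_iff comp_assoc del: upt_Suc)
  moreover have "len (inv w \<circ> longest_perm (Suc n)) = len ?u + n"
    unfolding longest_perm_Suc o_assoc by (rule len_comp_longest_perm_Suc[OF u])
  ultimately have "reduced_word (\<alpha> @ ?c) (inv w \<circ> longest_perm (Suc n))"
    using \<alpha> by (auto simp: reduced_word_iff simp del: upt_Suc)
  then have "schubert_in (Suc n) w = foldr divided_difference (\<alpha> @ ?c) (staircase_monomial (Suc n))"
    using schubert_in_eq fp by blast
  also have "\<dots> = schubert_in n w"
    using schubert_in_eq[OF fp(1) \<alpha>] by (simp only: foldr_append foldr_divided_difference_staircase)
  finally show ?thesis .
qed

lemma schubert_eq_schubert_in:
  assumes "w permutes {1..N}"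
  shows "schubert w = schubert_in N w"
proof -
  define n where "n = (LEAST n. w permutes {1..n})"
  have n: "w permutes {1..n}" "n \<le> N"
    unfolding n_def using assms by (rule LeastI, rule Least_le)
  from n(2) have "schubert_in N w = schubert_in n w"
  proof (induction N rule: dec_induct)
    case (step N)
    then show ?case
      using schubert_in_Suc permutes_atLeastAtMost_mono[OF n(1)] by simp
  qed simp
  then show ?thesis unfolding schubert_def n_def by simp
qed

lemma schubert_id [simp]: "schubert id = 1"
proof -
  have "longest_perm 0 = id" by (auto simp: longest_perm_def)
  then have "reduced_word [] (inv id \<circ> longest_perm 0)"
    by (simp add: reduced_word_iff)
  then show ?thesis
    using schubert_eq_schubert_in[of id 0] schubert_in_eq[of id "[]" 0]
    by (simp add: permutes_id staircase_monomial_def)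
qed

section \<open>Divided differences of Schubert polynomials\<close>

lemma descent_less:
  assumes "w permutes {1..n}" "w (Suc i) < w i"
  shows "i < n"
proof (rule ccontr)
  assume "\<not> i < n"
  then have *: "w (Suc i) = Suc i" using assms by (simp add: permutes_def)
  have "w i \<le> i"
  proof (cases "i \<in> {1..n}")
    case True
    then have "w i \<in> {1..n}" using assms(1) permutes_in_image by metis
    then show ?thesis using \<open>\<not> i < n\<close> by simp
  qed (use assms in \<open>auto simp: permutes_def\<close>)
  then show False using * assms by simp
qed

text \<open>An operator acting on permutations from the right is represented by its adjoint on functions of
  permutations; a product is then applied with its rightmost factor first.\<close>

definition down :: "nat \<Rightarrow> ((nat \<Rightarrow> nat) \<Rightarrow> mpol) \<Rightarrow> (nat \<Rightarrow> nat) \<Rightarrow> mpol" where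
  "down i F w = (if w (Suc i) < w i then F (w \<circ> simple_refl i) else 0)"

text \<open>For u = w^{-1} w_0 the inverse w_0 w reverses the order of values. A descent of
  \<open>w\<close> at \<open>i\<close> is therefore a left ascent of u, and \<open>i\<close>
  prolongs its reduced words. At an ascent of \<open>w\<close>, u has a reduced word starting with
  \<open>i\<close>, and the same divided difference applied twice gives 0.\<close>

theorem divided_difference_schubert:
  assumes w: "fin_perm w" and i: "0 < i"
  shows "divided_difference i (schubert w) = down i schubert w"
proof -
  obtain n where "w permutes {1..n}" using w unfolding fin_perm_def by blast
  \<comment> \<open>Both positions \<open>i\<close> and \<open>Suc i\<close> must lie in the range
    that w_0 reverses.\<close>
  define N where "N = max n (Suc i)"
  have N: "w permutes {1..N}" "i < N"
    unfolding N_def by (rule permutes_atLeastAtMost_mono[OF \<open>w permutes {1..n}\<close>]) simp_all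
  let ?u = "inv w \<circ> longest_perm N"
  have u: "fin_perm ?u" using w by simp
  have invu: "inv ?u = longest_perm N \<circ> w"
    using w by (simp add: fin_perm_inv_comp inv_inv_eq fin_perm_bij)
  have rng: "1 \<le> w i" "w i \<le> N" "1 \<le> w (Suc i)" "w (Suc i) \<le> N"
    using permutes_in_image[OF N(1), of i] permutes_in_image[OF N(1), of "Suc i"] N(2) i by auto
  show ?thesis
  proof (cases "w (Suc i) < w i")
    case True
    obtain \<alpha> where \<alpha>: "reduced_word \<alpha> ?u" using u exists_reduced_word by blast
    have ws: "w \<circ> simple_refl i permutes {1..N}"
      unfolding simple_refl_def using N i by (intro permutes_compose[OF permutes_swap_id]) auto
    have "inv (w \<circ> simple_refl i) \<circ> longest_perm N = simple_refl i \<circ> ?u"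
      using w i by (simp add: fin_perm_inv_comp comp_assoc)
    moreover have "reduced_word (i # \<alpha>) (simple_refl i \<circ> ?u)"
      using \<alpha> u i True rng fin_perm_inv_comp[of "simple_refl i" ?u]
      by (subst reduced_word_Cons_iff) (simp_all add: invu longest_perm_less_iff del: inv_longest_perm)
    ultimately have "schubert (w \<circ> simple_refl i) = foldr divided_difference (i # \<alpha>) (staircase_monomial N)"
      using schubert_eq_schubert_in[OF ws] schubert_in_eq[of "w \<circ> simple_refl i" "i # \<alpha>" N] w i by simp
    also have "\<dots> = divided_difference i (schubert w)"
      using schubert_eq_schubert_in[OF N(1)] schubert_in_eq[OF w \<alpha>] by simp
    finally show ?thesis using True by (simp add: down_def)
  next
    case False
    then have asc: "w i < w (Suc i)"
      using fin_perm_eq_iff[OF w, of i "Suc i"] by linarith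
    obtain \<beta> where \<beta>: "reduced_word \<beta> (simple_refl i \<circ> ?u)" using u i exists_reduced_word by fastforce
    have "reduced_word (i # \<beta>) ?u"
      using \<beta> u i asc rng by (subst reduced_word_Cons_iff) (simp_all add: invu longest_perm_less_iff)
    then have "schubert w = divided_difference i (foldr divided_difference \<beta> (staircase_monomial N))"
      using schubert_eq_schubert_in[OF N(1)] schubert_in_eq[OF w, of "i # \<beta>" N] by simp
    then show ?thesis using False by (simp add: down_def)
  qed
qed

section \<open>Degrees of Schubert polynomials\<close>

lemma homogeneous_foldr_divided_difference:
  "\<forall>i\<in>set \<alpha>. 0 < i \<Longrightarrow> homogeneous (d + length \<alpha>) f \<Longrightarrow> homogeneous d (foldr divided_difference \<alpha> f)"
  by (induction \<alpha> arbitrary: d) (simp_all add: homogeneous_divided_difference_Suc flip: add_Suc)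

lemma homogeneous_prod_var: "homogeneous n (\<Prod>i=1..n. var i)"
proof (induction n)
  case (Suc n)
  then show ?case using homogeneous_mult[OF Suc homogeneous_var[of "Suc n"]] by simp
qed simp

lemma homogeneous_staircase: "homogeneous (len (longest_perm n)) (staircase_monomial n)"
proof (induction n)
  case 0
  have "longest_perm 0 = id" by (auto simp: longest_perm_def)
  then have "len (longest_perm 0) = 0" using len_id by metis
  then show ?case by (simp add: staircase_monomial_def)
next
  case (Suc n)
  have "staircase_monomial (Suc n) = (\<Prod>i=1..n. var i ^ (n - i) * var i)"
    unfolding staircase_monomial_def by (auto intro!: prod.cong simp: Suc_diff_le)
  then have "staircase_monomial (Suc n) = staircase_monomial n * (\<Prod>i=1..n. var i)"
    unfolding staircase_monomial_def by (simp add: prod.distrib)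
  moreover have "len (longest_perm (Suc n)) = len (longest_perm n) + n"
    unfolding longest_perm_Suc by (rule len_comp_longest_perm_Suc[OF longest_perm_permutes])
  ultimately show ?case
    using homogeneous_mult[OF Suc homogeneous_prod_var[of n]] by simp
qed

text \<open>Since w_0 reverses the order of values, removing a descent from \<open>w\<close>
  lengthens \<open>inv w \<circ> longest_perm n\<close> by one, so the sum stays constant down to
  the identity.\<close>

lemma len_inv_comp_longest_perm:
  assumes "w permutes {1..n}"
  shows "len (inv w \<circ> longest_perm n) + len w = len (longest_perm n)"
  using assms
proof (induction "len w" arbitrary: w)
  case 0
  then have "w = id" using len_eq_0_iff[of w] permutes_fin_perm by metis
  then show ?case by (simp only: len_id inv_id id_comp add_0_right)
next
  case (Suc l)
  have w: "fin_perm w" using Suc.prems permutes_fin_perm by blast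
  obtain p where p: "0 < p" "w (Suc p) < w p"
    using exists_descent[OF w] Suc.hyps(2) by (metis len_id nat.distinct(1))
  have "p < n" using descent_less Suc.prems p by blast
  let ?v = "w \<circ> simple_refl p"
  have v: "?v permutes {1..n}" "fin_perm ?v"
    unfolding simple_refl_def using Suc.prems p \<open>p < n\<close> w
    by (auto intro!: permutes_compose[OF permutes_swap_id])
  have len: "len w = Suc (len ?v)" using len_descent[OF w p] .
  let ?u = "inv ?v \<circ> longest_perm n"
  have u: "fin_perm ?u" using v by simp
  have invu: "inv ?u = longest_perm n \<circ> ?v"
    using v w p by (simp add: fin_perm_inv_comp inv_inv_eq fin_perm_bij comp_assoc)
  have "1 \<le> w p" "w p \<le> n" "1 \<le> w (Suc p)" "w (Suc p) \<le> n"
    using permutes_in_image[OF Suc.prems, of p] permutes_in_image[OF Suc.prems, of "Suc p"] p \<open>p < n\<close> by auto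
  then have "inv ?u (Suc p) < inv ?u p"
    unfolding invu using p by (simp add: longest_perm_less_iff)
  then have "len ?u = Suc (len (simple_refl p \<circ> ?u))"
    using len_left_descent[OF u p(1)] by blast
  moreover have "simple_refl p \<circ> ?u = inv w \<circ> longest_perm n"
    using w p by (simp add: fin_perm_inv_comp comp_assoc)
  ultimately show ?case
    using Suc.hyps(1)[of ?v] Suc.hyps(2) v len by simp
qed

lemma homogeneous_schubert:
  assumes w: "fin_perm w"
  shows "homogeneous (len w) (schubert w)"
proof -
  obtain n where n: "w permutes {1..n}" using w unfolding fin_perm_def by blast
  have "fin_perm (inv w \<circ> longest_perm n)" using w by simp
  then obtain \<alpha> where \<alpha>: "reduced_word \<alpha> (inv w \<circ> longest_perm n)"
    using exists_reduced_word by blast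
  have "homogeneous (len w) (foldr divided_difference \<alpha> (staircase_monomial n))"
    using \<alpha> len_inv_comp_longest_perm[OF n] homogeneous_staircase[of n]
    by (intro homogeneous_foldr_divided_difference) (auto simp: reduced_word_iff ac_simps)
  then show ?thesis
    using schubert_eq_schubert_in[OF n] schubert_in_eq[OF w \<alpha>] by simp
qed

section \<open>The Pieri operators\<close>

definition up :: "nat \<Rightarrow> nat \<Rightarrow> ((nat \<Rightarrow> nat) \<Rightarrow> mpol) \<Rightarrow> (nat \<Rightarrow> nat) \<Rightarrow> mpol" where
  "up a b F w = (if len (w \<circ> transpose a b) = Suc (len w)
     then (if a < b then F (w \<circ> transpose a b) else - F (w \<circ> transpose a b)) else 0)"

text \<open>The recursion is that of \<open>complete_sym\<close>, with multiplication by x_a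
  replaced by the sum of all \<open>up a b\<close>: the head of the list is either given up or used
  for the next factor. Deleting \<open>b\<close> from \<open>B\<close> keeps the second indices
  distinct.\<close>

fun pieri :: "nat list \<Rightarrow> nat set \<Rightarrow> nat \<Rightarrow> ((nat \<Rightarrow> nat) \<Rightarrow> mpol) \<Rightarrow> (nat \<Rightarrow> nat) \<Rightarrow> mpol" where
  "pieri as B 0 F w = F w"
| "pieri [] B (Suc m) F w = 0"
| "pieri (a # as) B (Suc m) F w
     = pieri as B (Suc m) F w + (\<Sum>b\<in>B. up a b (pieri (a # as) (B - {b}) m F) w)"

lemma pieri_0: "pieri as B 0 F = F"
  by (rule ext) simp

lemma pieri_Cons_Suc: "pieri (a # as) B (Suc m) F
    = (\<lambda>w. pieri as B (Suc m) F w + (\<Sum>b\<in>B. up a b (pieri (a # as) (B - {b}) m F) w))"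
  by (rule ext) simp

lemma up_cong:
  "(\<And>v. fin_perm v \<Longrightarrow> F v = G v) \<Longrightarrow> fin_perm w \<Longrightarrow> 0 < a \<Longrightarrow> 0 < b \<Longrightarrow> up a b F w = up a b G w"
  unfolding up_def by simp

lemma up_add: "up a b (\<lambda>v. F v + G v) w = up a b F w + up a b G w"
  unfolding up_def by simp

lemma up_sum: "up a b (\<lambda>v. \<Sum>x\<in>X. F x v) w = (\<Sum>x\<in>X. up a b (F x) w)"
  unfolding up_def by (simp add: sum_negf)

lemma up_mult: "up a b (\<lambda>v. c * F v) w = c * up a b F w"
  unfolding up_def by simp

lemma up_flip: "a \<noteq> b \<Longrightarrow> up b a F w = - up a b F w"
  unfolding up_def transpose_commute[of b a] by auto

lemma divided_difference_up: "divided_difference i (up a b F w) = up a b (\<lambda>v. divided_difference i (F v)) w"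
  unfolding up_def by simp

lemma down_add: "down i (\<lambda>v. F v + G v) w = down i F w + down i G w"
  unfolding down_def by simp

lemma down_sum: "down i (\<lambda>v. \<Sum>x\<in>X. F x v) w = (\<Sum>x\<in>X. down i (F x) w)"
  unfolding down_def by simp

section \<open>Relations among the operators\<close>

text \<open>Both orders lead to the same permutation, two above \<open>w\<close> in length. The
  steps of the other path lengthen too, because disjoint positions do not affect each other's
  values; two strict increases with total two are covers.\<close>

lemma cover_commute_aux:
  assumes w: "fin_perm w" and pos: "0 < a" "0 < c" and lt: "a < b" "c < d"
    and disj: "a \<noteq> c" "a \<noteq> d" "b \<noteq> c" "b \<noteq> d"
    and cov: "len (w \<circ> transpose a b) = Suc (len w)"
      "len (w \<circ> transpose a b \<circ> transpose c d) = Suc (len (w \<circ> transpose a b))"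
  shows "len (w \<circ> transpose c d) = Suc (len w)"
    "len (w \<circ> transpose c d \<circ> transpose a b) = Suc (len (w \<circ> transpose c d))"
proof -
  have comm: "w \<circ> transpose a b \<circ> transpose c d = w \<circ> transpose c d \<circ> transpose a b"
    using disj by (auto simp: fun_eq_iff transpose_def)
  have "w a < w b"
    using cov(1) len_transpose_less_iff[OF w pos(1) lt(1)] by simp
  moreover have "w c < w d"
    using cov(2) len_transpose_less_iff[of "w \<circ> transpose a b" c d] w pos lt disj
    by (simp add: transpose_def)
  ultimately have "len w < len (w \<circ> transpose c d)"
    "len (w \<circ> transpose c d) < len (w \<circ> transpose c d \<circ> transpose a b)"
    using w pos lt disj by (auto simp: transpose_def intro!: len_transpose_less)
  then show "len (w \<circ> transpose c d) = Suc (len w)"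
    "len (w \<circ> transpose c d \<circ> transpose a b) = Suc (len (w \<circ> transpose c d))"
    using cov unfolding comm by linarith+
qed

lemma cover_commute:
  assumes "fin_perm w" "0 < a" "0 < b" "0 < c" "0 < d" "distinct [a, b, c, d]"
  shows "len (w \<circ> transpose a b) = Suc (len w) \<and>
      len (w \<circ> transpose a b \<circ> transpose c d) = Suc (len (w \<circ> transpose a b)) \<longleftrightarrow>
    len (w \<circ> transpose c d) = Suc (len w) \<and>
      len (w \<circ> transpose c d \<circ> transpose a b) = Suc (len (w \<circ> transpose c d))"
proof -
  have *: "len (w \<circ> transpose a b) = Suc (len w) \<and>
      len (w \<circ> transpose a b \<circ> transpose c d) = Suc (len (w \<circ> transpose a b)) \<longleftrightarrow>
    len (w \<circ> transpose c d) = Suc (len w) \<and>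
      len (w \<circ> transpose c d \<circ> transpose a b) = Suc (len (w \<circ> transpose c d))" (is "?A \<longleftrightarrow> ?B")
    if "a < b" "c < d" "0 < a" "0 < c" "distinct [a, b, c, d]" for a b c d :: nat
  proof (intro iffI; elim conjE)
    have dist: "a \<noteq> c" "a \<noteq> d" "b \<noteq> c" "b \<noteq> d" "c \<noteq> a" "c \<noteq> b" "d \<noteq> a" "d \<noteq> b"
      using that(5) by auto
    show ?B if "len (w \<circ> transpose a b) = Suc (len w)"
      "len (w \<circ> transpose a b \<circ> transpose c d) = Suc (len (w \<circ> transpose a b))"
      using cover_commute_aux[OF assms(1) \<open>0 < a\<close> \<open>0 < c\<close> \<open>a < b\<close> \<open>c < d\<close> dist(1-4) that] by (rule conjI)
    show ?A if "len (w \<circ> transpose c d) = Suc (len w)"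
      "len (w \<circ> transpose c d \<circ> transpose a b) = Suc (len (w \<circ> transpose c d))"
      using cover_commute_aux[OF assms(1) \<open>0 < c\<close> \<open>0 < a\<close> \<open>c < d\<close> \<open>a < b\<close> dist(5-8) that] by (rule conjI)
  qed
  consider "a < b" "c < d" | "a < b" "d < c" | "b < a" "c < d" | "b < a" "d < c"
    using assms by fastforce
  then show ?thesis
  proof cases
    case 1
    then show ?thesis using * assms by blast
  next
    case 2
    then show ?thesis using *[of a b d c] assms by (simp add: transpose_commute[of c d])
  next
    case 3
    then show ?thesis using *[of b a c d] assms by (simp add: transpose_commute[of a b])
  next
    case 4
    then show ?thesis using *[of b a d c] assms by (simp add: transpose_commute[of c d] transpose_commute[of a b])
  qed
qed

lemma up_commute:
  assumes "fin_perm w" "0 < a" "0 < b" "0 < c" "0 < d" "distinct [a, b, c, d]"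
  shows "up a b (up c d F) w = up c d (up a b F) w"
proof -
  have "w \<circ> transpose a b \<circ> transpose c d = w \<circ> transpose c d \<circ> transpose a b"
    using assms by (auto simp: fun_eq_iff transpose_def)
  then show ?thesis
    using cover_commute[OF assms] unfolding up_def by auto
qed

lemma transpose_simple_refl:
  "w \<circ> transpose a b \<circ> simple_refl i = w \<circ> simple_refl i \<circ> transpose (simple_refl i a) (simple_refl i b)"
  by (auto simp: fun_eq_iff transpose_def simple_refl_def)

text \<open>Consider the square \<open>w\<close>, \<open>x\<close>, \<open>y\<close>,
  \<open>z\<close>. The two edges given by \<open>simple_refl i\<close> change the length by one;
  the two transposition edges rise together, as both compare \<open>w a\<close> with
  \<open>w b\<close>. If one path from \<open>w\<close> to \<open>z\<close> rises and then falls by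
  one, the ends have equal length, and the other path must fall and then rise by one.\<close>

lemma cover_simple_refl:
  assumes w: "fin_perm w" and pos: "0 < i" "0 < a" "a < b" and ne: "(a, b) \<noteq> (i, Suc i)"
  shows "len (w \<circ> transpose a b) = Suc (len w) \<and> (w \<circ> transpose a b) (Suc i) < (w \<circ> transpose a b) i
    \<longleftrightarrow> w (Suc i) < w i \<and>
      len (w \<circ> simple_refl i \<circ> transpose (simple_refl i a) (simple_refl i b)) = Suc (len (w \<circ> simple_refl i))"
proof -
  define x y where "x = w \<circ> transpose a b" and "y = w \<circ> simple_refl i"
  let ?sa = "simple_refl i a" and ?sb = "simple_refl i b"
  define z where "z = y \<circ> transpose ?sa ?sb"
  have z: "z = x \<circ> simple_refl i"
    unfolding z_def x_def y_def transpose_simple_refl ..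
  have fp: "fin_perm x" "fin_perm y" unfolding x_def y_def using w pos by auto
  have lt: "?sa < ?sb" using simple_refl_less pos ne by blast
  have sa: "0 < ?sa" using pos by (auto simp: simple_refl_def transpose_def)
  have x: "len w < len x \<longleftrightarrow> w a < w b"
    unfolding x_def using len_transpose_less_iff w pos by blast
  have y: "len y < len z \<longleftrightarrow> w a < w b"
    unfolding z_def using len_transpose_less_iff[OF fp(2) sa lt] by (simp add: y_def)
  have wasc: "len y = Suc (len w)" if "w i < w (Suc i)"
    using len_ascent[OF w that] unfolding y_def .
  have wdesc: "len w = Suc (len y)" if "w (Suc i) < w i"
    using len_descent[OF w pos(1) that] unfolding y_def .
  have xasc: "len z = Suc (len x)" if "x i < x (Suc i)"
    using len_ascent[OF fp(1) that] unfolding z .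
  have xdesc: "len x = Suc (len z)" if "x (Suc i) < x i"
    using len_descent[OF fp(1) pos(1) that] unfolding z .
  have ne: "w i < w (Suc i) \<or> w (Suc i) < w i" "x i < x (Suc i) \<or> x (Suc i) < x i"
    using fin_perm_eq_iff[OF w, of i "Suc i"] fin_perm_eq_iff[OF fp(1), of i "Suc i"] by linarith+
  have "len x = Suc (len w) \<and> x (Suc i) < x i \<longleftrightarrow> w (Suc i) < w i \<and> len z = Suc (len y)"
  proof
    assume A: "len x = Suc (len w) \<and> x (Suc i) < x i"
    then have "len y < len z" "len w = len z" using x y xdesc by auto
    then have "\<not> w i < w (Suc i)" using wasc by force
    then have desc: "w (Suc i) < w i" using ne(1) by blast
    show "w (Suc i) < w i \<and> len z = Suc (len y)"
      using desc wdesc[OF desc] \<open>len w = len z\<close> by simp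
  next
    assume A: "w (Suc i) < w i \<and> len z = Suc (len y)"
    then have "len w < len x" "len w = len z" using x y wdesc by auto
    then have "\<not> x i < x (Suc i)" using xasc by force
    then have desc: "x (Suc i) < x i" using ne(2) by blast
    show "len x = Suc (len w) \<and> x (Suc i) < x i"
      using desc xdesc[OF desc] \<open>len w = len z\<close> by simp
  qed
  then show ?thesis unfolding z_def x_def y_def .
qed

lemma up_down:
  assumes w: "fin_perm w" and pos: "0 < i" "0 < a" "0 < b" "a \<noteq> b" and ne: "{a, b} \<noteq> {i, Suc i}"
  shows "up a b (down i F) w = down i (up (simple_refl i a) (simple_refl i b) F) w"
proof -
  have *: "up a b (down i F) w = down i (up (simple_refl i a) (simple_refl i b) F) w"
    if lt: "a < b" and pos: "0 < a" and ne: "{a, b} \<noteq> {i, Suc i}" for a b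
  proof -
    have ne: "(a, b) \<noteq> (i, Suc i)" using ne by auto
    have "simple_refl i a < simple_refl i b" using simple_refl_less lt ne by blast
    then show ?thesis
      using cover_simple_refl[OF w \<open>0 < i\<close> pos lt ne] lt
      unfolding up_def down_def transpose_simple_refl[symmetric] by auto
  qed
  show ?thesis
  proof (cases "a < b")
    case True
    then show ?thesis using * pos ne by blast
  next
    case False
    have sne: "simple_refl i b \<noteq> simple_refl i a"
      using pos by (metis simple_refl_invol(1))
    have "up a b (down i F) w = - up b a (down i F) w"
      using up_flip[of b a] pos by simp
    also have "\<dots> = - down i (up (simple_refl i b) (simple_refl i a) F) w"
      using *[of b a] False pos ne by (simp add: insert_commute)
    also have "\<dots> = down i (up (simple_refl i a) (simple_refl i b) F) w"
      using up_flip[OF sne] unfolding down_def by auto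
    finally show ?thesis .
  qed
qed

text \<open>Exactly one summand survives, according to whether \<open>i\<close> is an ascent or a
  descent, and its two steps cancel.\<close>

lemma up_down_simple:
  assumes w: "fin_perm w" and i: "0 < i"
  shows "up i (Suc i) (down i F) w + down i (up i (Suc i) F) w = F w"
proof (cases "w i < w (Suc i)")
  case True
  then show ?thesis
    using len_ascent[OF w True] unfolding up_def down_def simple_refl_def[symmetric] by simp
next
  case False
  then have "w (Suc i) < w i"
    using fin_perm_eq_iff[OF w, of i "Suc i"] by linarith
  then show ?thesis
    using len_descent[OF w i] unfolding up_def down_def simple_refl_def[symmetric] by simp
qed

section \<open>Independence of the order of the first indices\<close>

lemma pieri_Cons_cong:
  assumes "\<And>B' m v. B' \<subseteq> B \<Longrightarrow> fin_perm v \<Longrightarrow> pieri as B' m F v = pieri as' B' m F v"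
    and "fin_perm w" "0 < a" "\<forall>b\<in>B. 0 < b"
  shows "pieri (a # as) B m F w = pieri (a # as') B m F w"
  using assms
proof (induction m arbitrary: B w)
  case (Suc m)
  have "up a b (pieri (a # as) (B - {b}) m F) w = up a b (pieri (a # as') (B - {b}) m F) w" if "b \<in> B" for b
  proof (intro up_cong Suc.IH)
    show "pieri as B' m' F v = pieri as' B' m' F v" if "B' \<subseteq> B - {b}" "fin_perm v" for B' m' v
      using Suc.prems(1) that by blast
  qed (use Suc.prems that in auto)
  then show ?case using Suc.prems by simp
qed simp

text \<open>In the terms starting with \<open>up a b\<close>, induction brings \<open>a'\<close> to
  the front of the remaining list; a second expansion then leaves terms with \<open>a\<close> alone
  and mixed terms starting with \<open>up a b\<close> and \<open>up a' c\<close>. The mixed terms of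
  the two orders agree because these operators commute and the double sum over distinct
  \<open>b\<close>, \<open>c\<close> can be exchanged.\<close>

lemma pieri_swap:
  assumes "fin_perm w" "finite B" "0 < a" "0 < a'" "a \<noteq> a'" "a \<notin> B" "a' \<notin> B" "\<forall>b\<in>B. 0 < b"
  shows "pieri (a # a' # as) B m F w = pieri (a' # a # as) B m F w"
  using assms
proof (induction m arbitrary: B w rule: less_induct)
  case (less m)
  have flip: "up a b (pieri (a # a' # as) (B - {b}) k F) w = up a b (pieri (a' # a # as) (B - {b}) k F) w"
    "up a' b (pieri (a' # a # as) (B - {b}) k F) w = up a' b (pieri (a # a' # as) (B - {b}) k F) w"
    if "b \<in> B" "k < m" for b k
    using less.prems that by (auto intro!: up_cong less.IH less.IH[symmetric])
  consider "m = 0" | "m = Suc 0" | k where "m = Suc (Suc k)"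
    by (metis not0_implies_Suc)
  then show ?case
  proof cases
    case 3
    have expand: "(\<Sum>b\<in>B. up x b (pieri (x # y # as) (B - {b}) (Suc k) F) w)
        = (\<Sum>b\<in>B. up x b (pieri (x # as) (B - {b}) (Suc k) F) w)
          + (\<Sum>b\<in>B. \<Sum>c\<in>B - {b}. up x b (up y c (pieri (y # x # as) (B - {b} - {c}) k F)) w)"
      if "{x, y} = {a, a'}" for x y
    proof -
      have "up x b (pieri (x # y # as) (B - {b}) (Suc k) F) w = up x b (pieri (y # x # as) (B - {b}) (Suc k) F) w"
        if "b \<in> B" for b
        using flip[OF that, of "Suc k"] 3 \<open>{x, y} = {a, a'}\<close> by (auto simp: doubleton_eq_iff)
      then show ?thesis
        by (simp only: pieri_Cons_Suc[of y] up_add up_sum sum.distrib cong: sum.cong)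
    qed
    have "(\<Sum>b\<in>B. \<Sum>c\<in>B - {b}. up a b (up a' c (pieri (a' # a # as) (B - {b} - {c}) k F)) w)
        = (\<Sum>b\<in>B. \<Sum>c | c \<in> B \<and> b \<noteq> c. up a b (up a' c (pieri (a' # a # as) (B - {b} - {c}) k F)) w)"
      by (intro sum.cong) auto
    also have "\<dots> = (\<Sum>c\<in>B. \<Sum>b | b \<in> B \<and> b \<noteq> c. up a b (up a' c (pieri (a' # a # as) (B - {b} - {c}) k F)) w)"
      using less.prems(2) by (rule sum.swap_restrict) (rule less.prems(2))
    also have "\<dots> = (\<Sum>c\<in>B. \<Sum>b\<in>B - {c}. up a' c (up a b (pieri (a # a' # as) (B - {c} - {b}) k F)) w)"
    proof (intro sum.cong)
      fix c b assume cb: "c \<in> B" "b \<in> B - {c}"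
      have "up a b (up a' c (pieri (a' # a # as) (B - {b} - {c}) k F)) w
          = up a' c (up a b (pieri (a' # a # as) (B - {b} - {c}) k F)) w"
        using less.prems cb by (intro up_commute) auto
      have diff: "B - {b} - {c} = B - {c} - {b}" by auto
      note \<open>up a b (up a' c (pieri (a' # a # as) (B - {b} - {c}) k F)) w
          = up a' c (up a b (pieri (a' # a # as) (B - {b} - {c}) k F)) w\<close>
      also have "up a' c (up a b (pieri (a' # a # as) (B - {b} - {c}) k F)) w
          = up a' c (up a b (pieri (a # a' # as) (B - {c} - {b}) k F)) w"
        using less.prems cb 3 unfolding diff
        by (intro up_cong less.IH[symmetric]) auto
      finally show "up a b (up a' c (pieri (a' # a # as) (B - {b} - {c}) k F)) w
          = up a' c (up a b (pieri (a # a' # as) (B - {c} - {b}) k F)) w" .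
    qed auto
    finally have mixed: "(\<Sum>b\<in>B. \<Sum>c\<in>B - {b}. up a b (up a' c (pieri (a' # a # as) (B - {b} - {c}) k F)) w)
        = (\<Sum>c\<in>B. \<Sum>b\<in>B - {c}. up a' c (up a b (pieri (a # a' # as) (B - {c} - {b}) k F)) w)" .
    have two: "pieri (x # y # as) B m F w = pieri as B m F w + (\<Sum>b\<in>B. up y b (pieri (y # as) (B - {b}) (Suc k) F) w)
        + (\<Sum>b\<in>B. up x b (pieri (x # y # as) (B - {b}) (Suc k) F) w)" for x y
      unfolding 3 pieri.simps(3)[of x "y # as"] pieri.simps(3)[of y as] ..
    show ?thesis
      unfolding two using expand[of a a'] expand[of a' a] mixed by (simp only: insert_commute ac_simps)
  qed (simp_all add: pieri_0 add.commute add.left_commute)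
qed

lemma pieri_move_front:
  assumes "fin_perm w" "finite B" "distinct (xs @ a # ys)" "set (xs @ a # ys) \<inter> B = {}"
    "\<forall>b\<in>B. 0 < b" "\<forall>x\<in>set (xs @ a # ys). 0 < x"
  shows "pieri (xs @ a # ys) B m F w = pieri (a # xs @ ys) B m F w"
  using assms
proof (induction xs arbitrary: B m w)
  case (Cons x xs)
  have "pieri (x # (xs @ a # ys)) B m F w = pieri (x # (a # xs @ ys)) B m F w"
  proof (rule pieri_Cons_cong)
    fix B' m v assume "B' \<subseteq> B" "fin_perm v"
    then show "pieri (xs @ a # ys) B' m F v = pieri (a # xs @ ys) B' m F v"
      using Cons.prems finite_subset by (intro Cons.IH) auto
  qed (use Cons.prems in auto)
  also have "\<dots> = pieri (a # x # xs @ ys) B m F w"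
    using Cons.prems by (intro pieri_swap) auto
  finally show ?case by simp
qed simp

lemma pieri_mset_eq:
  assumes "mset as = mset as'" "fin_perm w" "finite B" "distinct as" "set as \<inter> B = {}"
    "\<forall>b\<in>B. 0 < b" "\<forall>x\<in>set as. 0 < x"
  shows "pieri as B m F w = pieri as' B m F w"
  using assms
proof (induction as arbitrary: as' B m w)
  case (Cons a as)
  then obtain xs ys where as': "as' = xs @ a # ys"
    by (metis list.set_intros(1) set_mset_mset split_list)
  then have ms: "mset as = mset (xs @ ys)" using Cons.prems by simp
  have d: "distinct as'" "set as' = set (a # as)"
    using Cons.prems mset_eq_imp_distinct_iff mset_eq_setD by (metis, metis)
  have "pieri (a # as) B m F w = pieri (a # xs @ ys) B m F w"
  proof (rule pieri_Cons_cong)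
    fix B' m v assume "B' \<subseteq> B" "fin_perm v"
    then show "pieri as B' m F v = pieri (xs @ ys) B' m F v"
      using Cons.prems ms finite_subset by (intro Cons.IH) auto
  qed (use Cons.prems in auto)
  also have "\<dots> = pieri as' B m F w"
    using Cons.prems d as' by (subst pieri_move_front[symmetric]) auto
  finally show ?case .
qed simp

section \<open>Passing \<open>down i\<close> through the Pieri sums\<close>

lemma simple_refl_image_diff: "simple_refl i ` (B - {b}) = simple_refl i ` B - {simple_refl i b}"
  using inj_simple_refl by (auto simp: inj_eq)

lemma simple_refl_image_eq: "(i \<in> B \<longleftrightarrow> Suc i \<in> B) \<Longrightarrow> simple_refl i ` B = B"
  by (auto simp: image_iff) (metis simple_refl_simps)+

lemma pieri_down:
  assumes "fin_perm w" "0 < i" "finite B" "\<forall>b\<in>B. 0 < b" "\<forall>a\<in>set as. 0 < a" "set as \<inter> B = {}"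
    "\<forall>a\<in>set as. \<forall>b\<in>B. {a, b} \<noteq> {i, Suc i}"
  shows "pieri as B m (down i F) w = down i (pieri (map (simple_refl i) as) (simple_refl i ` B) m F) w"
  using assms
proof (induction as B m "down i F" w rule: pieri.induct)
  case (1 as B w)
  then show ?case by (simp add: down_def)
next
  case (2 B m w)
  then show ?case by (simp add: down_def)
next
  case (3 a as B m w)
  have "up a b (pieri (a # as) (B - {b}) m (down i F)) w
      = down i (up (simple_refl i a) (simple_refl i b)
          (pieri (map (simple_refl i) (a # as)) (simple_refl i ` B - {simple_refl i b}) m F)) w"
    if "b \<in> B" for b
  proof -
    have "up a b (pieri (a # as) (B - {b}) m (down i F)) w
        = up a b (down i (pieri (map (simple_refl i) (a # as)) (simple_refl i ` (B - {b})) m F)) w"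
      using "3.prems" that by (intro up_cong "3.hyps"(2)) auto
    also have "\<dots> = down i (up (simple_refl i a) (simple_refl i b)
          (pieri (map (simple_refl i) (a # as)) (simple_refl i ` (B - {b})) m F)) w"
      using "3.prems" that by (intro up_down) auto
    finally show ?thesis unfolding simple_refl_image_diff .
  qed
  moreover have "pieri as B (Suc m) (down i F) w
      = down i (pieri (map (simple_refl i) as) (simple_refl i ` B) (Suc m) F) w"
    using "3.prems" by (intro "3.hyps"(1)) auto
  ultimately show ?case
    using inj_on_subset[OF inj_simple_refl[of i], of B]
    by (simp add: pieri_Cons_Suc[of "simple_refl i a"] down_add down_sum sum.reindex)
qed

text \<open>In the term containing \<open>t\<^sub>x\<^sub>y\<close>, which does not commute with \<open>down i\<close>, the extra summand
  of \<open>up_down_simple\<close> deletes this factor and turns the later factors with \<open>a = x\<close> into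
  factors with \<open>a = y\<close>.\<close>

lemma pieri_down_pair:
  fixes i x y :: nat
  assumes "fin_perm w" "0 < i" "finite B" "\<forall>b\<in>B. 0 < b" "\<forall>a\<in>set as. 0 < a" "set as \<inter> B = {}"
    and xy: "{x, y} = {i, Suc i}" and "x \<notin> B" "y \<in> B" "x \<notin> set as"
  defines "\<epsilon> \<equiv> (if x = i then 1 else -1)"
  shows "pieri (x # as) B (Suc m) (down i F) w
    = down i (pieri (y # as) (simple_refl i ` B) (Suc m) F) w + \<epsilon> * pieri (x # y # as) (B - {y}) m F w"
proof -
  \<comment> \<open>The correction term has one factor less. Setting it to 0 for
    \<open>m = 0\<close> lets the induction start there.\<close>
  define R where "R B m v = (case m of 0 \<Rightarrow> 0 | Suc k \<Rightarrow> pieri (x # y # as) (B - {y}) k F v)" for B m v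
  have sx: "simple_refl i x = y" "simple_refl i y = x" "0 < x" "0 < y" "x \<noteq> y"
    using xy \<open>0 < i\<close> by (auto simp: doubleton_eq_iff)
  have R_0: "R B 0 = (\<lambda>_. 0)" for B
    unfolding R_def by simp
  have R_Suc: "R B (Suc m) w = pieri (y # as) (B - {y}) m F w + (\<Sum>b\<in>B - {y}. up x b (R (B - {b}) m) w)"
    for B m w
  proof (cases m)
    case (Suc k)
    have "R (B - {b}) m = pieri (x # y # as) (B - {y} - {b}) k F" for b
      unfolding R_def Suc by (simp add: Diff_insert2[symmetric] insert_commute Diff_insert[symmetric])
    then show ?thesis unfolding Suc by (simp add: R_def)
  qed (simp add: R_0 R_def pieri_0 up_def cong: if_cong)
  have "pieri (x # as) B m (down i F) w = down i (pieri (y # as) (simple_refl i ` B) m F) w + \<epsilon> * R B m w" for m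
    using assms(1,3,4,6,8,9)
  proof (induction m arbitrary: B w)
    case 0
    then show ?case by (simp add: R_def pieri_0)
  next
    case (Suc m)
    have as: "map (simple_refl i) as = as"
      using Suc.prems \<open>x \<notin> set as\<close> xy by (intro map_idI simple_refl_simps(3)) (auto simp: doubleton_eq_iff)
    have no: "{a, b} \<noteq> {i, Suc i}" if "a \<in> set as" for a b
      using that Suc.prems \<open>x \<notin> set as\<close> xy by (auto simp: doubleton_eq_iff)
    have no': "{x, b} \<noteq> {i, Suc i}" "simple_refl i b = b" "b \<noteq> x" "0 < b" if "b \<in> B - {y}" for b
    proof -
      have "b \<noteq> i" "b \<noteq> Suc i" using that Suc.prems xy by (auto simp: doubleton_eq_iff)
      then show "{x, b} \<noteq> {i, Suc i}" "simple_refl i b = b" by (auto simp: doubleton_eq_iff)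
    qed (use that Suc.prems in auto)
    have sBy: "simple_refl i ` (B - {y}) = B - {y}"
      using no'(2) by simp
    have sB: "simple_refl i ` B = insert x (B - {y})"
      using Suc.prems sx sBy by (metis image_insert insert_Diff)
    \<comment> \<open>\<open>G\<close> describes what follows the exceptional factor: with
      \<open>y\<close> deleted from \<open>B\<close> no further exceptional pair can occur, so
      \<open>pieri_down\<close> handles the rest.\<close>
    define G where "G = pieri (y # as) (B - {y}) m F"
    have head: "pieri as B (Suc m) (down i F) w = down i (pieri as (simple_refl i ` B) (Suc m) F) w"
      using pieri_down[of w i B as] Suc.prems assms(2,5) no as by simp
    have "up x y (pieri (x # as) (B - {y}) m (down i F)) w = up x y (down i G) w"
    proof (rule up_cong)
      fix v assume "fin_perm v"
      then show "pieri (x # as) (B - {y}) m (down i F) v = down i G v"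
        unfolding G_def using pieri_down[of v i "B - {y}" "x # as" m F] Suc.prems assms(2,5) no no' as sx sBy
        by auto
    qed (use Suc.prems sx in auto)
    \<comment> \<open>This is \<open>up_down_simple\<close>; the sign is that of
      \<open>up x y\<close> relative to \<open>up i (Suc i)\<close>.\<close>
    also have "\<dots> = down i (up y x G) w + \<epsilon> * G w"
    proof (cases "x = i")
      case True
      then have [simp]: "y = Suc i" using sx by simp
      have "down i (up y x G) w = - down i (up x y G) w"
        using up_flip[of x y] sx unfolding down_def by simp
      then show ?thesis using up_down_simple[OF Suc.prems(1) assms(2), of G] True
        by (simp add: \<epsilon>_def algebra_simps)
    next
      case False
      then have [simp]: "y = i" "x = Suc i" using xy by (auto simp: doubleton_eq_iff)
      have "up i (Suc i) (down i G) w = G w - down i (up i (Suc i) G) w"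
        unfolding eq_diff_eq by (rule up_down_simple[OF Suc.prems(1) assms(2)])
      moreover have "up x y (down i G) w = - up y x (down i G) w"
        using up_flip[of y x] sx by simp
      ultimately show ?thesis by (simp add: \<epsilon>_def)
    qed
    finally have y: "up x y (pieri (x # as) (B - {y}) m (down i F)) w = down i (up y x G) w + \<epsilon> * G w" .
    have b: "up x b (pieri (x # as) (B - {b}) m (down i F)) w
        = down i (up y b (pieri (y # as) (simple_refl i ` B - {b}) m F)) w + \<epsilon> * up x b (R (B - {b}) m) w"
      if "b \<in> B - {y}" for b
    proof -
      have "up x b (pieri (x # as) (B - {b}) m (down i F)) w
          = up x b (\<lambda>v. down i (pieri (y # as) (simple_refl i ` (B - {b})) m F) v + \<epsilon> * R (B - {b}) m v) w"
        using Suc.prems that sx by (intro up_cong Suc.IH) auto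
      also have "\<dots> = up x b (down i (pieri (y # as) (simple_refl i ` (B - {b})) m F)) w
          + \<epsilon> * up x b (R (B - {b}) m) w"
        by (simp add: up_add up_mult)
      also have "up x b (down i (pieri (y # as) (simple_refl i ` (B - {b})) m F)) w
          = down i (up y b (pieri (y # as) (simple_refl i ` (B - {b})) m F)) w"
        using up_down[of w i x b] Suc.prems assms(2) sx no'[OF that] by simp
      finally show ?thesis unfolding simple_refl_image_diff no'(2)[OF that] .
    qed
    have "pieri (x # as) B (Suc m) (down i F) w = down i (pieri as (simple_refl i ` B) (Suc m) F) w
        + (up x y (pieri (x # as) (B - {y}) m (down i F)) w
          + (\<Sum>b\<in>B - {y}. up x b (pieri (x # as) (B - {b}) m (down i F)) w))"
      using Suc.prems by (simp add: head sum.remove)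
    also have "\<dots> = down i (pieri as (simple_refl i ` B) (Suc m) F) w
        + (down i (up y x G) w + (\<Sum>b\<in>B - {y}. down i (up y b (pieri (y # as) (simple_refl i ` B - {b}) m F)) w))
        + \<epsilon> * (G w + (\<Sum>b\<in>B - {y}. up x b (R (B - {b}) m) w))"
      unfolding y by (simp add: b sum.distrib sum_distrib_left distrib_left)
    also have "G w + (\<Sum>b\<in>B - {y}. up x b (R (B - {b}) m) w) = R B (Suc m) w"
      unfolding R_Suc G_def ..
    also have "down i (up y x G) w + (\<Sum>b\<in>B - {y}. down i (up y b (pieri (y # as) (simple_refl i ` B - {b}) m F)) w)
        = (\<Sum>b\<in>simple_refl i ` B. down i (up y b (pieri (y # as) (simple_refl i ` B - {b}) m F)) w)"
      unfolding sB G_def using Suc.prems by (subst sum.insert) (auto simp: Diff_insert_absorb)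
    also have "down i (pieri as (simple_refl i ` B) (Suc m) F) w + \<dots>
        = down i (pieri (y # as) (simple_refl i ` B) (Suc m) F) w"
      by (simp add: pieri_Cons_Suc[of y] down_add down_sum)
    finally show ?case .
  qed
  from this[of "Suc m"] show ?thesis by (simp add: R_def)
qed

section \<open>Multiplication by complete symmetric polynomials\<close>

fun complete_sym :: "nat list \<Rightarrow> nat \<Rightarrow> mpol" where
  "complete_sym as 0 = 1"
| "complete_sym [] (Suc m) = 0"
| "complete_sym (a # as) (Suc m) = complete_sym as (Suc m) + var a * complete_sym (a # as) m"

lemma complete_sym_swap: "complete_sym (a # b # as) m = complete_sym (b # a # as) m"
proof (induction m rule: less_induct)
  case (less m)
  show ?case
  proof (cases m)
    case (Suc m)
    \<comment> \<open>Expanding each side of the claim twice, the terms without \<open>a\<close> and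
      \<open>b\<close> agree, and what remains to be compared is exactly this identity.\<close>
    have "(var a - var b) * complete_sym (a # b # as) m = var a * complete_sym (a # as) m - var b * complete_sym (b # as) m"
    proof (cases m)
      case (Suc k)
      have 1: "complete_sym (b # as) m = complete_sym (a # b # as) m - var a * complete_sym (a # b # as) k"
        using Suc by simp
      have 2: "complete_sym (a # as) m = complete_sym (a # b # as) m - var b * complete_sym (a # b # as) k"
      proof -
        have "complete_sym (a # b # as) m = complete_sym (b # a # as) m"
          using \<open>_ = Suc m\<close> by (intro less) simp
        also have "\<dots> = complete_sym (a # as) m + var b * complete_sym (b # a # as) k"
          by (simp add: Suc)
        also have "complete_sym (b # a # as) k = complete_sym (a # b # as) k"
          using \<open>_ = Suc m\<close> Suc by (intro less[symmetric]) simp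
        finally show ?thesis by simp
      qed
      show ?thesis by (simp only: 1 2 algebra_simps)
    qed simp
    then show ?thesis using less[of m] Suc by (simp add: algebra_simps)
  qed simp
qed

lemma complete_sym_mset_eq: "mset as = mset as' \<Longrightarrow> complete_sym as m = complete_sym as' m"
proof -
  have cong: "complete_sym (a # as) m = complete_sym (a # as') m"
    if "\<And>m. complete_sym as m = complete_sym as' m" for a as as' m
    using that by (induction m) auto
  have move: "complete_sym (xs @ a # ys) m = complete_sym (a # xs @ ys) m" for xs a ys m
  proof (induction xs arbitrary: m)
    case (Cons x xs)
    have "complete_sym (x # (xs @ a # ys)) m = complete_sym (x # (a # xs @ ys)) m"
      using Cons by (intro cong)
    then show ?case using complete_sym_swap by simp
  qed simp
  show "mset as = mset as' \<Longrightarrow> ?thesis"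
  proof (induction as arbitrary: as' m)
    case (Cons a as)
    then obtain xs ys where as': "as' = xs @ a # ys"
      by (metis list.set_intros(1) set_mset_mset split_list)
    then have "complete_sym (a # as) m = complete_sym (a # xs @ ys) m"
      using Cons by (intro cong) simp
    then show ?case unfolding as' move .
  qed simp
qed

lemma swap_vars_complete_sym:
  "swap_vars i (complete_sym as m) = complete_sym (map (simple_refl i) as) m"
  by (induction as m rule: complete_sym.induct) (simp_all add: swap_vars_var)

lemma homogeneous_complete_sym: "\<forall>a\<in>set as. 0 < a \<Longrightarrow> homogeneous m (complete_sym as m)"
proof (induction as m rule: complete_sym.induct)
  case (3 a as m)
  then show ?case
    using homogeneous_mult[of "Suc 0" "var a" m "complete_sym (a # as) m"] by (auto intro: homogeneous_add)
qed simp_all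

lemma swap_vars_complete_sym_same:
  assumes "distinct as" "i \<in> set as \<longleftrightarrow> Suc i \<in> set as"
  shows "mset (map (simple_refl i) as) = mset as" "swap_vars i (complete_sym as m) = complete_sym as m"
proof -
  have "distinct (map (simple_refl i) as)"
    using assms inj_on_subset[OF inj_simple_refl] by (simp add: distinct_map)
  moreover have "set (map (simple_refl i) as) = set as"
    using simple_refl_image_eq[OF assms(2)] by simp
  ultimately show "mset (map (simple_refl i) as) = mset as"
    using assms(1) set_eq_iff_mset_eq_distinct by blast
  then show "swap_vars i (complete_sym as m) = complete_sym as m"
    unfolding swap_vars_complete_sym by (rule complete_sym_mset_eq)
qed

text \<open>Expanding h_{m+1} of x, y, as along x and along y gives h_{m+1}(y,as) + x_x h_m(x,y,as)
  = h_{m+1}(x,as) + x_y h_m(x,y,as). The sign records which of \<open>x\<close>, \<open>y\<close> is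
  \<open>i\<close>.\<close>

lemma divided_difference_complete_sym:
  assumes "{x, y} = {i, Suc i}" "x \<notin> set as" "y \<notin> set as"
  shows "divided_difference i (complete_sym (x # as) (Suc m))
    = (if x = i then 1 else -1) * complete_sym (x # y # as) m"
proof (rule divided_difference_eqI)
  have "map (simple_refl i) as = as"
    using assms by (intro map_idI simple_refl_simps(3)) (auto simp: doubleton_eq_iff)
  then have "swap_vars i (complete_sym (x # as) (Suc m)) = complete_sym (y # as) (Suc m)"
    unfolding swap_vars_complete_sym using assms by (auto simp: doubleton_eq_iff)
  moreover have "complete_sym (y # as) (Suc m) + var x * complete_sym (x # y # as) m
      = complete_sym (x # as) (Suc m) + var y * complete_sym (x # y # as) m"
    using complete_sym_swap[of x y as "Suc m"] complete_sym_swap[of y x as m] by simp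
  ultimately show "complete_sym (x # as) (Suc m) - swap_vars i (complete_sym (x # as) (Suc m))
      = (var i - var (Suc i)) * ((if x = i then 1 else -1) * complete_sym (x # y # as) m)"
    using assms(1) by (auto simp: doubleton_eq_iff algebra_simps)
qed

section \<open>The product formula for arbitrary index sets\<close>

lemma homogeneous_pieri:
  assumes "fin_perm w" "\<forall>b\<in>B. 0 < b" "\<forall>a\<in>set as. 0 < a"
  shows "homogeneous (len w + m) (pieri as B m schubert w)"
  using assms
proof (induction as B m schubert w rule: pieri.induct)
  case (3 a as B m w)
  have "homogeneous (len w + Suc m) (up a b (pieri (a # as) (B - {b}) m schubert) w)" if "b \<in> B" for b
  proof (cases "len (w \<circ> transpose a b) = Suc (len w)")
    case True
    then show ?thesis
      using "3.hyps"(2)[OF that, of "w \<circ> transpose a b"] "3.prems" that unfolding up_def True by simp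
  qed (simp add: up_def)
  then show ?case using 3 by (auto intro!: homogeneous_add homogeneous_sum)
qed (simp_all add: homogeneous_schubert)

text \<open>A divided difference acts on values and commutes with all signed sums, so it reaches
  \<open>schubert\<close> itself, where it becomes \<open>down i\<close>, applied before all other
  operators.\<close>

lemma divided_difference_pieri:
  assumes "fin_perm w" "\<forall>b\<in>B. 0 < b" "\<forall>a\<in>set as. 0 < a" "0 < i"
  shows "divided_difference i (pieri as B m schubert w) = pieri as B m (down i schubert) w"
  using assms
proof (induction as B m schubert w rule: pieri.induct)
  case (3 a as B m w)
  have "divided_difference i (up a b (pieri (a # as) (B - {b}) m schubert) w)
      = up a b (pieri (a # as) (B - {b}) m (down i schubert)) w" if "b \<in> B" for b
    unfolding divided_difference_up
    using "3.hyps"(2)[OF that] "3.prems" that by (intro up_cong) auto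
  then show ?case using 3 by simp
qed (simp_all add: divided_difference_schubert)

theorem schubert_mult_complete_sym:
  assumes "w permutes {1..n}" "distinct as" "set as \<subseteq> {1..n}" "n + m \<le> N"
  shows "schubert w * complete_sym as m = pieri as ({1..N} - set as) m schubert w"
  using assms
proof (induction "m + len w" arbitrary: w n as m rule: less_induct)
  case less
  have w: "fin_perm w" using less.prems permutes_fin_perm by blast
  define B where "B = {1..N} - set as"
  show ?case
  proof (cases m)
    case (Suc m')
    have B: "finite B" "\<forall>b\<in>B. 0 < b" "set as \<inter> B = {}" "\<forall>a\<in>set as. 0 < a"
      unfolding B_def using less.prems(3) by auto
    have "schubert w * complete_sym as (Suc m') = pieri as B (Suc m') schubert w"
    proof (rule eq_if_divided_differences_eq)
      show "homogeneous (len w + Suc m') (schubert w * complete_sym as (Suc m'))"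
        using w B by (intro homogeneous_mult homogeneous_schubert homogeneous_complete_sym)
      show "homogeneous (len w + Suc m') (pieri as B (Suc m') schubert w)"
        using w B by (intro homogeneous_pieri)
      fix i :: nat assume i: "0 < i"
      have ws: "w \<circ> simple_refl i permutes {1..n} \<and> i < n \<and> len (w \<circ> simple_refl i) < len w"
        if "w (Suc i) < w i"
        using descent_less[OF less.prems(1) that] len_descent[OF w i that] less.prems(1) i
        unfolding simple_refl_def by (auto intro!: permutes_compose[OF permutes_swap_id])
      \<comment> \<open>The inclusion is demanded only for \<open>i < n\<close>: for
        \<open>i = n\<close> the list may contain n+1, but then \<open>i\<close> is no descent of
        \<open>w\<close> and both sides are 0.\<close>
      have IH: "down i schubert w * complete_sym cs (Suc m')
          = down i (pieri cs ({1..N} - set cs) (Suc m') schubert) w"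
        if "distinct cs" "i < n \<Longrightarrow> set cs \<subseteq> {1..n}" for cs
      proof (cases "w (Suc i) < w i")
        case True
        then show ?thesis
          using less.hyps[of m "w \<circ> simple_refl i" n cs] ws[OF True] that less.prems Suc by (simp add: down_def)
      qed (simp add: down_def)
      have lhs: "divided_difference i (schubert w * complete_sym as (Suc m'))
          = down i schubert w * swap_vars i (complete_sym as (Suc m'))
            + schubert w * divided_difference i (complete_sym as (Suc m'))"
        unfolding divided_difference_mult divided_difference_schubert[OF w i] ..
      have rhs: "divided_difference i (pieri as B (Suc m') schubert w) = pieri as B (Suc m') (down i schubert) w"
        using divided_difference_pieri w B i by blast
      show "divided_difference i (schubert w * complete_sym as (Suc m'))
          = divided_difference i (pieri as B (Suc m') schubert w)"
      proof (cases "i \<in> set as \<longleftrightarrow> Suc i \<in> set as")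
        case True
        note sym = swap_vars_complete_sym_same[OF less.prems(2) True]
        have no: "\<forall>a\<in>set as. \<forall>b\<in>B. {a, b} \<noteq> {i, Suc i}"
          using True B(3) by (auto simp: doubleton_eq_iff)
        have "divided_difference i (schubert w * complete_sym as (Suc m')) = down i schubert w * complete_sym as (Suc m')"
          unfolding lhs using sym(2)[of "Suc m'"] divided_difference_eq_0_iff[of i "complete_sym as (Suc m')"] by simp
        also have "\<dots> = down i (pieri as B (Suc m') schubert) w"
          unfolding B_def using less.prems by (intro IH)
        also have "\<dots> = down i (pieri (map (simple_refl i) as) (simple_refl i ` B) (Suc m') schubert) w"
        proof (cases "w (Suc i) < w i")
          case desc: True
          \<comment> \<open>The truncation at \<open>N\<close> could break this only at
            \<open>i = N\<close>; a descent at \<open>i\<close> forces \<open>i < n\<close>.\<close>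
          have "i \<in> B \<longleftrightarrow> Suc i \<in> B"
            unfolding B_def using True ws[OF desc] less.prems(4) i by auto
          then have "simple_refl i ` B = B" by (rule simple_refl_image_eq)
          then show ?thesis
            unfolding down_def using B w i less.prems(2) by (auto intro!: pieri_mset_eq sym(1)[symmetric])
        qed (simp add: down_def)
        also have "\<dots> = pieri as B (Suc m') (down i schubert) w"
          using pieri_down w i B no by metis
        finally show ?thesis unfolding rhs .
      next
        case False
        then obtain x y where xy: "{x, y} = {i, Suc i}" "x \<in> set as" "y \<notin> set as" by blast
        have lt: "i \<le> n" using xy less.prems(3) by (auto simp: doubleton_eq_iff)
        obtain cs where cs: "mset as = mset (x # cs)"
          using xy(2) by (metis ex_mset mset.simps(2) multi_member_split set_mset_mset)
        have d: "distinct (x # cs)" "set as = set (x # cs)"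
          using cs less.prems(2) mset_eq_imp_distinct_iff mset_eq_setD by (metis, metis)
        have x: "x \<notin> set cs" "y \<notin> set cs" "x \<noteq> y" using d xy by (auto simp: doubleton_eq_iff)
        have y: "y \<in> B" "x \<notin> B"
          using xy less.prems(4) lt Suc i unfolding B_def by (auto simp: doubleton_eq_iff)
        have sB: "simple_refl i ` B = {1..N} - set (y # cs)" "B - {y} = {1..N} - set (x # y # cs)"
        proof -
          show *: "B - {y} = {1..N} - set (x # y # cs)"
            unfolding B_def d(2) by auto
          have "simple_refl i ` (B - {y}) = (\<lambda>b. b) ` (B - {y})"
            using y(2) xy(1) by (intro image_cong simple_refl_simps(3)) (auto simp: doubleton_eq_iff)
          moreover have "simple_refl i y = x" using xy(1) by (auto simp: doubleton_eq_iff)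
          moreover have "B = insert y (B - {y})" using y by auto
          ultimately have "simple_refl i ` B = insert x (B - {y})"
            by (metis image_ident image_insert)
          also have "\<dots> = {1..N} - set (y # cs)"
            unfolding * using x xy(2) less.prems(3,4) by auto
          finally show "simple_refl i ` B = {1..N} - set (y # cs)" .
        qed
        define \<epsilon> :: mpol where "\<epsilon> = (if x = i then 1 else -1)"
        have c: "complete_sym as (Suc m') = complete_sym (x # cs) (Suc m')"
          using cs by (rule complete_sym_mset_eq)
        have sc: "swap_vars i (complete_sym (x # cs) (Suc m')) = complete_sym (y # cs) (Suc m')"
        proof -
          have "map (simple_refl i) cs = cs"
            using xy(1) x by (intro map_idI simple_refl_simps(3)) (auto simp: doubleton_eq_iff)
          then show ?thesis
            unfolding swap_vars_complete_sym using xy by (auto simp: doubleton_eq_iff)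
        qed
        have "divided_difference i (schubert w * complete_sym as (Suc m'))
            = down i schubert w * complete_sym (y # cs) (Suc m') + \<epsilon> * (schubert w * complete_sym (x # y # cs) m')"
          unfolding lhs unfolding c sc divided_difference_complete_sym[OF xy(1) x(1,2)] \<epsilon>_def by (simp only: ac_simps)
        also have "down i schubert w * complete_sym (y # cs) (Suc m')
            = down i (pieri (y # cs) (simple_refl i ` B) (Suc m') schubert) w"
          unfolding sB using d x less.prems(3) i xy by (intro IH) (auto simp: doubleton_eq_iff)
        also have "schubert w * complete_sym (x # y # cs) m' = pieri (x # y # cs) (B - {y}) m' schubert w"
          unfolding sB
        proof (rule less.hyps)
          \<comment> \<open>The added index may be n+1, so n grows by one while m drops by one; the
            bound by \<open>N\<close> is preserved.\<close>
          show "w permutes {1..Suc n}"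
            by (rule permutes_atLeastAtMost_mono[OF less.prems(1)]) simp
          show "set (x # y # cs) \<subseteq> {1..Suc n}"
            using less.prems(3) d xy lt i by (auto simp: doubleton_eq_iff)
        qed (use Suc d x less.prems(4) in auto)
        also have "down i (pieri (y # cs) (simple_refl i ` B) (Suc m') schubert) w
            + \<epsilon> * pieri (x # y # cs) (B - {y}) m' schubert w = pieri (x # cs) B (Suc m') (down i schubert) w"
          unfolding \<epsilon>_def using w i B d xy y x by (intro pieri_down_pair[symmetric]) auto
        also have "\<dots> = pieri as B (Suc m') (down i schubert) w"
          using cs w B less.prems(2) by (intro pieri_mset_eq[symmetric]) auto
        finally show ?thesis unfolding rhs .
      qed
    qed simp
    then show ?thesis unfolding Suc B_def .
  qed simp
qed

section \<open>Tower diagrams as inversion codes\<close>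

definition code :: "(nat \<Rightarrow> nat) \<Rightarrow> tower" where
  "code w p = card {y. y < inv w p \<and> p < w y}"

lemma mem_simple_refl_image: "y \<in> simple_refl i ` B \<longleftrightarrow> simple_refl i y \<in> B"
  by (metis image_iff simple_refl_invol(1))

lemma code_id: "code id = (\<lambda>_. 0)"
  unfolding code_def by auto

text \<open>The only pair whose left-right order changes is that of the values \<open>w i\<close>
  and \<open>w (Suc i)\<close>; the smaller one gains a larger value on its left.\<close>

lemma code_ascent:
  assumes w: "fin_perm w" and i: "0 < i" and asc: "w i < w (Suc i)"
  shows "code (w \<circ> simple_refl i) = (code w)(w i := Suc (code w (w i)))"
proof
  fix p
  have inv: "inv (w \<circ> simple_refl i) p = simple_refl i (inv w p)"
    using w i by (simp add: fin_perm_inv_comp)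
  consider "inv w p = i" | "inv w p = Suc i" | "inv w p \<noteq> i" "inv w p \<noteq> Suc i" by blast
  then show "code (w \<circ> simple_refl i) p = ((code w)(w i := Suc (code w (w i)))) p"
  proof cases
    case 1
    then have p: "p = w i" using w by (metis fin_perm_inv_apply(2))
    have "{y. y < Suc i \<and> p < (w \<circ> simple_refl i) y} = insert i {y. y < i \<and> p < w y}"
      using asc p by (auto simp: less_Suc_eq)
    then show ?thesis
      unfolding code_def inv 1 using p w by (simp add: fin_perm_inv_apply)
  next
    case 2
    then have p: "p = w (Suc i)" using w by (metis fin_perm_inv_apply(2))
    have "{y. y < i \<and> p < (w \<circ> simple_refl i) y} = {y. y < Suc i \<and> p < w y}"
      using asc p by (auto simp: less_Suc_eq)
    then show ?thesis
      unfolding code_def inv 2 using p asc 2 by simp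
  next
    case 3
    have "simple_refl i y < inv w p \<longleftrightarrow> y < inv w p" for y
      using 3 unfolding simple_refl_def transpose_def by auto
    then have "{y. y < inv w p \<and> p < (w \<circ> simple_refl i) y} = simple_refl i ` {y. y < inv w p \<and> p < w y}"
      by (intro set_eqI) (simp add: mem_simple_refl_image)
    moreover have "p \<noteq> w i" using 3 w by (auto simp: fin_perm_inv_apply)
    ultimately show ?thesis
      unfolding code_def inv using 3 by (simp add: card_image inj_on_subset[OF inj_simple_refl])
  qed
qed

text \<open>On reaching tower \<open>p\<close>, the sliding number \<open>s\<close> is \<open>p - 1\<close> plus the number of positions up to \<open>i\<close> that
  carry a value \<open>\<ge> p\<close>.\<close>

lemma slide_from_code:
  assumes w: "fin_perm w" and i: "0 < i" and "0 < p" "p \<le> w i" "p \<le> w (Suc i)"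
    and "s + 1 = p + card {y. y \<le> i \<and> p \<le> w y}"
  shows "slide_from p s (code w) = code (w \<circ> simple_refl i)"
  using assms(3-)
proof (induction "w i + w (Suc i) - p" arbitrary: p s rule: less_induct)
  case less
  define x where "x = inv w p"
  have x: "w x = p" unfolding x_def using w by (simp add: fin_perm_inv_apply)
  have weq: "w y = w z \<longleftrightarrow> y = z" for y z using fin_perm_eq_iff[OF w] .
  have ne: "w i \<noteq> w (Suc i)" using weq by simp
  have pw: "w y = p \<longleftrightarrow> y = x" for y using x weq[of y x] by simp
  have h: "code w p = card {y. y < x \<and> p < w y}" unfolding code_def x_def ..
  let ?R = "card {y. y \<le> i \<and> p \<le> w y}"
  have next_R: "card {y. y \<le> i \<and> Suc p \<le> w y} = (if x \<le> i then ?R - 1 else ?R)"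
  proof -
    have "y \<le> i \<and> Suc p \<le> w y \<longleftrightarrow> y \<le> i \<and> p \<le> w y \<and> y \<noteq> x" for y
      using pw[of y] by (auto simp: Suc_le_eq)
    then have "{y. y \<le> i \<and> Suc p \<le> w y} = {y. y \<le> i \<and> p \<le> w y} - {x}" by auto
    then show ?thesis using x by (simp add: card_Diff_singleton_if)
  qed
  \<comment> \<open>The slide stops at the smaller of the values \<open>w i\<close> and
    \<open>w (Suc i)\<close>. A value \<open>p\<close> below both sits either left of
    \<open>i\<close>, where the counted positions include \<open>i\<close> and \<open>x\<close>
    besides those of the tower and \<open>s\<close> passes unchanged, or right of
    \<open>Suc i\<close>, where \<open>Suc i\<close> itself adds to the tower and \<open>s\<close>
    grows by one.\<close>
  consider (stop1) "p = w i" | (stop2) "p = w (Suc i)" | (go) "p < w i" "p < w (Suc i)"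
    using less.prems by linarith
  then show ?case
  proof cases
    case stop1
    then have "x = i" using pw[of i] by simp
    then have "y \<le> i \<and> p \<le> w y \<longleftrightarrow> y = x \<or> y < x \<and> p < w y" for y
      using pw[of y] x by auto
    then have "{y. y \<le> i \<and> p \<le> w y} = insert x {y. y < x \<and> p < w y}" by auto
    then have s: "s = p + code w p" using less.prems(4) h by simp
    have "w i < w (Suc i)" using stop1 less.prems ne by simp
    then show ?thesis
      using code_ascent[OF w i] s stop1 by (subst slide_from.simps) simp
  next
    case stop2
    let ?v = "w \<circ> simple_refl i"
    have xi: "x = Suc i" using stop2 pw[of "Suc i"] by simp
    have desc: "w (Suc i) < w i" using stop2 less.prems ne by simp
    have "y \<le> i \<and> p \<le> w y \<longleftrightarrow> y < x \<and> p < w y" for y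
      using xi pw[of y] by auto
    then have "{y. y \<le> i \<and> p \<le> w y} = {y. y < x \<and> p < w y}" by auto
    then have s: "s + 1 = p + code w p" using less.prems(4) h by simp
    have "code w = (code ?v)(p := Suc (code ?v p))"
      using code_ascent[of ?v i] w i desc stop2 by simp
    then have "code w p \<ge> 1" "(code w)(p := code w p - 1) = code ?v"
      by (metis One_nat_def fun_upd_same le_add1 plus_1_eq_Suc,
          metis One_nat_def diff_Suc_Suc diff_zero fun_upd_same fun_upd_triv fun_upd_upd)
    then show ?thesis using s by (subst slide_from.simps) simp
  next
    case go
    then have xi: "x \<noteq> i" "x \<noteq> Suc i" using x by auto
    show ?thesis
    proof (cases "x < i")
      case True
      have "insert i (insert x {y. y < x \<and> p < w y}) \<subseteq> {y. y \<le> i \<and> p \<le> w y}"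
        using True x go by auto
      then have "card (insert i (insert x {y. y < x \<and> p < w y})) \<le> ?R"
        by (rule card_mono[rotated]) simp
      then have R: "Suc (Suc (code w p)) \<le> ?R" using True h by simp
      then have "slide_from p s (code w) = slide_from (Suc p) s (code w)"
        using less.prems(4) by (subst slide_from.simps) simp
      also have "\<dots> = code (w \<circ> simple_refl i)"
        using less.prems go R next_R True by (intro less.hyps) auto
      finally show ?thesis .
    next
      case False
      then have xi: "Suc i < x" using xi by simp
      have "p < w y \<and> y < x" if "y \<le> i" "p \<le> w y" for y
        using xi that pw[of y] by auto
      then have "insert (Suc i) {y. y \<le> i \<and> p \<le> w y} \<subseteq> {y. y < x \<and> p < w y}"
        using xi go by auto
      then have "card (insert (Suc i) {y. y \<le> i \<and> p \<le> w y}) \<le> code w p"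
        unfolding h by (rule card_mono[rotated]) simp
      then have R: "Suc ?R \<le> code w p" by simp
      then have "slide_from p s (code w) = slide_from (Suc p) (Suc s) (code w)"
        using less.prems(4) by (subst slide_from.simps) simp
      also have "\<dots> = code (w \<circ> simple_refl i)"
        using less.prems go next_R xi by (intro less.hyps) auto
      finally show ?thesis .
    qed
  qed
qed

lemma slide_code:
  assumes w: "fin_perm w" and i: "0 < i"
  shows "slide i (code w) = code (w \<circ> simple_refl i)"
  unfolding slide_def
proof (rule slide_from_code[OF w i])
  have pos: "1 \<le> w y \<longleftrightarrow> 1 \<le> y" for y
    by (simp add: Suc_le_eq fin_perm_pos_iff[OF w])
  have "{y. y \<le> i \<and> 1 \<le> w y} = {1..i}"
    unfolding pos by auto
  then show "i + 1 = 1 + card {y. y \<le> i \<and> 1 \<le> w y}" by simp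
  show "1 \<le> w i" "1 \<le> w (Suc i)"
    using i fin_perm_pos_iff[OF w, of i] fin_perm_pos_iff[OF w, of "Suc i"] by linarith+
qed simp

lemma slide_word_eq_code:
  "\<forall>p\<in>set \<alpha>. 0 < p \<Longrightarrow> slide_word \<alpha> (\<lambda>_. 0) = code (word_perm \<alpha>)"
proof (induction \<alpha> rule: rev_induct)
  case Nil
  have "slide_word [] (\<lambda>_. 0) = (\<lambda>_. 0)" by (simp add: slide_word_def)
  then show ?case unfolding word_perm_Nil code_id .
next
  case (snoc i \<alpha>)
  have "slide_word (\<alpha> @ [i]) (\<lambda>_. 0) = slide i (code (word_perm \<alpha>))"
    using snoc by (simp add: slide_word_def)
  also have "\<dots> = code (word_perm \<alpha> \<circ> simple_refl i)"
    using snoc by (intro slide_code) auto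
  also have "word_perm \<alpha> \<circ> simple_refl i = word_perm (\<alpha> @ [i])" by simp
  finally show ?case .
qed

lemma tower_of_eq_code:
  assumes "fin_perm w"
  shows "tower_of w = code w"
  using reduced_word_some[OF assms] slide_word_eq_code
  unfolding tower_of_def by (auto simp: reduced_word_iff)

text \<open>The positions of the values are recovered in increasing order: once the set
  \<open>A\<close> of positions of smaller values is known, \<open>p\<close> sits at the free
  position with exactly \<open>code w p\<close> free positions to its left.\<close>

lemma code_inject:
  assumes v: "fin_perm v" and w: "fin_perm w" and eq: "code v = code w"
  shows "v = w"
proof -
  have "inv v p = inv w p" for p
  proof (induction p rule: less_induct)
    case (less p)
    define A where "A = inv v ` {..<p}"
    have A: "A = inv w ` {..<p}" unfolding A_def using less by (intro image_cong) auto
    have code: "code u p = card ({..<inv u p} - inv u ` {..<p})" "inv u p \<notin> inv u ` {..<p}"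
      if u: "fin_perm u" for u
    proof -
      have "{y. y < inv u p \<and> p < u y} = {..<inv u p} - inv u ` {..<p}"
      proof (rule set_eqI)
        fix y
        have "y \<in> inv u ` {..<p} \<longleftrightarrow> u y < p"
          using u by (auto simp: fin_perm_inv_apply intro: image_eqI[of _ _ "u y"])
        moreover have "u y \<noteq> p" if "y < inv u p"
          using that u by (auto simp: fin_perm_inv_apply)
        ultimately show "y \<in> {y. y < inv u p \<and> p < u y} \<longleftrightarrow> y \<in> {..<inv u p} - inv u ` {..<p}"
          by fastforce
      qed
      then show "code u p = card ({..<inv u p} - inv u ` {..<p})" unfolding code_def by simp
      show "inv u p \<notin> inv u ` {..<p}"
        using fin_perm_eq_iff[OF fin_perm_inv[OF u]] by auto
    qed
    have lt: "card ({..<x} - A) < card ({..<y} - A)" if "x < y" "x \<notin> A" for x y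
      using that by (intro psubset_card_mono) auto
    have "card ({..<inv v p} - A) = card ({..<inv w p} - A)" "inv v p \<notin> A" "inv w p \<notin> A"
      using code[OF v] code[OF w] fun_cong[OF eq, of p] unfolding A_def[symmetric] A[symmetric] by auto
    then show ?case using lt by (metis linorder_neqE_nat nat_less_le)
  qed
  then have "inv v = inv w" by blast
  then show ?thesis
    using v w by (metis fin_perm_bij inv_inv_eq)
qed

lemma perm_of_tower_tower_of:
  "fin_perm w \<Longrightarrow> perm_of_tower (tower_of w) = w"
  unfolding perm_of_tower_def using tower_of_eq_code code_inject by (intro the_equality) auto

section \<open>Saturated chains\<close>

lemma chain_perm_Nil [simp]: "chain_perm w [] = w"
  and chain_perm_Cons [simp]: "chain_perm w ((a, b) # c) = chain_perm (w \<circ> transpose a b) c"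
  unfolding chain_perm_def by simp_all

fun rising :: "(nat \<Rightarrow> nat) \<Rightarrow> (nat \<times> nat) list \<Rightarrow> bool" where
  "rising w [] \<longleftrightarrow> True"
| "rising w ((a, b) # c) \<longleftrightarrow> len (w \<circ> transpose a b) = Suc (len w) \<and> rising (w \<circ> transpose a b) c"

lemma fin_perm_chain_perm:
  "fin_perm w \<Longrightarrow> \<forall>(a, b)\<in>set c. 0 < a \<and> 0 < b \<Longrightarrow> fin_perm (chain_perm w c)"
  by (induction w c rule: rising.induct) auto

lemma rising_iff:
  assumes "fin_perm w" "\<forall>(a, b)\<in>set c. 0 < a \<and> 0 < b"
  shows "rising w c \<longleftrightarrow> (\<forall>q<length c. coxeter_length (chain_perm w (take (Suc q) c))
      = coxeter_length (chain_perm w (take q c)) + 1)"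
  using assms
proof (induction c arbitrary: w)
  case (Cons x c)
  obtain a b where x: "x = (a, b)" by force
  have fp: "fin_perm (w \<circ> transpose a b)" using Cons.prems by (simp add: x)
  have "(\<forall>q<length ((a, b) # c). coxeter_length (chain_perm w (take (Suc q) ((a, b) # c)))
      = coxeter_length (chain_perm w (take q ((a, b) # c))) + 1) \<longleftrightarrow>
    coxeter_length (w \<circ> transpose a b) = Suc (coxeter_length w) \<and>
    (\<forall>q<length c. coxeter_length (chain_perm (w \<circ> transpose a b) (take (Suc q) c))
      = coxeter_length (chain_perm (w \<circ> transpose a b) (take q c)) + 1)"
    by (simp add: All_less_Suc2)
  then show ?case using Cons.IH[of "w \<circ> transpose a b"] Cons.prems fp unfolding x by (simp del: comp_apply)
qed simp

lemma saturated_chain_iff: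
  assumes "fin_perm w"
  shows "saturated_chain k m w c \<longleftrightarrow>
    length c = m \<and> (\<forall>(a, b)\<in>set c. 0 < a \<and> a \<le> k \<and> k < b) \<and> rising w c"
proof (cases "\<forall>(a, b)\<in>set c. 0 < a \<and> a \<le> k \<and> k < b")
  case True
  then have "\<forall>(a, b)\<in>set c. 0 < a \<and> 0 < b" by auto
  then show ?thesis
    unfolding saturated_chain_def using rising_iff[OF assms] by auto
qed (auto simp: saturated_chain_def)

section \<open>Expansion of the Pieri sums into chains\<close>

definition pieri_chains :: "nat \<Rightarrow> nat set \<Rightarrow> nat \<Rightarrow> (nat \<Rightarrow> nat) \<Rightarrow> (nat \<times> nat) list set" where
  "pieri_chains k B m w = {c. length c = m \<and> fst ` set c \<subseteq> {1..k} \<and> snd ` set c \<subseteq> B \<and> rising w c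
     \<and> sorted_wrt (\<ge>) (map fst c) \<and> distinct (map snd c)}"

lemma finite_pieri_chains:
  assumes "finite B"
  shows "finite (pieri_chains k B m w)"
proof (rule finite_subset)
  show "pieri_chains k B m w \<subseteq> {c. set c \<subseteq> {1..k} \<times> B \<and> length c = m}"
    unfolding pieri_chains_def by force
  show "finite {c. set c \<subseteq> {1..k} \<times> B \<and> length c = m}"
    using assms by (intro finite_lists_length_eq) simp
qed

lemma pieri_chains_0: "pieri_chains k B 0 w = {[]}"
  unfolding pieri_chains_def by auto

lemma pieri_chains_no_rows: "pieri_chains 0 B (Suc m) w = {}"
  unfolding pieri_chains_def by (auto simp: length_Suc_conv)

text \<open>As the first indices decrease, a chain that uses the largest index at all starts with
  it. This matches the recursion of \<open>pieri\<close> on the descending list.\<close>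

lemma pieri_chains_Suc_Suc:
  "pieri_chains (Suc k) B (Suc m) w = pieri_chains k B (Suc m) w \<union>
    (\<Union>b\<in>{b \<in> B. len (w \<circ> transpose (Suc k) b) = Suc (len w)}.
      (#) (Suc k, b) ` pieri_chains (Suc k) (B - {b}) m (w \<circ> transpose (Suc k) b))"
  (is "?L = ?M \<union> ?R")
proof (intro equalityI subsetI)
  fix c assume c: "c \<in> ?L"
  then obtain a b c' where c': "c = (a, b) # c'" unfolding pieri_chains_def by (cases c) auto
  show "c \<in> ?M \<union> ?R"
  proof (cases "a = Suc k")
    case True
    then show ?thesis using c unfolding c' pieri_chains_def by (auto intro!: imageI)
  next
    case False
    then have "a \<le> k" using c unfolding c' pieri_chains_def by auto
    then show ?thesis using c unfolding c' pieri_chains_def by fastforce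
  qed
next
  fix c assume "c \<in> ?M \<union> ?R"
  then show "c \<in> ?L"
  proof
    assume "c \<in> ?M"
    then show ?thesis unfolding pieri_chains_def by fastforce
  next
    assume "c \<in> ?R"
    then show ?thesis unfolding pieri_chains_def by fastforce
  qed
qed

text \<open>With \<open>B\<close> above \<open>k\<close> every factor has \<open>a < b\<close>, so
  no sign occurs.\<close>

lemma pieri_eq_sum_chains:
  assumes "finite B" "\<forall>b\<in>B. k < b"
  shows "pieri (rev [1..<Suc k]) B m F w = (\<Sum>c\<in>pieri_chains k B m w. F (chain_perm w c))"
  using assms
proof (induction k arbitrary: B m w)
  case 0
  then show ?case
    by (cases m) (simp_all add: pieri_chains_0 pieri_chains_no_rows)
next
  case (Suc k)
  note outer = Suc
  show ?case
    using Suc.prems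
  proof (induction m arbitrary: B w)
    case 0
    then show ?case by (simp add: pieri_chains_0)
  next
    case (Suc m)
    have rev: "rev [1..<Suc (Suc k)] = Suc k # rev [1..<Suc k]" by simp
    let ?w = "\<lambda>b. w \<circ> transpose (Suc k) b"
    let ?S = "{b \<in> B. len (?w b) = Suc (len w)}"
    let ?C = "\<lambda>b. (#) (Suc k, b) ` pieri_chains (Suc k) (B - {b}) m (?w b)"
    have first: "pieri (rev [1..<Suc k]) B (Suc m) F w = (\<Sum>c\<in>pieri_chains k B (Suc m) w. F (chain_perm w c))"
      using Suc.prems by (intro outer(1)) auto
    have up: "up (Suc k) b (pieri (rev [1..<Suc (Suc k)]) (B - {b}) m F) w
        = (if len (?w b) = Suc (len w) then \<Sum>c\<in>?C b. F (chain_perm w c) else 0)" if "b \<in> B" for b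
    proof -
      have "(\<Sum>c\<in>?C b. F (chain_perm w c)) = (\<Sum>c\<in>pieri_chains (Suc k) (B - {b}) m (?w b). F (chain_perm (?w b) c))"
        by (subst sum.reindex) (auto simp: inj_on_def)
      moreover have "pieri (rev [1..<Suc (Suc k)]) (B - {b}) m F (?w b)
          = (\<Sum>c\<in>pieri_chains (Suc k) (B - {b}) m (?w b). F (chain_perm (?w b) c))"
        using Suc.prems by (intro Suc.IH) auto
      ultimately show ?thesis
        using Suc.prems that unfolding up_def by simp
    qed
    have "(\<Sum>b\<in>B. up (Suc k) b (pieri (rev [1..<Suc (Suc k)]) (B - {b}) m F) w)
        = (\<Sum>b\<in>?S. \<Sum>c\<in>?C b. F (chain_perm w c))"
    proof -
      have "(\<Sum>b\<in>B. up (Suc k) b (pieri (rev [1..<Suc (Suc k)]) (B - {b}) m F) w)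
          = (\<Sum>b\<in>B. if len (?w b) = Suc (len w) then \<Sum>c\<in>?C b. F (chain_perm w c) else 0)"
        by (intro sum.cong refl up)
      also have "\<dots> = (\<Sum>b\<in>?S. \<Sum>c\<in>?C b. F (chain_perm w c))"
        by (rule sum.inter_filter[symmetric]) (rule Suc.prems(1))
      finally show ?thesis .
    qed
    also have "\<dots> = (\<Sum>c\<in>(\<Union>b\<in>?S. ?C b). F (chain_perm w c))"
      using Suc.prems(1) by (intro sum.UNION_disjoint[symmetric]) (auto simp: finite_pieri_chains)
    finally have second: "(\<Sum>b\<in>B. up (Suc k) b (pieri (rev [1..<Suc (Suc k)]) (B - {b}) m F) w) = \<dots>" .
    have disj: "pieri_chains k B (Suc m) w \<inter> (\<Union>b\<in>?S. ?C b) = {}"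
      by (auto simp: pieri_chains_def)
    have "pieri (rev [1..<Suc (Suc k)]) B (Suc m) F w = (\<Sum>c\<in>pieri_chains k B (Suc m) w. F (chain_perm w c))
        + (\<Sum>c\<in>(\<Union>b\<in>?S. ?C b). F (chain_perm w c))"
      unfolding second[symmetric] first[symmetric] unfolding rev pieri.simps(3) ..
    also have "\<dots> = (\<Sum>c\<in>pieri_chains (Suc k) B (Suc m) w. F (chain_perm w c))"
      unfolding pieri_chains_Suc_Suc using Suc.prems(1) disj
      by (intro sum.union_disjoint[symmetric]) (auto simp: finite_pieri_chains)
    finally show ?case .
  qed
qed

section \<open>Bounds on the positions in a chain\<close>

text \<open>If \<open>b\<close> exceeded n+1, the fixed point n+1 would lie between \<open>a\<close>
  and \<open>b\<close> in position and between \<open>w a\<close> and \<open>w b = b\<close> in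
  value.\<close>

lemma cover_bound:
  assumes w: "w permutes {1..n}" and ab: "0 < a" "a \<le> n" "a < b"
    and cov: "len (w \<circ> transpose a b) = Suc (len w)"
  shows "b \<le> Suc n" "w \<circ> transpose a b permutes {1..Suc n}"
proof -
  show b: "b \<le> Suc n"
  proof (rule ccontr)
    assume "\<not> b \<le> Suc n"
    moreover have "w a \<le> n" using permutes_in_image[OF w, of a] ab by simp
    ultimately have "Suc (len w) < len (w \<circ> transpose a b)"
      using w ab permutes_fin_perm[OF w]
      by (intro not_cover_between[where c = "Suc n"]) (auto simp: permutes_def)
    then show False using cov by simp
  qed
  show "w \<circ> transpose a b permutes {1..Suc n}"
    using b ab by (intro permutes_compose[OF permutes_swap_id] permutes_atLeastAtMost_mono[OF w]) auto
qed

lemma rising_bound: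
  assumes "w permutes {1..n}" "k \<le> n" "\<forall>(a, b)\<in>set c. 0 < a \<and> a \<le> k \<and> k < b" "rising w c"
  shows "\<forall>b\<in>snd ` set c. b \<le> n + length c"
  using assms
proof (induction c arbitrary: w n)
  case (Cons x c)
  obtain a b where x: "x = (a, b)" by force
  have *: "b \<le> Suc n" "w \<circ> transpose a b permutes {1..Suc n}"
    using cover_bound[of w n a b] Cons.prems unfolding x by auto
  have "\<forall>b\<in>snd ` set c. b \<le> Suc n + length c"
    using Cons.prems * unfolding x by (intro Cons.IH[of "w \<circ> transpose a b" "Suc n"]) (simp_all del: comp_apply)
  then show ?case using * unfolding x by auto
qed simp

lemma pieri_chains_eq:
  assumes w: "w permutes {1..n}" and "k \<le> n"
  shows "pieri_chains k {Suc k..n + m} m w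
    = {c. saturated_chain k m w c \<and> sorted_wrt (\<ge>) (map fst c) \<and> distinct (map snd c)}"
proof (intro equalityI subsetI)
  fix c assume "c \<in> pieri_chains k {Suc k..n + m} m w"
  then show "c \<in> {c. saturated_chain k m w c \<and> sorted_wrt (\<ge>) (map fst c) \<and> distinct (map snd c)}"
    unfolding pieri_chains_def saturated_chain_iff[OF permutes_fin_perm[OF w]] by fastforce
next
  fix c assume "c \<in> {c. saturated_chain k m w c \<and> sorted_wrt (\<ge>) (map fst c) \<and> distinct (map snd c)}"
  then show "c \<in> pieri_chains k {Suc k..n + m} m w"
    unfolding pieri_chains_def saturated_chain_iff[OF permutes_fin_perm[OF w]]
    using rising_bound[OF w \<open>k \<le> n\<close>, of c] by force
qed

section \<open>Labelled diagrams\<close>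

lemma fst_add_labels: "fst (add_labels w q L c) = tower_of (chain_perm w c)"
proof (induction c arbitrary: w q L)
  case (Cons x c)
  obtain a b where x: "x = (a, b)" by force
  show ?case unfolding x add_labels.simps chain_perm_Cons Let_def by (rule Cons.IH)
qed simp

lemma labels_add_labels:
  "fst ` snd (add_labels w q L c) = fst ` L \<union> set (zip [q..<q + length c] c)"
proof (induction c arbitrary: w q L)
  case (Cons x c)
  obtain a b where x: "x = (a, b)" by force
  have "[q..<q + length (x # c)] = q # [Suc q..<Suc q + length c]"
    by (simp add: upt_conv_Cons del: upt_Suc)
  then have zip: "set (zip [q..<q + length (x # c)] (x # c)) = insert (q, a, b) (set (zip [Suc q..<Suc q + length c] c))"
    unfolding x by simp
  show ?case
    unfolding zip unfolding x add_labels.simps Let_def Cons.IH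
    by (auto simp: image_image simp del: upt_Suc)
qed simp

lemma set_zip_upt: "set (zip [q..<q + length c] c) = (\<lambda>i. (q + i, c ! i)) ` {..<length c}"
  by (auto simp: set_zip) (metis nat_add_left_cancel_less nth_upt)

lemma zip_upt_inject:
  assumes "length c = length c'" "set (zip [q..<q + length c] c) = set (zip [q..<q + length c'] c')"
  shows "c = c'"
proof (rule nth_equalityI)
  fix i assume i: "i < length c"
  then have "(q + i, c ! i) \<in> set (zip [q..<q + length c] c)"
    by (force simp: set_zip)
  then have "(q + i, c ! i) \<in> set (zip [q..<q + length c'] c')"
    using assms(2) by simp
  then show "c ! i = c' ! i" by (auto simp: set_zip)
qed (rule assms(1))

text \<open>The labels record the steps of the chain with their numbers, whatever cells they are
  attached to.\<close>

lemma inj_on_add_labels: "inj_on (add_labels w 1 {}) {c. length c = m}"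
proof (rule inj_onI)
  fix c c' assume *: "c \<in> {c. length c = m}" "c' \<in> {c. length c = m}"
    "add_labels w 1 {} c = add_labels w 1 {} c'"
  then have "set (zip [1..<1 + length c] c) = set (zip [1..<1 + length c'] c')"
    using labels_add_labels[of w 1 "{}" c] labels_add_labels[of w 1 "{}" c']
    by (simp only: image_empty Un_empty_left)
  then show "c = c'" using zip_upt_inject[of c c' 1] * by (metis mem_Collect_eq)
qed

lemma weakly_decreasing_labels_iff:
  "weakly_decreasing_labels (add_labels w 1 {} c) \<longleftrightarrow> sorted_wrt (\<ge>) (map fst c)"
proof -
  have "weakly_decreasing_labels (add_labels w 1 {} c) \<longleftrightarrow>
      (\<forall>(q, a, b)\<in>fst ` snd (add_labels w 1 {} c). \<forall>(q', a', b')\<in>fst ` snd (add_labels w 1 {} c).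
        q \<le> q' \<longrightarrow> a \<ge> a')"
    unfolding weakly_decreasing_labels_def by fastforce
  also have "\<dots> \<longleftrightarrow> (\<forall>i\<in>{..<length c}. \<forall>j\<in>{..<length c}. i \<le> j \<longrightarrow> fst (c ! i) \<ge> fst (c ! j))"
    unfolding labels_add_labels set_zip_upt by (simp add: split_beta)
  also have "\<dots> \<longleftrightarrow> sorted_wrt (\<ge>) (map fst c)"
    unfolding sorted_wrt_iff_nth_less by (auto simp: le_less)
  finally show ?thesis .
qed

section \<open>Codes before and after a transposition\<close>

context
  fixes w :: "nat \<Rightarrow> nat" and a b :: nat
  assumes w: "fin_perm w" and ab: "0 < a" "a < b" "w a < w b"
begin

lemma inv_comp_transpose:
  "inv (w \<circ> transpose a b) (w a) = b" "inv (w \<circ> transpose a b) (w b) = a"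
  "p \<noteq> w a \<Longrightarrow> p \<noteq> w b \<Longrightarrow> inv (w \<circ> transpose a b) p = inv w p"
proof -
  have v: "fin_perm (w \<circ> transpose a b)" using w ab by simp
  show "inv (w \<circ> transpose a b) (w a) = b" "inv (w \<circ> transpose a b) (w b) = a"
    using fin_perm_inv_eq_iff[OF v] by simp_all
  assume p: "p \<noteq> w a" "p \<noteq> w b"
  then have "inv w p \<noteq> a" "inv w p \<noteq> b" using fin_perm_inv_apply(2)[OF w, of p] by auto
  then show "inv (w \<circ> transpose a b) p = inv w p"
    unfolding fin_perm_inv_eq_iff[OF v] using fin_perm_inv_apply(2)[OF w] by simp
qed

text \<open>Right of \<open>b\<close> the same values stand to the left; otherwise a larger value
  can only move in. An inequality is enough to keep labelled cells inside the diagram, and it holds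
  for any ascending pair.\<close>

lemma code_transpose_unchanged:
  assumes p: "p \<noteq> w a" "p \<noteq> w b"
  shows "code w p \<le> code (w \<circ> transpose a b) p"
proof -
  let ?v = "w \<circ> transpose a b"
  define x where "x = inv w p"
  have x: "x \<noteq> a" "x \<noteq> b" using fin_perm_inv_apply(2)[OF w, of p] p unfolding x_def by auto
  let ?A = "{y. y < x \<and> p < w y}" and ?A' = "{y. y < x \<and> p < ?v y}"
  have "card ?A \<le> card ?A'"
  proof (cases "b < x")
    case True
    have "?A = transpose a b ` ?A'"
      using True ab by (auto simp: image_iff transpose_def)
    then show ?thesis by (simp add: card_image_le)
  next
    case False
    have "?A \<subseteq> ?A'"
      using False x ab by (auto simp: transpose_def)
    then show ?thesis by (intro card_mono) auto
  qed
  then show ?thesis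
    unfolding code_def inv_comp_transpose(3)[OF p] x_def[symmetric] .
qed

lemma code_transpose_lowered:
  "code (w \<circ> transpose a b) (w b) = card {y. y < a \<and> w b < w y}"
  "code (w \<circ> transpose a b) (w b) \<le> code w (w b)"
proof -
  have eq: "{y. y < a \<and> w b < (w \<circ> transpose a b) y} = {y. y < a \<and> w b < w y}"
    using ab by (auto simp: transpose_def)
  then show "code (w \<circ> transpose a b) (w b) = card {y. y < a \<and> w b < w y}"
    unfolding code_def inv_comp_transpose by simp
  have "{y. y < a \<and> w b < w y} \<subseteq> {y. y < b \<and> w b < w y}" using ab by auto
  then have "card {y. y < a \<and> w b < w y} \<le> card {y. y < b \<and> w b < w y}"
    by (intro card_mono) auto
  then show "code (w \<circ> transpose a b) (w b) \<le> code w (w b)"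
    unfolding code_def inv_comp_transpose eq using w by (simp add: fin_perm_inv_apply)
qed

text \<open>The value \<open>w a\<close>, now at \<open>b\<close>, gains the value
  \<open>w b\<close> on its left and all values above \<open>w a\<close> strictly between the
  positions (\<open>?M\<close>). The tower of \<open>w b\<close> loses those above
  \<open>w b\<close> in between (\<open>?N\<close>), a subset of \<open>?M\<close>.\<close>

lemma code_transpose_raised:
  "code w (w a) + 1 + (code w (w b) - code (w \<circ> transpose a b) (w b)) \<le> code (w \<circ> transpose a b) (w a)"
proof -
  let ?v = "w \<circ> transpose a b"
  let ?S = "{y. y < a \<and> w a < w y}" and ?M = "{y. a < y \<and> y < b \<and> w a < w y}"
    and ?T = "{y. y < a \<and> w b < w y}" and ?N = "{y. a < y \<and> y < b \<and> w b < w y}"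
  have "code ?v (w a) = card {y. y < b \<and> w a < ?v y}"
    unfolding code_def inv_comp_transpose ..
  also have "{y. y < b \<and> w a < ?v y} = insert a (?S \<union> ?M)"
    using ab by (auto simp: transpose_def)
  also have "card \<dots> = Suc (card ?S + card ?M)"
    by (subst card_insert_disjoint) (auto intro!: card_Un_disjoint)
  finally have 1: "code ?v (w a) = Suc (code w (w a) + card ?M)"
    unfolding code_def using w by (simp add: fin_perm_inv_apply)
  have "code w (w b) = card {y. y < b \<and> w b < w y}"
    unfolding code_def using w by (simp add: fin_perm_inv_apply)
  also have "{y. y < b \<and> w b < w y} = ?T \<union> ?N"
  proof -
    have "y < b \<and> w b < w y \<longleftrightarrow> y < a \<and> w b < w y \<or> a < y \<and> y < b \<and> w b < w y" for y
      using ab by (cases y a rule: linorder_cases) auto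
    then show ?thesis by auto
  qed
  also have "card \<dots> = card ?T + card ?N"
    by (intro card_Un_disjoint) auto
  finally have 2: "code w (w b) - code ?v (w b) = card ?N"
    unfolding code_transpose_lowered by simp
  have "card ?N \<le> card ?M"
    using ab by (intro card_mono) auto
  then show ?thesis using 1 2 by simp
qed

end

text \<open>If the \<open>b\<close>s of a chain are distinct, no labelled cell is ever carried, and label \<open>(q, a, b)\<close>
  ends in the tower of the value at position \<open>b\<close>.\<close>

lemma add_labels_distinct:
  assumes "fin_perm w" "rising w c" "\<forall>(a, b)\<in>set c. 0 < a \<and> a \<le> k \<and> k < b" "distinct (map snd c)"
    and "\<forall>((q, a, b), (p, h))\<in>L. w b = p \<and> k < b \<and> b \<notin> snd ` set c"
  shows "\<forall>((q, a, b), (p, h))\<in>snd (add_labels w q L c). chain_perm w c b = p"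
  using assms
proof (induction c arbitrary: w q L)
  case (Cons x c)
  obtain a b where x: "x = (a, b)" by force
  let ?v = "w \<circ> transpose a b" and ?D = "tower_of w"
  let ?carry = "carry_cell ?D (w a) (w b) (?D (w b) - tower_of ?v (w b))"
  let ?L = "insert ((q, a, b), (w a, ?D (w a))) (apsnd ?carry ` L)"
  have w: "fin_perm w" by fact
  have ab: "0 < a" "a \<le> k" "k < b" "b \<notin> snd ` set c" using Cons.prems unfolding x by auto
  have old: "?v b' = p' \<and> k < b' \<and> b' \<notin> snd ` set c"
    if t: "((q', a', b'), (p, h)) \<in> L" "(p', h') = ?carry (p, h)" for q' a' b' p h p' h'
  proof -
    have p: "w b' = p" "k < b'" "b' \<notin> snd ` set c" "b' \<noteq> b"
      using bspec[OF Cons.prems(5) t(1)] unfolding x by auto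
    then have "p \<noteq> w b" using fin_perm_eq_iff[OF w, of b' b] by auto
    then have "p' = p" using t(2) by (simp add: carry_cell_def)
    moreover have "b' \<noteq> a" using p ab by auto
    ultimately show ?thesis using p by simp
  qed
  have "\<forall>((q, a, b), (p, h))\<in>snd (add_labels ?v (Suc q) ?L c). chain_perm ?v c b = p"
  proof (rule Cons.IH)
    show "fin_perm ?v" using w ab by simp
    show "\<forall>((q, a, b), (p, h))\<in>?L. ?v b = p \<and> k < b \<and> b \<notin> snd ` set c"
    proof
      fix y assume "y \<in> ?L"
      then consider "y = ((q, a, b), (w a, ?D (w a)))" | z where "z \<in> L" "y = apsnd ?carry z" by blast
      then show "(\<lambda>((q, a, b), (p, h)). ?v b = p \<and> k < b \<and> b \<notin> snd ` set c) y"
      proof cases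
        case 1
        then show ?thesis using ab by simp
      next
        case 2
        obtain q' a' b' p h where z: "z = ((q', a', b'), (p, h))" by (metis surj_pair)
        obtain p' h' where c: "?carry (p, h) = (p', h')" by force
        have "y = ((q', a', b'), (p', h'))" using 2(2) z c by simp
        then show ?thesis using old[OF 2(1)[unfolded z] c[symmetric]] by simp
      qed
    qed
  qed (use Cons.prems x in \<open>auto simp del: comp_apply\<close>)
  then show ?case unfolding x add_labels.simps chain_perm_Cons Let_def .
qed auto

text \<open>If the \<open>a\<close>s decrease, each label stays in the tower of a value at one of the positions \<open>b\<close> used
  so far: the level of the label is at least the number of larger values to the left of the
  current \<open>a\<close>, so that the cell is carried along when the value at its position \<open>b\<close> moves to \<open>a\<close>.\<close>

lemma add_labels_positions:
  assumes "fin_perm w" "rising w c" "\<forall>(a, b)\<in>set c. 0 < a \<and> a \<le> k \<and> k < b"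
    and "sorted_wrt (\<ge>) (map fst c)" "\<forall>a\<in>fst ` set c. a \<le> A" "\<forall>b\<in>U. k < b"
    and "\<forall>(t, (p, h))\<in>L. inv w p \<in> U \<and> h < code w p \<and> card {y. y < A \<and> p < w y} \<le> h"
  shows "\<forall>(t, (p, h))\<in>snd (add_labels w q L c). inv (chain_perm w c) p \<in> U \<union> snd ` set c"
  using assms
proof (induction c arbitrary: w q L A U)
  case (Cons x c)
  obtain a b where x: "x = (a, b)" by force
  let ?v = "w \<circ> transpose a b" and ?D = "tower_of w"
  let ?r = "?D (w b) - tower_of ?v (w b)"
  let ?L = "insert ((q, a, b), (w a, ?D (w a))) (apsnd (carry_cell ?D (w a) (w b) ?r) ` L)"
  have w: "fin_perm w" by fact
  have ab: "0 < a" "a \<le> k" "k < b" "a < b" "a \<le> A" using Cons.prems unfolding x by auto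
  have v: "fin_perm ?v" using w ab by simp
  have "w a < w b" using Cons.prems(2) len_transpose_less_iff[OF w, of a b] ab unfolding x by simp
  note ab = ab this
  note tower = tower_of_eq_code[OF w] tower_of_eq_code[OF v]
  note code = code_transpose_unchanged[OF w \<open>0 < a\<close> \<open>a < b\<close> \<open>w a < w b\<close>]
    code_transpose_lowered[OF w \<open>0 < a\<close> \<open>a < b\<close> \<open>w a < w b\<close>]
    code_transpose_raised[OF w \<open>0 < a\<close> \<open>a < b\<close> \<open>w a < w b\<close>]
  note inv = inv_comp_transpose[OF w \<open>0 < a\<close> \<open>a < b\<close> \<open>w a < w b\<close>]
  have below: "{y. y < a \<and> p < ?v y} = {y. y < a \<and> p < w y}" for p
    using ab by (auto simp: transpose_def)
  have code_a: "code w (w a) = card {y. y < a \<and> w a < w y}"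
    unfolding code_def using w by (simp add: fin_perm_inv_apply)
  have old: "inv ?v p' \<in> insert b U \<and> h' < code ?v p' \<and> card {y. y < a \<and> p' < ?v y} \<le> h'"
    if t: "(t, (p, h)) \<in> L" "(p', h') = carry_cell ?D (w a) (w b) ?r (p, h)" for t p h p' h'
  proof -
    have p: "inv w p \<in> U" "h < code w p" "card {y. y < A \<and> p < w y} \<le> h"
      using bspec[OF Cons.prems(7) t(1)] by simp_all
    have "card {y. y < a \<and> p < w y} \<le> card {y. y < A \<and> p < w y}"
      using ab by (intro card_mono) auto
    then have h: "card {y. y < a \<and> p < w y} \<le> h" using p(3) by simp
    have "k < inv w p" using p(1) Cons.prems(6) by blast
    then have pa: "p \<noteq> w a" using ab w by (auto simp: fin_perm_inv_apply)
    show ?thesis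
    proof (cases "p = w b")
      case True
      have r: "?r = code w (w b) - code ?v (w b)" unfolding tower ..
      \<comment> \<open>The left side is the new height of the lowered tower, the number of values
        above \<open>w b\<close> left of \<open>a\<close>. The invariant bounds this by
        \<open>h\<close>, so the labelled cell is among those removed.\<close>
      have "code w (w b) - ?r \<le> h"
        unfolding r using h code(2,3) True by simp
      then have "p' = w a" "h' = code w (w a) + 1 + (h - (code w (w b) - ?r))"
        using t(2) p(2) True by (simp_all add: carry_cell_def tower)
      \<comment> \<open>The carried cell is one of \<open>?r\<close> cells above the lowest new one,
        and the raised tower has room for all of them.\<close>
      moreover have "h - (code w (w b) - ?r) < ?r"
        using p(2) True \<open>code w (w b) - ?r \<le> h\<close> code(3) unfolding r by (simp add: diff_less_mono)
      ultimately show ?thesis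
        using code(4) code_a inv(1) unfolding below r by simp
    next
      case False
      then have "p' = p" "h' = h" using t(2) by (simp_all add: carry_cell_def)
      then show ?thesis
        unfolding below using inv(3)[OF pa False] code(1)[OF pa False] p h by simp
    qed
  qed
  have new: "inv ?v (w a) \<in> insert b U \<and> ?D (w a) < code ?v (w a) \<and> card {y. y < a \<and> w a < ?v y} \<le> ?D (w a)"
    unfolding below tower using inv(1) code(4) code_a by simp
  have "\<forall>(t, (p, h))\<in>snd (add_labels ?v (Suc q) ?L c). inv (chain_perm ?v c) p \<in> insert b U \<union> snd ` set c"
  proof (rule Cons.IH[where A = a])
    show "fin_perm ?v" by fact
    show "\<forall>(t, (p, h))\<in>?L. inv ?v p \<in> insert b U \<and> h < code ?v p \<and> card {y. y < a \<and> p < ?v y} \<le> h"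
    proof
      fix y assume "y \<in> ?L"
      then consider "y = ((q, a, b), (w a, ?D (w a)))"
        | z where "z \<in> L" "y = apsnd (carry_cell ?D (w a) (w b) ?r) z" by blast
      then show "case y of (t, (p, h)) \<Rightarrow>
          inv ?v p \<in> insert b U \<and> h < code ?v p \<and> card {y. y < a \<and> p < ?v y} \<le> h"
      proof cases
        case 1
        then show ?thesis using new by simp
      next
        case 2
        obtain t p h where z: "z = (t, (p, h))" by (metis surj_pair)
        obtain p' h' where c: "carry_cell ?D (w a) (w b) ?r (p, h) = (p', h')" by force
        have "y = (t, (p', h'))" using 2(2) z c by simp
        then show ?thesis using old[OF 2(1)[unfolded z] c[symmetric]] by simp
      qed
    qed
    show "\<forall>b\<in>insert b U. k < b" using ab Cons.prems(6) by simp
  qed (use Cons.prems x in \<open>auto simp del: comp_apply\<close>)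
  then show ?case unfolding x add_labels.simps chain_perm_Cons Let_def by simp
qed auto

text \<open>From right to left, each label sits in the tower of the value at its own
  \<open>b\<close>. From left to right, distinct towers belong to distinct positions, all among the
  b's; so there are at least as many different b's as labels, and none is repeated.\<close>

lemma labels_in_distinct_towers_iff:
  assumes w: "fin_perm w" and c: "rising w c" "\<forall>(a, b)\<in>set c. 0 < a \<and> a \<le> k \<and> k < b"
    and sorted: "sorted_wrt (\<ge>) (map fst c)"
  shows "labels_in_distinct_towers (add_labels w 1 {} c) \<longleftrightarrow> distinct (map snd c)"
proof
  let ?v = "chain_perm w c" and ?Z = "set (zip [1..<1 + length c] c)"
  have v: "fin_perm ?v" using w c(2) by (intro fin_perm_chain_perm) auto
  define L where "L = snd (add_labels w 1 {} c)"
  have labels: "fst ` L = ?Z" unfolding L_def labels_add_labels by simp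
  {
    assume dist: "labels_in_distinct_towers (add_labels w 1 {} c)"
    have "\<forall>t\<in>?Z. \<exists>x. (t, x) \<in> L" using labels by force
    then obtain f where f: "\<And>t. t \<in> ?Z \<Longrightarrow> (t, f t) \<in> L" by metis
    have sep: "t \<noteq> t' \<longrightarrow> p \<noteq> p'" if "(t, (p, h)) \<in> L" "(t', (p', h')) \<in> L" for t p h t' p' h'
      using dist that unfolding labels_in_distinct_towers_def L_def[symmetric] by fast
    have "inj_on (\<lambda>t. inv ?v (fst (f t))) ?Z"
    proof (rule inj_onI)
      fix t t' assume t: "t \<in> ?Z" "t' \<in> ?Z" "inv ?v (fst (f t)) = inv ?v (fst (f t'))"
      then have "fst (f t) = fst (f t')" using v by (metis fin_perm_inv_apply(2))
      moreover have "(t, (fst (f t), snd (f t))) \<in> L" "(t', (fst (f t'), snd (f t'))) \<in> L"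
        using f t by simp_all
      ultimately show "t = t'" using sep by blast
    qed
    moreover have "(\<lambda>t. inv ?v (fst (f t))) ` ?Z \<subseteq> snd ` set c"
    proof
      fix x assume "x \<in> (\<lambda>t. inv ?v (fst (f t))) ` ?Z"
      then obtain t where t: "t \<in> ?Z" "x = inv ?v (fst (f t))" by blast
      have "\<forall>(t, (p, h))\<in>L. inv ?v p \<in> {} \<union> snd ` set c"
        unfolding L_def using c sorted w
        by (intro add_labels_positions[where k = k and A = k]) auto
      then show "x \<in> snd ` set c" using f[OF t(1)] t(2) by (cases "f t") auto
    qed
    ultimately have "card ?Z \<le> card (snd ` set c)"
      by (metis card_image card_mono finite_imageI finite_set)
    moreover have "card ?Z = length c"
      unfolding set_zip_upt by (subst card_image) (auto simp: inj_on_def)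
    ultimately have "length (map snd c) \<le> card (set (map snd c))" by simp
    then show "distinct (map snd c)"
      by (metis card_distinct card_length le_antisym)
  }
  assume dist: "distinct (map snd c)"
  have pos: "\<forall>((q, a, b), (p, h))\<in>L. ?v b = p"
    unfolding L_def using dist c w by (intro add_labels_distinct[where k = k]) auto
  have "p \<noteq> p'" if "(t, p, h) \<in> L" "(t', p', h') \<in> L" "t \<noteq> t'" for t p h t' p' h'
  proof
    assume "p = p'"
    have "t \<in> ?Z" "t' \<in> ?Z" 
      using imageI[OF that(1), of fst] imageI[OF that(2), of fst] labels by simp_all
    then obtain i j where ij: "i < length c" "j < length c" "t = (1 + i, c ! i)" "t' = (1 + j, c ! j)"
      unfolding set_zip_upt by auto
    have "?v (snd (c ! i)) = p" "?v (snd (c ! j)) = p'"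
      using pos that ij by (auto split: prod.splits) (metis prod.collapse)+
    then have "snd (c ! i) = snd (c ! j)"
      using \<open>p = p'\<close> fin_perm_eq_iff[OF v, of "snd (c ! i)" "snd (c ! j)"] by simp
    then have "i = j"
      using dist ij by (simp add: distinct_conv_nth) (metis nth_map)
    then show False using that ij by simp
  qed
  then show "labels_in_distinct_towers (add_labels w 1 {} c)"
    unfolding labels_in_distinct_towers_def L_def[symmetric] by blast
qed

section \<open>The Schubert polynomial of the cycle\<close>

lemma pieri_cycle_apply:
  "pieri_cycle k m i = (if i = k then k + m else if k < i \<and> i \<le> k + m then i - 1 else i)"
proof (induction m)
  case 0
  then show ?case by (simp add: pieri_cycle_def)
next
  case (Suc m)
  have "pieri_cycle k (Suc m) = transpose (Suc (k + m)) (k + m) \<circ> pieri_cycle k m"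
    by (cases m) (simp_all add: pieri_cycle_def)
  then show ?case using Suc by (auto simp: transpose_def)
qed

lemma pieri_cycle_0: "pieri_cycle k 0 = id"
  by (rule ext) (simp add: pieri_cycle_apply)

text \<open>Removing the only descent \<open>k\<close> moves to the cycle for k+1 and m, just as the
  divided difference at \<open>k\<close> turns h_{m+1} in k variables into h_m in k+1
  variables.\<close>

lemma pieri_cycle_Suc: "pieri_cycle k (Suc m) \<circ> simple_refl k = pieri_cycle (Suc k) m"
  by (rule ext) (auto simp: pieri_cycle_apply simple_refl_def transpose_def)

lemma fin_perm_pieri_cycle: "0 < k \<Longrightarrow> fin_perm (pieri_cycle k m)"
proof (induction m arbitrary: k)
  case (Suc m)
  then have "fin_perm (pieri_cycle (Suc k) m \<circ> simple_refl k)"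
    by (intro fin_perm_comp) auto
  then show ?case unfolding pieri_cycle_Suc[symmetric] by simp
qed (simp add: pieri_cycle_0)

lemma pieri_cycle_descent: "pieri_cycle k m (Suc i) < pieri_cycle k m i \<longleftrightarrow> i = k \<and> 0 < m"
  by (auto simp: pieri_cycle_apply)

lemma len_pieri_cycle: "0 < k \<Longrightarrow> len (pieri_cycle k m) = m"
proof (induction m arbitrary: k)
  case (Suc m)
  have "len (pieri_cycle k (Suc m)) = Suc (len (pieri_cycle k (Suc m) \<circ> simple_refl k))"
    using Suc.prems fin_perm_pieri_cycle pieri_cycle_descent by (intro len_descent) auto
  then show ?case unfolding pieri_cycle_Suc using Suc by simp
qed (simp only: pieri_cycle_0 len_id)

lemma schubert_pieri_cycle: "0 < k \<Longrightarrow> schubert (pieri_cycle k m) = complete_sym (rev [1..<Suc k]) m"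
proof (induction m arbitrary: k)
  case 0
  then show ?case by (simp only: pieri_cycle_0 schubert_id complete_sym.simps)
next
  case (Suc m)
  note fp = fin_perm_pieri_cycle[OF Suc.prems]
  show ?case
  proof (rule eq_if_divided_differences_eq)
    show "homogeneous (Suc m) (schubert (pieri_cycle k (Suc m)))"
      using homogeneous_schubert[OF fp] len_pieri_cycle[OF Suc.prems] by metis
    show "homogeneous (Suc m) (complete_sym (rev [1..<Suc k]) (Suc m))"
      by (rule homogeneous_complete_sym) auto
    fix i :: nat assume i: "0 < i"
    show "divided_difference i (schubert (pieri_cycle k (Suc m)))
        = divided_difference i (complete_sym (rev [1..<Suc k]) (Suc m))"
    proof (cases "i = k")
      case True
      have "divided_difference i (schubert (pieri_cycle k (Suc m))) = schubert (pieri_cycle (Suc k) m)"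
        using divided_difference_schubert[OF fp i] True
        by (simp add: down_def pieri_cycle_descent pieri_cycle_Suc)
      also have "\<dots> = complete_sym (rev [1..<Suc (Suc k)]) m"
        by (rule Suc.IH) simp
      \<comment> \<open>The list is reordered so that the exchanged pair stands in front.\<close>
      also have "\<dots> = complete_sym (k # Suc k # rev [1..<k]) m"
        using Suc.prems by (intro complete_sym_mset_eq) simp
      also have "\<dots> = divided_difference i (complete_sym (k # rev [1..<k]) (Suc m))"
        unfolding True by (subst divided_difference_complete_sym[where y = "Suc k"]) auto
      also have "k # rev [1..<k] = rev [1..<Suc k]" using Suc.prems by simp
      finally show ?thesis .
    next
      case False
      have "i \<in> set (rev [1..<Suc k]) \<longleftrightarrow> Suc i \<in> set (rev [1..<Suc k])" using False i by auto
      then have "swap_vars i (complete_sym (rev [1..<Suc k]) (Suc m)) = complete_sym (rev [1..<Suc k]) (Suc m)"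
        by (intro swap_vars_complete_sym_same) auto
      then have "divided_difference i (complete_sym (rev [1..<Suc k]) (Suc m)) = 0"
        unfolding divided_difference_eq_0_iff .
      then show ?thesis
        using divided_difference_schubert[OF fp i] False by (simp add: down_def pieri_cycle_descent)
    qed
  qed simp
qed

section \<open>The Pieri rule\<close>

lemma pieri_diagrams_eq:
  assumes w: "w permutes {1..n}" and "k \<le> n"
  shows "pieri_diagrams k m w = add_labels w 1 {} ` pieri_chains k {Suc k..n + m} m w"
proof -
  have fp: "fin_perm w" using w permutes_fin_perm by blast
  have *: "weakly_decreasing_labels (add_labels w 1 {} c) \<and> labels_in_distinct_towers (add_labels w 1 {} c)
      \<longleftrightarrow> sorted_wrt (\<ge>) (map fst c) \<and> distinct (map snd c)" if "saturated_chain k m w c" for c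
    using that labels_in_distinct_towers_iff[OF fp, of c k]
    unfolding weakly_decreasing_labels_iff saturated_chain_iff[OF fp] by blast
  show ?thesis
    unfolding pieri_diagrams_def chain_diagrams_def pieri_chains_eq[OF assms] using * by blast
qed

theorem theorem6p2:
  fixes n k m :: nat and \<omega> :: "nat \<Rightarrow> nat"
  assumes "0 < n" and "0 < k" and "0 < m" and "k + m \<le> n"
    and "\<omega> permutes {1..n}"
  shows "schubert \<omega> * schubert (pieri_cycle k m)
           = (\<Sum>X\<in>pieri_diagrams k m \<omega>. schubert (perm_of_tower (fst X)))"
proof -
  let ?B = "{Suc k..n + m}" and ?as = "rev [1..<Suc k]"
  let ?C = "pieri_chains k ?B m \<omega>"
  have fp: "fin_perm \<omega>" using assms(5) permutes_fin_perm by blast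
  have B: "{1..n + m} - set ?as = ?B" by auto
  have "schubert \<omega> * schubert (pieri_cycle k m) = schubert \<omega> * complete_sym ?as m"
    using schubert_pieri_cycle[OF \<open>0 < k\<close>] by simp
  also have "\<dots> = pieri ?as ?B m schubert \<omega>"
    unfolding B[symmetric] using assms by (intro schubert_mult_complete_sym[where n = n]) auto
  also have "\<dots> = (\<Sum>c\<in>?C. schubert (chain_perm \<omega> c))"
    by (rule pieri_eq_sum_chains) auto
  also have "\<dots> = (\<Sum>c\<in>?C. schubert (perm_of_tower (fst (add_labels \<omega> 1 {} c))))"
  proof (intro sum.cong refl)
    fix c assume "c \<in> ?C"
    then have "\<forall>(a, b)\<in>set c. 0 < a \<and> 0 < b" unfolding pieri_chains_def by fastforce
    then show "schubert (chain_perm \<omega> c) = schubert (perm_of_tower (fst (add_labels \<omega> 1 {} c)))"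
      unfolding fst_add_labels using fin_perm_chain_perm[OF fp] perm_of_tower_tower_of by simp
  qed
  also have "\<dots> = (\<Sum>X\<in>pieri_diagrams k m \<omega>. schubert (perm_of_tower (fst X)))"
  proof -
    \<comment> \<open>Distinct chains may end in the same diagram; the labels keep them apart, so
      the sum over labelled diagrams has the right multiplicities.\<close>
    have "inj_on (add_labels \<omega> 1 {}) ?C"
      by (rule inj_on_subset[OF inj_on_add_labels[of \<omega> m]]) (auto simp: pieri_chains_def)
    moreover have "pieri_diagrams k m \<omega> = add_labels \<omega> 1 {} ` ?C"
      using assms by (intro pieri_diagrams_eq) auto
    ultimately show ?thesis by (simp add: sum.reindex)
  qed
  finally show ?thesis .
qed

end
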